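(* Let $\Bbbk$ be a field, $1\le m\le n$ and $\alpha\in\mathscr P_{m,n}$. The Specht module $S_{m,n}(\alpha)$ of $H^m_n$ has simple head isomorphic to $D_{m,n}(\mathrm{reg}(\alpha))\langle d(\alpha)\rangle$.
   Context: **Dyck paths.** Partitions are identified with Young diagrams $\{[r,c]:1\le c\le\lambda_r\}$. $\mathscr P_{m,n}$ is the set of partitions with $\lambda_1\le m$ and at most $n$ nonzero parts; $\mathscr R_{m,n}\subseteq\mathscr P_{m,n}$ is the set of those containing $(m,m-1,\dots,1)$. The content of $[r,c]$ is $r-c$. A Dyck path (in the rectangle $1\le r\le n$, $1\le c\le m$) is a non-empty sequence of tiles $[r_1,c_1],\dots,[r_s,c_s]$ with $[r_{i+1},c_{i+1}]\in\{[r_i+1,c_i],[r_i,c_i-1]\}$ and $\min_i(r_i+c_i-1)=r_1+c_1-1=r_s+c_s-1$. Its contents form the interval from $\mathrm{first}(P)=r_1-c_1$ to $\mathrm{last}(P)=r_s-c_s$; its breadth is $b(P)=\frac12(s+1)$; its height is $\mathrm{ht}(P)=r_1+c_1-1-m$. Dyck paths with the same content interval are identified (individual ones are called representatives), and expressions such as $Q\setminus P$ and containment refer to content intervals. $P,Q$ are adjacent if their content intervals are disjoint with union an interval. $P\prec Q$ means $\mathrm{first}(Q)<\mathrm{first}(P)$ and $\mathrm{last}(P)<\mathrm{last}(Q)$. $\mathrm{DRem}(\mu)$: those $P$ with a representative $P_b\subseteq\mu$ such that $\mu-P:=\mu\setminus P_b\in\mathscr P_{m,n}$. $\mathrm{DAdd}(\mu)$: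 those $P$ with a representative $P_b$ disjoint from $\mu$ such that $\mu+P:=\mu\sqcup P_b\in\mathscr P_{m,n}$; $\mathrm{DAdd}_k(\mu)$ is the subset with $\mathrm{ht}(P_b)=k$. $P,Q\in\mathrm{DRem}(\mu)$ commute if $P\in\mathrm{DRem}(\mu-Q)$ and $Q\in\mathrm{DRem}(\mu-P)$. For $P\in\mathrm{DRem}(\mu)$ and $Q\in\mathrm{DRem}(\mu-P)$ adjacent, $\langle P\cup Q\rangle_\mu$ is (if it exists) the smallest element of $\mathrm{DRem}(\mu)$ containing $P\cup Q$. **Regularisation.** The defect of $\alpha\in\mathscr P_{m,n}$ is $d(\alpha)=d-m\le0$, where $0\le d\le m$ is maximal with $(d,d-1,\dots,1)\subseteq\alpha$. Put $\mathrm{reg}_{d(\alpha)}(\alpha)=\alpha$ and, for $k=d(\alpha)+1,\dots,0$, $\mathrm{reg}_k(\alpha)=\mathrm{reg}_{k-1}(\alpha)+P^k$, where $P^k$ is the element of $\mathrm{DAdd}_k(\mathrm{reg}_{k-1}(\alpha))$ of maximal breadth. Then $\mathrm{reg}(\alpha)=\mathrm{reg}_0(\alpha)\in\mathscr R_{m,n}$. **The algebras.** The extended Khovanov arc algebra $K^m_n$ is the associative $\Bbbk$-algebra (unit $\sum_\mu\mathsf 1_\mu$) generated by $\mathsf 1_\mu$ ($\mu\in\mathscr P_{m,n}$, degree $0$) and $D^\lambda_\mu,D^\mu_\lambda$ (for $\lambda=\mu-P$, $P\in\mathrm{DRem}(\mu)$; degree $1$), subject to the following relations and their duals (images under the anti-involution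 fixing each $\mathsf 1_\mu$ and swapping $D^\lambda_\mu\leftrightarrow D^\mu_\lambda$): - $\mathsf 1_\mu\mathsf 1_\lambda=\delta_{\lambda\mu}\mathsf 1_\lambda$, $\mathsf 1_\lambda D^\lambda_\mu\mathsf 1_\mu=D^\lambda_\mu$. - For $P\in\mathrm{DRem}(\mu)$, $\lambda=\mu-P$: $D^\lambda_\mu D^\mu_\lambda=(-1)^{b(P)-1}\big(2\sum_{Q}(-1)^{b(Q)}D^\lambda_{\lambda-Q}D^{\lambda-Q}_\lambda+\sum_{Q'}(-1)^{b(Q')}D^\lambda_{\lambda-Q'}D^{\lambda-Q'}_\lambda\big)$, with $Q$ over $Q\in\mathrm{DRem}(\lambda)$, $P\prec Q$, and $Q'$ over $Q'\in\mathrm{DRem}(\lambda)$ adjacent to $P$. - For commuting $P,Q\in\mathrm{DRem}(\mu)$: $D^{\mu-P-Q}_{\mu-P}D^{\mu-P}_\mu=D^{\mu-P-Q}_{\mu-Q}D^{\mu-Q}_\mu$ and $D^{\mu-P}_\mu D^\mu_{\mu-Q}=D^{\mu-P}_{\mu-P-Q}D^{\mu-P-Q}_{\mu-Q}$. - For $P\prec Q$ in $\mathrm{DRem}(\mu)$ not commuting, $Q\setminus P=Q^1\sqcup Q^2$ with $Q^1,Q^2\in\mathrm{DRem}(\mu-P)$, and $D^{\mu-Q}_\mu D^\mu_{\mu-P}=D^{\mu-Q}_{\mu-P-Q^1}D^{\mu-P-Q^1}_{\mu-P}=D^{\mu-Q}_{\mu-P-Q^2}D^{\mu-P-Q^2}_{\mu-P}$.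 - For $P\in\mathrm{DRem}(\mu)$ and $Q\in\mathrm{DRem}(\mu-P)$ adjacent: $D^{\mu-P-Q}_{\mu-P}D^{\mu-P}_\mu=(-1)^{b(\langle P\cup Q\rangle_\mu)-b(Q)}D^{\mu-P-Q}_{\mu-\langle P\cup Q\rangle_\mu}D^{\mu-\langle P\cup Q\rangle_\mu}_\mu$ if $\langle P\cup Q\rangle_\mu$ exists, and $0$ otherwise. Put $e=\sum_{\lambda\in\mathscr R_{m,n}}\mathsf 1_\lambda$ and $H^m_n=eK^m_ne$. The standard (graded, right) $K^m_n$-module is $\Delta_{m,n}(\lambda)=\mathsf 1_\lambda K^m_n/\mathsf 1_\lambda K^m_n(\sum_{\mu\subsetneq\lambda}\mathsf 1_\mu)K^m_n$, with the image of $\mathsf 1_\lambda$ in degree $0$, and $L_{m,n}(\lambda)=\Delta_{m,n}(\lambda)/\mathrm{rad}(\Delta_{m,n}(\lambda))$ (concentrated in degree $0$). The Specht module is the right $H^m_n$-module $S_{m,n}(\lambda)=\Delta_{m,n}(\lambda)e$, and $D_{m,n}(\mu)=L_{m,n}(\mu)e$ for $\mu\in\mathscr R_{m,n}$ are the simple $H^m_n$-modules. Grading shift: $(M\langle k\rangle)_j=M_{j+k}$, so $D_{m,n}(\mathrm{reg}(\alpha))\langle d(\alpha)\rangle$ is concentrated in degree $-d(\alpha)$. *)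

theory Defs
  imports "HOL-Library.Poly_Mapping" "HOL-Algebra.QuotRing"
begin

section \<open>Partitions and Dyck paths\<close>

text \<open>A tile \<open>[r,c]\<close> is the pair \<open>(r, c)\<close>, with rows and columns counted from 1.\<close>

type_synonym tile = "nat \<times> nat"
type_synonym diagram = "tile set"

definition young :: "(nat \<Rightarrow> nat) \<Rightarrow> diagram" where
  "young l = {(r, c). 1 \<le> r \<and> 1 \<le> c \<and> c \<le> l r}"

definition Pmn :: "nat \<Rightarrow> nat \<Rightarrow> diagram set" where
  "Pmn m n = {young l | l. (\<forall>r\<ge>1. l (Suc r) \<le> l r) \<and> l 1 \<le> m \<and> (\<forall>r>n. l r = 0)}"

text \<open>The staircase \<open>(d, d-1, \<dots>, 1)\<close>.\<close>

definition staircase :: "nat \<Rightarrow> diagram" where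
  "staircase d = young (\<lambda>r. d + 1 - r)"

definition Rmn :: "nat \<Rightarrow> nat \<Rightarrow> diagram set" where
  "Rmn m n = {\<mu> \<in> Pmn m n. staircase m \<subseteq> \<mu>}"

definition content :: "tile \<Rightarrow> int" where
  "content t = int (fst t) - int (snd t)"

definition level :: "tile \<Rightarrow> nat" where
  "level t = fst t + snd t - 1"

definition dyck_step :: "tile \<Rightarrow> tile \<Rightarrow> bool" where
  "dyck_step s t \<longleftrightarrow>
     (fst t = fst s + 1 \<and> snd t = snd s) \<or> (fst t = fst s \<and> snd t + 1 = snd s)"

definition dyck_path :: "nat \<Rightarrow> nat \<Rightarrow> tile list \<Rightarrow> bool" where
  "dyck_path m n p \<longleftrightarrow> p \<noteq> [] \<and> set p \<subseteq> {1..n} \<times> {1..m} \<and> successively dyck_step p \<and>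
     Min (level ` set p) = level (hd p) \<and> level (hd p) = level (last p)"

definition height :: "nat \<Rightarrow> tile list \<Rightarrow> int" where
  "height m p = int (level (hd p)) - int m"

text \<open>
  Dyck paths up to identification are represented by their sets of contents, so that
  containment, set difference and disjointness of Dyck paths are those of sets of integers.
\<close>

type_synonym dpath = "int set"

definition contents :: "tile list \<Rightarrow> dpath" where
  "contents p = content ` set p"

text \<open>Contents strictly increase along a path, so the cardinality is the number of tiles.\<close>

definition breadth :: "dpath \<Rightarrow> nat" where
  "breadth P = (card P + 1) div 2"

definition adjacent :: "dpath \<Rightarrow> dpath \<Rightarrow> bool" where
  "adjacent P Q \<longleftrightarrow> P \<inter> Q = {} \<and> (\<exists>a b. P \<union> Q = {a..b})"

definition prec :: "dpath \<Rightarrow> dpath \<Rightarrow> bool" (infix \<open>\<prec>\<close> 50) where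
  "P \<prec> Q \<longleftrightarrow> Min Q < Min P \<and> Max P < Max Q"

definition removable :: "nat \<Rightarrow> nat \<Rightarrow> diagram \<Rightarrow> tile list \<Rightarrow> bool" where
  "removable m n \<mu> p \<longleftrightarrow> dyck_path m n p \<and> set p \<subseteq> \<mu> \<and> \<mu> - set p \<in> Pmn m n"

definition addable :: "nat \<Rightarrow> nat \<Rightarrow> diagram \<Rightarrow> tile list \<Rightarrow> bool" where
  "addable m n \<mu> p \<longleftrightarrow> dyck_path m n p \<and> set p \<inter> \<mu> = {} \<and> \<mu> \<union> set p \<in> Pmn m n"

definition DRem :: "nat \<Rightarrow> nat \<Rightarrow> diagram \<Rightarrow> dpath set" where
  "DRem m n \<mu> = {contents p | p. removable m n \<mu> p}"

definition DAdd :: "nat \<Rightarrow> nat \<Rightarrow> int \<Rightarrow> diagram \<Rightarrow> dpath set" where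
  "DAdd m n k \<mu> = {contents p | p. addable m n \<mu> p \<and> height m p = k}"

text \<open>
  The removable (addable) representative with given contents is unique, as on every diagonal
  only the last tile of \<open>\<mu>\<close> can be removed (only the first tile outside \<open>\<mu>\<close> can be added).
\<close>

definition dminus :: "nat \<Rightarrow> nat \<Rightarrow> diagram \<Rightarrow> dpath \<Rightarrow> diagram" where
  "dminus m n \<mu> P = (THE \<nu>. \<exists>p. removable m n \<mu> p \<and> contents p = P \<and> \<nu> = \<mu> - set p)"

definition dplus :: "nat \<Rightarrow> nat \<Rightarrow> diagram \<Rightarrow> dpath \<Rightarrow> diagram" where
  "dplus m n \<mu> P = (THE \<nu>. \<exists>p. addable m n \<mu> p \<and> contents p = P \<and> \<nu> = \<mu> \<union> set p)"

definition commuting :: "nat \<Rightarrow> nat \<Rightarrow> diagram \<Rightarrow> dpath \<Rightarrow> dpath \<Rightarrow> bool" where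
  "commuting m n \<mu> P Q \<longleftrightarrow> P \<in> DRem m n \<mu> \<and> Q \<in> DRem m n \<mu> \<and>
     P \<in> DRem m n (dminus m n \<mu> Q) \<and> Q \<in> DRem m n (dminus m n \<mu> P)"

text \<open>\<open>is_join m n \<mu> P Q R\<close>: the path \<open>\<langle>P \<union> Q\<rangle>\<^sub>\<mu>\<close> exists and is equal to \<open>R\<close>.\<close>

definition is_join :: "nat \<Rightarrow> nat \<Rightarrow> diagram \<Rightarrow> dpath \<Rightarrow> dpath \<Rightarrow> dpath \<Rightarrow> bool" where
  "is_join m n \<mu> P Q R \<longleftrightarrow> R \<in> DRem m n \<mu> \<and> P \<union> Q \<subseteq> R \<and>
     (\<forall>R' \<in> DRem m n \<mu>. P \<union> Q \<subseteq> R' \<longrightarrow> R \<subseteq> R')"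


section \<open>Regularisation\<close>

definition defect :: "nat \<Rightarrow> diagram \<Rightarrow> int" where
  "defect m \<alpha> = int (Max {d. d \<le> m \<and> staircase d \<subseteq> \<alpha>}) - int m"

definition reg_step :: "nat \<Rightarrow> nat \<Rightarrow> int \<Rightarrow> diagram \<Rightarrow> diagram" where
  "reg_step m n k \<beta> = dplus m n \<beta> (ARG_MAX breadth P. P \<in> DAdd m n k \<beta>)"

text \<open>\<open>reg_iter m n \<alpha> i\<close> is \<open>reg\<^sub>k(\<alpha>)\<close> for \<open>k = d(\<alpha>) + i\<close>.\<close>

primrec reg_iter :: "nat \<Rightarrow> nat \<Rightarrow> diagram \<Rightarrow> nat \<Rightarrow> diagram" where
  "reg_iter m n \<alpha> 0 = \<alpha>"
| "reg_iter m n \<alpha> (Suc i) = reg_step m n (defect m \<alpha> + int (Suc i)) (reg_iter m n \<alpha> i)"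

definition reg :: "nat \<Rightarrow> nat \<Rightarrow> diagram \<Rightarrow> diagram" where
  "reg m n \<alpha> = reg_iter m n \<alpha> (nat (- defect m \<alpha>))"


section \<open>Free algebras\<close>

text \<open>
  The free monoid, written additively so that \<^typ>\<open>'w \<Rightarrow>\<^sub>0 'k\<close> with its
  library multiplication is its monoid algebra.
\<close>

datatype 'x free_monoid = Word (letters: "'x list")

instantiation free_monoid :: (type) monoid_add
begin

definition zero_free_monoid :: "'a free_monoid" where
  "0 = Word []"

definition plus_free_monoid :: "'a free_monoid \<Rightarrow> 'a free_monoid \<Rightarrow> 'a free_monoid" where
  "u + v = Word (letters u @ letters v)"

instance
  by standard (simp_all add: zero_free_monoid_def plus_free_monoid_def)

end

definition free_algebra :: "'x set \<Rightarrow> ('x free_monoid \<Rightarrow>\<^sub>0 'k::field) ring" where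
  "free_algebra X =
     \<lparr>carrier = {f. \<forall>w \<in> Poly_Mapping.keys f. set (letters w) \<subseteq> X},
      mult = (*), one = 1, zero = 0, add = (+)\<rparr>"

lemma ring_free_algebra: "ring (free_algebra X :: ('x free_monoid \<Rightarrow>\<^sub>0 'k::field) ring)"
proof (rule ringI)
  let ?F = "free_algebra X :: ('x free_monoid \<Rightarrow>\<^sub>0 'k) ring"
  show "abelian_group ?F"
  proof (rule abelian_groupI)
    fix x assume "x \<in> carrier ?F"
    then have "- x \<in> carrier ?F" by (simp add: free_algebra_def)
    then show "\<exists>y\<in>carrier ?F. y \<oplus>\<^bsub>?F\<^esub> x = \<zero>\<^bsub>?F\<^esub>"
      by (intro bexI[of _ "- x"]) (simp_all add: free_algebra_def)
  next
    fix x y assume *: "x \<in> carrier ?F" "y \<in> carrier ?F"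
    have "Poly_Mapping.keys (x + y) \<subseteq> Poly_Mapping.keys x \<union> Poly_Mapping.keys y"
      by (rule keys_add)
    with * show "x \<oplus>\<^bsub>?F\<^esub> y \<in> carrier ?F"
      by (auto simp: free_algebra_def)
  qed (simp_all add: free_algebra_def add.assoc add.commute)
  have mult: "set (letters w) \<subseteq> X" if "x \<in> carrier ?F" "y \<in> carrier ?F"
    "w \<in> Poly_Mapping.keys (x * y)" for x y w
  proof -
    have "w \<in> {u + v | u v. u \<in> Poly_Mapping.keys x \<and> v \<in> Poly_Mapping.keys y}"
      using keys_mult[of x y] that by blast
    then obtain u v where "u \<in> Poly_Mapping.keys x" "v \<in> Poly_Mapping.keys y" "w = u + v"
      by blast
    with \<open>x \<in> carrier ?F\<close> \<open>y \<in> carrier ?F\<close> show ?thesis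
      by (auto simp: free_algebra_def plus_free_monoid_def)
  qed
  show "Group.monoid ?F"
  proof (rule monoidI)
    fix x y assume "x \<in> carrier ?F" "y \<in> carrier ?F"
    then have "\<forall>w \<in> Poly_Mapping.keys (x * y). set (letters w) \<subseteq> X"
      using mult by blast
    then show "x \<otimes>\<^bsub>?F\<^esub> y \<in> carrier ?F"
      by (simp add: free_algebra_def)
  qed (auto simp: free_algebra_def zero_free_monoid_def mult.assoc)
qed (simp_all add: free_algebra_def distrib_left distrib_right)


section \<open>The extended Khovanov arc algebra\<close>

text \<open>\<open>IdemGen \<mu>\<close> is \<open>1\<^sub>\<mu>\<close>, and \<open>ArrGen \<kappa> \<mu>\<close> is \<open>D\<close> with upper index \<open>\<kappa>\<close> and lower index \<open>\<mu>\<close>.\<close>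

datatype generator = IdemGen diagram | ArrGen diagram diagram

type_synonym 'k free_elem = "generator free_monoid \<Rightarrow>\<^sub>0 'k"

definition linked :: "nat \<Rightarrow> nat \<Rightarrow> diagram \<Rightarrow> diagram \<Rightarrow> bool" where
  "linked m n \<kappa> \<mu> \<longleftrightarrow> \<kappa> \<in> Pmn m n \<and> \<mu> \<in> Pmn m n \<and>
     ((\<exists>P \<in> DRem m n \<mu>. \<kappa> = dminus m n \<mu> P) \<or> (\<exists>P \<in> DRem m n \<kappa>. \<mu> = dminus m n \<kappa> P))"

definition generators :: "nat \<Rightarrow> nat \<Rightarrow> generator set" where
  "generators m n = IdemGen ` Pmn m n \<union> {ArrGen \<kappa> \<mu> | \<kappa> \<mu>. linked m n \<kappa> \<mu>}"

definition idem :: "diagram \<Rightarrow> 'k::field free_elem" where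
  "idem \<mu> = Poly_Mapping.single (Word [IdemGen \<mu>]) 1"

text \<open>
  The value 0 for indices that are not linked is a convention that keeps
  all expressions inside the free algebra on \<^const>\<open>generators\<close>; all pairs of
  indices in the relations below are in fact linked.
\<close>

definition arr :: "nat \<Rightarrow> nat \<Rightarrow> diagram \<Rightarrow> diagram \<Rightarrow> 'k::field free_elem" where
  "arr m n \<kappa> \<mu> = (if linked m n \<kappa> \<mu> then Poly_Mapping.single (Word [ArrGen \<kappa> \<mu>]) 1 else 0)"

primrec dual_generator :: "generator \<Rightarrow> generator" where
  "dual_generator (IdemGen \<mu>) = IdemGen \<mu>"
| "dual_generator (ArrGen \<kappa> \<mu>) = ArrGen \<mu> \<kappa>"

definition dual_word :: "generator free_monoid \<Rightarrow> generator free_monoid" where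
  "dual_word w = Word (rev (map dual_generator (letters w)))"

lemma dual_generator_dual_generator [simp]: "dual_generator (dual_generator g) = g"
  by (cases g) simp_all

lemma dual_word_dual_word [simp]: "dual_word (dual_word w) = w"
  by (cases w) (simp add: dual_word_def rev_map o_def)

lemma inj_dual_word: "inj dual_word"
  by (metis dual_word_dual_word injI)

text \<open>The anti-involution; \<^const>\<open>dual_word\<close> is its own inverse, so precomposing with it is
  the linear extension of \<^const>\<open>dual_word\<close>.\<close>

definition dual :: "'k::field free_elem \<Rightarrow> 'k free_elem" where
  "dual f = Poly_Mapping.map_key dual_word f"

lemma dual_single: "dual (Poly_Mapping.single w c) = Poly_Mapping.single (dual_word w) c"
  unfolding dual_def using map_key_single[OF inj_dual_word, of "dual_word w" c] by simp

text \<open>An element \<open>x - y\<close> of this set stands for the relation \<open>x = y\<close>.\<close>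

inductive_set relations :: "nat \<Rightarrow> nat \<Rightarrow> 'k::field free_elem set" for m n where
  unit: "(\<Sum>\<mu> \<in> Pmn m n. idem \<mu>) - 1 \<in> relations m n"
| idempotent: "idem \<mu> * idem \<kappa> - (if \<kappa> = \<mu> then idem \<kappa> else 0) \<in> relations m n"
    if "\<mu> \<in> Pmn m n" "\<kappa> \<in> Pmn m n"
| idempotent_arr: "idem \<kappa> * arr m n \<kappa> \<mu> * idem \<mu> - arr m n \<kappa> \<mu> \<in> relations m n"
    if "\<mu> \<in> Pmn m n" "P \<in> DRem m n \<mu>" "\<kappa> = dminus m n \<mu> P"
| self_dual:
    "arr m n \<kappa> \<mu> * arr m n \<mu> \<kappa> - (- 1) ^ (breadth P - 1) *
       (2 * (\<Sum>Q | Q \<in> DRem m n \<kappa> \<and> P \<prec> Q.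
               (- 1) ^ breadth Q * arr m n \<kappa> (dminus m n \<kappa> Q) * arr m n (dminus m n \<kappa> Q) \<kappa>)
        + (\<Sum>Q | Q \<in> DRem m n \<kappa> \<and> adjacent Q P.
               (- 1) ^ breadth Q * arr m n \<kappa> (dminus m n \<kappa> Q) * arr m n (dminus m n \<kappa> Q) \<kappa>))
     \<in> relations m n"
    if "\<mu> \<in> Pmn m n" "P \<in> DRem m n \<mu>" "\<kappa> = dminus m n \<mu> P"
| commuting_down:
    "arr m n \<rho> \<kappa> * arr m n \<kappa> \<mu> - arr m n \<rho> \<nu> * arr m n \<nu> \<mu> \<in> relations m n"
    if "\<mu> \<in> Pmn m n" "commuting m n \<mu> P Q"
      "\<kappa> = dminus m n \<mu> P" "\<nu> = dminus m n \<mu> Q" "\<rho> = dminus m n \<kappa> Q"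
| commuting_mixed:
    "arr m n \<kappa> \<mu> * arr m n \<mu> \<nu> - arr m n \<kappa> \<rho> * arr m n \<rho> \<nu> \<in> relations m n"
    if "\<mu> \<in> Pmn m n" "commuting m n \<mu> P Q"
      "\<kappa> = dminus m n \<mu> P" "\<nu> = dminus m n \<mu> Q" "\<rho> = dminus m n \<kappa> Q"
| non_commuting:
    "arr m n \<nu> \<mu> * arr m n \<mu> \<kappa> - arr m n \<nu> (dminus m n \<kappa> R) * arr m n (dminus m n \<kappa> R) \<kappa>
     \<in> relations m n"
    if "\<mu> \<in> Pmn m n" "P \<in> DRem m n \<mu>" "Q \<in> DRem m n \<mu>" "P \<prec> Q" "\<not> commuting m n \<mu> P Q"
      "\<kappa> = dminus m n \<mu> P" "\<nu> = dminus m n \<mu> Q"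
      "Q1 \<in> DRem m n \<kappa>" "Q2 \<in> DRem m n \<kappa>" "Q - P = Q1 \<union> Q2" "Q1 \<inter> Q2 = {}" "R \<in> {Q1, Q2}"
| adjacent_join:
    "arr m n \<rho> \<kappa> * arr m n \<kappa> \<mu>
       - (- 1) ^ (breadth R - breadth Q) * arr m n \<rho> (dminus m n \<mu> R) * arr m n (dminus m n \<mu> R) \<mu>
     \<in> relations m n"
    if "\<mu> \<in> Pmn m n" "P \<in> DRem m n \<mu>" "\<kappa> = dminus m n \<mu> P"
      "Q \<in> DRem m n \<kappa>" "adjacent P Q" "\<rho> = dminus m n \<kappa> Q" "is_join m n \<mu> P Q R"
| adjacent_no_join:
    "arr m n \<rho> \<kappa> * arr m n \<kappa> \<mu> \<in> relations m n"
    if "\<mu> \<in> Pmn m n" "P \<in> DRem m n \<mu>" "\<kappa> = dminus m n \<mu> P"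
      "Q \<in> DRem m n \<kappa>" "adjacent P Q" "\<rho> = dminus m n \<kappa> Q" "\<nexists>R. is_join m n \<mu> P Q R"
| dual: "dual x \<in> relations m n" if "x \<in> relations m n"

lemma relations_carrier:
  "relations m n \<subseteq> carrier (free_algebra (generators m n) :: ('k::field free_elem) ring)"
proof
  let ?F = "free_algebra (generators m n) :: ('k free_elem) ring"
  interpret F: ring ?F by (rule ring_free_algebra)
  have times: "x * y \<in> carrier ?F" if "x \<in> carrier ?F" "y \<in> carrier ?F" for x y
    using F.m_closed[OF that] by (simp add: free_algebra_def)
  have plus: "x + y \<in> carrier ?F" if "x \<in> carrier ?F" "y \<in> carrier ?F" for x y
    using F.a_closed[OF that] by (simp add: free_algebra_def)
  have neg: "- x \<in> carrier ?F" if "x \<in> carrier ?F" for x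
    using that by (simp add: free_algebra_def)
  have diff: "x - y \<in> carrier ?F" if "x \<in> carrier ?F" "y \<in> carrier ?F" for x y
    using plus[OF that(1) neg[OF that(2)]] by simp
  have zero: "0 \<in> carrier ?F" and one: "1 \<in> carrier ?F"
    using F.zero_closed F.one_closed by (simp_all add: free_algebra_def)
  have two: "2 \<in> carrier ?F" using plus[OF one one] by simp
  have sign: "(- 1) ^ k \<in> carrier ?F" for k
    by (induction k) (auto intro: one neg times)
  have arr: "arr m n a b \<in> carrier ?F" for a b
    by (auto simp: arr_def free_algebra_def generators_def)
  have idem: "idem a \<in> carrier ?F" if "a \<in> Pmn m n" for a
    using that by (auto simp: idem_def free_algebra_def generators_def)
  have sum: "sum f B \<in> carrier ?F" if "\<And>b. b \<in> B \<Longrightarrow> f b \<in> carrier ?F"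
    for f :: "'b \<Rightarrow> 'k free_elem" and B
    using that by (induction B rule: infinite_finite_induct) (auto intro: zero plus)
  have gen: "dual_generator g \<in> generators m n" if "g \<in> generators m n" for g
    using that by (auto simp: generators_def linked_def)
  fix x assume "x \<in> (relations m n :: 'k free_elem set)"
  then show "x \<in> carrier ?F"
  proof induction
    case (dual x)
    have "set (letters w) \<subseteq> generators m n" if "w \<in> Poly_Mapping.keys (dual x)" for w
    proof -
      have "dual_word w \<in> Poly_Mapping.keys x"
        using that by (simp add: dual_def keys_map_key[OF inj_dual_word])
      then have "set (letters (dual_word w)) \<subseteq> generators m n"
        using dual.IH by (simp add: free_algebra_def)
      then have "dual_generator ` set (letters w) \<subseteq> generators m n"
        by (simp add: dual_word_def)
      then show ?thesis
        using gen by (metis dual_generator_dual_generator image_subset_iff subsetI)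
    qed
    then show ?case by (simp add: free_algebra_def)
  next
    case (idempotent_arr \<mu> P \<kappa>)
    show ?case
    proof (cases "linked m n \<kappa> \<mu>")
      case True
      then show ?thesis
        by (intro diff times arr idem) (simp_all add: linked_def)
    qed (simp add: arr_def zero)
  next
    case (idempotent \<mu> \<kappa>)
    then show ?case by (cases "\<kappa> = \<mu>") (simp_all add: diff times zero idem)
  qed (intro diff times plus sign one two arr idem sum; assumption)+
qed

text \<open>
  Ideals are two-sided. They are automatically subspaces, and the field acts on the quotient
  through the multiples of the unit; ring-theoretic modules and homomorphisms over the quotient
  and over its unital corners are therefore automatically linear over the field.
\<close>

definition rel_ideal :: "nat \<Rightarrow> nat \<Rightarrow> 'k::field free_elem set" where
  "rel_ideal m n = genideal (free_algebra (generators m n)) (relations m n)"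

type_synonym 'k arc_elem = "'k free_elem set"

definition arc_algebra :: "nat \<Rightarrow> nat \<Rightarrow> 'k::field arc_elem ring" where
  "arc_algebra m n = free_algebra (generators m n) Quot rel_ideal m n"

lemma ring_arc_algebra: "ring (arc_algebra m n :: 'k::field arc_elem ring)"
  unfolding arc_algebra_def rel_ideal_def
  by (intro ideal.quotient_is_ring ring.genideal_ideal ring_free_algebra relations_carrier)

definition arc_class :: "nat \<Rightarrow> nat \<Rightarrow> 'k::field free_elem \<Rightarrow> 'k arc_elem" where
  "arc_class m n f = rel_ideal m n +>\<^bsub>free_algebra (generators m n)\<^esub> f"

definition generator_degree :: "generator \<Rightarrow> nat" where
  "generator_degree g = (case g of IdemGen \<mu> \<Rightarrow> 0 | ArrGen \<kappa> \<mu> \<Rightarrow> 1)"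

definition word_degree :: "generator free_monoid \<Rightarrow> nat" where
  "word_degree w = sum_list (map generator_degree (letters w))"

definition arc_hcomp :: "nat \<Rightarrow> nat \<Rightarrow> int \<Rightarrow> 'k::field arc_elem set" where
  "arc_hcomp m n j = arc_class m n `
     {f \<in> carrier (free_algebra (generators m n)).
        \<forall>w \<in> Poly_Mapping.keys f. int (word_degree w) = j}"

definition arc_e :: "nat \<Rightarrow> nat \<Rightarrow> 'k::field arc_elem" where
  "arc_e m n = arc_class m n (\<Sum>\<kappa> \<in> Rmn m n. idem \<kappa>)"

definition corner :: "('a, 'b) ring_scheme \<Rightarrow> 'a \<Rightarrow> ('a, 'b) ring_scheme" where
  "corner A e = A\<lparr>carrier := {e \<otimes>\<^bsub>A\<^esub> x \<otimes>\<^bsub>A\<^esub> e | x. x \<in> carrier A}, one := e\<rparr>"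

definition H_algebra :: "nat \<Rightarrow> nat \<Rightarrow> 'k::field arc_elem ring" where
  "H_algebra m n = corner (arc_algebra m n) (arc_e m n)"


section \<open>Graded right modules\<close>

text \<open>
  As for modules in the library, the record extends that of rings in order to reuse the notation
  for the additive group, and the fields \<^const>\<open>mult\<close> and \<^const>\<open>one\<close> play no role.
  The set \<open>hcomp M j\<close> is the homogeneous component \<open>M\<^sub>j\<close>.
\<close>

record ('a, 'b) graded_module = "'b ring" +
  ract :: "'b \<Rightarrow> 'a \<Rightarrow> 'b"
  hcomp :: "int \<Rightarrow> 'b set"

definition right_submodule ::
    "('a, 'c) ring_scheme \<Rightarrow> ('a, 'b) graded_module \<Rightarrow> 'b set \<Rightarrow> bool" where
  "right_submodule A M N \<longleftrightarrow>
     additive_subgroup N M \<and> (\<forall>x \<in> N. \<forall>a \<in> carrier A. ract M x a \<in> N)"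

definition restrict_module ::
    "('a, 'b) graded_module \<Rightarrow> 'b set \<Rightarrow> ('a, 'b) graded_module" where
  "restrict_module M N = M\<lparr>carrier := N, hcomp := (\<lambda>j. hcomp M j \<inter> N)\<rparr>"

definition quotient_module ::
    "('a, 'b) graded_module \<Rightarrow> 'b set \<Rightarrow> ('a, 'b set) graded_module" where
  "quotient_module M N =
     \<lparr>carrier = a_rcosets\<^bsub>M\<^esub> N, mult = undefined, one = undefined, zero = N, add = set_add M,
      ract = (\<lambda>X a. \<Union>x \<in> X. N +>\<^bsub>M\<^esub> ract M x a),
      hcomp = (\<lambda>j. (\<lambda>x. N +>\<^bsub>M\<^esub> x) ` hcomp M j)\<rparr>"

definition shift_module :: "('a, 'b) graded_module \<Rightarrow> int \<Rightarrow> ('a, 'b) graded_module" where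
  "shift_module M k = M\<lparr>hcomp := (\<lambda>j. hcomp M (j + k))\<rparr>"

definition maximal_submodule ::
    "('a, 'c) ring_scheme \<Rightarrow> ('a, 'b) graded_module \<Rightarrow> 'b set \<Rightarrow> bool" where
  "maximal_submodule A M N \<longleftrightarrow> right_submodule A M N \<and> N \<noteq> carrier M \<and>
     (\<forall>N'. right_submodule A M N' \<and> N \<subseteq> N' \<longrightarrow> N' = N \<or> N' = carrier M)"

definition mod_radical :: "('a, 'c) ring_scheme \<Rightarrow> ('a, 'b) graded_module \<Rightarrow> 'b set" where
  "mod_radical A M = carrier M \<inter> \<Inter> {N. maximal_submodule A M N}"

definition module_head ::
    "('a, 'c) ring_scheme \<Rightarrow> ('a, 'b) graded_module \<Rightarrow> ('a, 'b set) graded_module" where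
  "module_head A M = quotient_module M (mod_radical A M)"

definition simple_module :: "('a, 'c) ring_scheme \<Rightarrow> ('a, 'b) graded_module \<Rightarrow> bool" where
  "simple_module A M \<longleftrightarrow> carrier M \<noteq> {\<zero>\<^bsub>M\<^esub>} \<and>
     (\<forall>N. right_submodule A M N \<longrightarrow> N = {\<zero>\<^bsub>M\<^esub>} \<or> N = carrier M)"

definition graded_isomorphic ::
    "('a, 'd) ring_scheme \<Rightarrow> ('a, 'b) graded_module \<Rightarrow> ('a, 'c) graded_module \<Rightarrow> bool" where
  "graded_isomorphic A M N \<longleftrightarrow> (\<exists>f. bij_betw f (carrier M) (carrier N) \<and>
     (\<forall>x \<in> carrier M. \<forall>y \<in> carrier M. f (x \<oplus>\<^bsub>M\<^esub> y) = f x \<oplus>\<^bsub>N\<^esub> f y) \<and>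
     (\<forall>x \<in> carrier M. \<forall>a \<in> carrier A. f (ract M x a) = ract N (f x) a) \<and>
     (\<forall>j. f ` hcomp M j = hcomp N j))"

text \<open>\<open>M e\<close>, a module over the corner algebra \<open>e A e\<close>.\<close>

definition corner_module :: "('a, 'b) graded_module \<Rightarrow> 'a \<Rightarrow> ('a, 'b) graded_module" where
  "corner_module M e = restrict_module M {ract M x e | x. x \<in> carrier M}"


section \<open>Standard, Specht and simple modules\<close>

definition regular_module :: "nat \<Rightarrow> nat \<Rightarrow> ('k::field arc_elem, 'k arc_elem) graded_module" where
  "regular_module m n =
     \<lparr>carrier = carrier (arc_algebra m n), mult = undefined, one = undefined,
      zero = \<zero>\<^bsub>arc_algebra m n\<^esub>, add = add (arc_algebra m n),
      ract = mult (arc_algebra m n), hcomp = arc_hcomp m n\<rparr>"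

definition proj_module ::
    "nat \<Rightarrow> nat \<Rightarrow> diagram \<Rightarrow> ('k::field arc_elem, 'k arc_elem) graded_module" where
  "proj_module m n \<kappa> = restrict_module (regular_module m n)
     {arc_class m n (idem \<kappa>) \<otimes>\<^bsub>arc_algebra m n\<^esub> x | x. x \<in> carrier (arc_algebra m n)}"

text \<open>For \<open>f\<close> in a unital ring \<open>K\<close>, the two-sided ideal generated by \<open>f\<close> is \<open>K f K\<close>
  (the additive span of the products), so this is \<open>1\<^sub>\<kappa> K (\<Sum>\<^sub>\<mu> 1\<^sub>\<mu>) K\<close>.\<close>

definition lower_submodule :: "nat \<Rightarrow> nat \<Rightarrow> diagram \<Rightarrow> 'k::field arc_elem set" where
  "lower_submodule m n \<kappa> =
     {arc_class m n (idem \<kappa>) \<otimes>\<^bsub>arc_algebra m n\<^esub> x | x.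
        x \<in> genideal (arc_algebra m n)
               {arc_class m n (\<Sum>\<mu> | \<mu> \<in> Pmn m n \<and> \<mu> \<subset> \<kappa>. idem \<mu>)}}"

definition Delta_module ::
    "nat \<Rightarrow> nat \<Rightarrow> diagram \<Rightarrow> ('k::field arc_elem, 'k arc_elem set) graded_module" where
  "Delta_module m n \<kappa> = quotient_module (proj_module m n \<kappa>) (lower_submodule m n \<kappa>)"

definition L_module ::
    "nat \<Rightarrow> nat \<Rightarrow> diagram \<Rightarrow> ('k::field arc_elem, 'k arc_elem set set) graded_module" where
  "L_module m n \<kappa> = module_head (arc_algebra m n) (Delta_module m n \<kappa>)"

definition Specht_module ::
    "nat \<Rightarrow> nat \<Rightarrow> diagram \<Rightarrow> ('k::field arc_elem, 'k arc_elem set) graded_module" where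
  "Specht_module m n \<kappa> = corner_module (Delta_module m n \<kappa>) (arc_e m n)"

definition D_module ::
    "nat \<Rightarrow> nat \<Rightarrow> diagram \<Rightarrow> ('k::field arc_elem, 'k arc_elem set set) graded_module" where
  "D_module m n \<mu> = corner_module (L_module m n \<mu>) (arc_e m n)"

end

theory Submission
  imports Defs "HOL.Vector_Spaces"
begin

text \<open>
  Let \<open>\<lambda>\<close> be the regularisation of \<open>\<alpha>\<close> and \<open>k\<close> minus the defect of \<open>\<alpha>\<close>. The product \<open>V\<close> of the \<open>k\<close>
  arrows along the steps of the regularisation is a homogeneous element of degree \<open>k\<close> of the Specht
  module. It generates this module, and it survives in the head, which is the line spanned by its
  image.

  Partitions are replaced by lattice paths, the heights of their boundaries. Removable Dyck paths
  become matched pairs of parentheses, which are nested or separated, and a step of the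
  regularisation lifts the interval between the first and the last minimum (\<open>reg_step_shape\<close>).

  Generation. The relations rewrite an addition followed by a removal through smaller partitions,
  so a standard module is spanned by paths that only add tiles (\<open>straighten\<close>). If such a path ends
  at a regular partition, then it has to raise the minimum of the lattice path level by level. The
  commuting and the non-commuting relations move the lift of the lowest arc to the front
  (\<open>exchange_path\<close>), and repeating this at each level the path factors through \<open>V\<close>
  (\<open>reg_factorisation\<close>). Since the length of upward paths is bounded, loops of positive length at \<open>\<lambda>\<close>
  act nilpotently on \<open>V\<close>. An element that involves \<open>V\<close> with a non-zero coefficient therefore generates
  the whole module (\<open>local_inverse\<close>, \<open>recover_generator\<close>).

  Survival. The paths added by two successive steps of the regularisation are strictly nested, yet
  do not commute, and no product of two such steps occurs in any of the relations
  (\<open>killed_relations\<close>). So the algebra has a representation in which exactly these arrows and the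
  idempotents act non-trivially. Its matrix coefficient from \<open>\<alpha>\<close> to \<open>\<lambda>\<close> is a functional on the Specht
  module with value one on \<open>V\<close>; its kernel is the only maximal submodule, and the head is a line
  in degree \<open>k\<close> (\<open>specht_head_line\<close>). The algebra acts on this line by the coefficient from \<open>\<lambda>\<close> to \<open>\<lambda>\<close>.
  The case \<open>\<alpha> = \<lambda>\<close> of the same argument shows that the simple module of \<open>\<lambda>\<close> is a line in degree zero
  with the same character (\<open>simple_head_line\<close>), and the two agree up to the shift.
\<close>

section \<open>Partitions as lattice paths\<close>

text \<open>
  Let \<open>h x\<close> be the level of the first tile of content \<open>x\<close> outside a partition. On neighbouring
  diagonals these levels differ by one, and beyond the rectangle the first missing tile lies on an
  axis, at level \<open>\<bar>x\<bar> + 1\<close>. A tile belongs to the partition iff its level is less than the height of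
  its diagonal, which is how \<open>shape\<close> recovers the partition.
\<close>

definition lattice_paths :: "nat \<Rightarrow> nat \<Rightarrow> (int \<Rightarrow> int) set" where
  "lattice_paths m n = {h. (\<forall>x. \<bar>h (x + 1) - h x\<bar> = 1) \<and>
     (\<forall>x \<le> - int m. h x = 1 - x) \<and> (\<forall>x \<ge> int n. h x = x + 1)}"

definition shape :: "(int \<Rightarrow> int) \<Rightarrow> diagram" where
  "shape h = {(r, c). 1 \<le> r \<and> 1 \<le> c \<and> int r + int c - 1 < h (int r - int c)}"

text \<open>
  A tile is determined by its content \<open>x\<close> and level \<open>l\<close>: row and column have difference \<open>x\<close> and sum
  \<open>l + 1\<close>. Both are positive integers exactly when \<open>l + x\<close> is odd and \<open>\<bar>x\<bar> < l\<close>.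
\<close>

definition tile_at :: "int \<Rightarrow> int \<Rightarrow> tile" where
  "tile_at x l = (nat ((l + 1 + x) div 2), nat ((l + 1 - x) div 2))"

lemma lipschitz_of_unit_steps:
  fixes h :: "int \<Rightarrow> int"
  assumes "\<And>x. \<bar>h (x + 1) - h x\<bar> = 1"
  shows "\<bar>h y - h x\<bar> \<le> \<bar>y - x\<bar>"
proof -
  have *: "\<bar>h (x + int k) - h x\<bar> \<le> int k" for x k
  proof (induction k)
    case (Suc k)
    have "\<bar>h (x + int k + 1) - h (x + int k)\<bar> = 1" by (rule assms)
    with Suc show ?case by (simp add: algebra_simps abs_if split: if_splits)
  qed simp
  show ?thesis
    using *[of x "nat (y - x)"] *[of y "nat (x - y)"] by (cases "x \<le> y") auto
qed

lemma tile_at_props: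
  assumes "even (l + x + 1)" "\<bar>x\<bar> + 1 \<le> l"
  shows "content (tile_at x l) = x" "level (tile_at x l) = nat l"
    "1 \<le> fst (tile_at x l)" "1 \<le> snd (tile_at x l)"
    "int (fst (tile_at x l)) + int (snd (tile_at x l)) - 1 = l"
    "int (fst (tile_at x l)) - int (snd (tile_at x l)) = x"
proof -
  obtain k where k: "l + x + 1 = 2 * k" using assms(1) by (elim evenE)
  have e: "(l + 1 + x) div 2 = k" "(l + 1 - x) div 2 = k - x" using k by auto
  have "k \<ge> 1" "k - x \<ge> 1" using assms(2) k by auto
  then show "content (tile_at x l) = x" "level (tile_at x l) = nat l"
    "1 \<le> fst (tile_at x l)" "1 \<le> snd (tile_at x l)"
    "int (fst (tile_at x l)) + int (snd (tile_at x l)) - 1 = l"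
    "int (fst (tile_at x l)) - int (snd (tile_at x l)) = x"
    using k by (auto simp: tile_at_def content_def level_def e)
qed

lemma tile_at_content_level:
  assumes "1 \<le> fst t" "1 \<le> snd t"
  shows "tile_at (content t) (int (level t)) = t"
  using assms by (cases t) (auto simp: tile_at_def content_def level_def)

locale rectangle =
  fixes m n :: nat
begin

abbreviation "LP \<equiv> lattice_paths m n"

lemma lp_step: "h \<in> LP \<Longrightarrow> \<bar>h (x + 1) - h x\<bar> = 1"
  and lp_left: "h \<in> LP \<Longrightarrow> x \<le> - int m \<Longrightarrow> h x = 1 - x"
  and lp_right: "h \<in> LP \<Longrightarrow> x \<ge> int n \<Longrightarrow> h x = x + 1"
  by (auto simp: lattice_paths_def)

lemma lp_step_cases: "h \<in> LP \<Longrightarrow> h (x + 1) = h x + 1 \<or> h (x + 1) = h x - 1"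
  using lp_step[of h x] by (auto simp: abs_if split: if_splits)

lemma lp_step_cases': "h \<in> LP \<Longrightarrow> h (x - 1) = h x + 1 \<or> h (x - 1) = h x - 1"
  using lp_step_cases[of h "x - 1"] by auto

lemma lp_lipschitz: "h \<in> LP \<Longrightarrow> \<bar>h y - h x\<bar> \<le> \<bar>y - x\<bar>"
  by (rule lipschitz_of_unit_steps) (rule lp_step)

lemma lp_parity: assumes "h \<in> LP" shows "even (h x + x + 1)"
proof (induction x rule: int_induct[where k = "- int m"])
  case base
  then show ?case using lp_left[OF assms] by simp
next
  case (step1 x)
  then show ?case using lp_step_cases[OF assms, of x] by auto
next
  case (step2 x)
  then show ?case using lp_step_cases'[OF assms, of x] by auto
qed

lemma lp_lower: assumes "h \<in> LP" shows "\<bar>x\<bar> + 1 \<le> h x"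
proof -
  have "1 - x \<le> h x"
    using lp_lipschitz[OF assms, of x "- int m"] lp_left[OF assms, of "- int m"] lp_left[OF assms, of x]
    by (cases "x \<le> - int m") auto
  moreover have "1 + x \<le> h x"
    using lp_lipschitz[OF assms, of x "int n"] lp_right[OF assms, of "int n"] lp_right[OF assms, of x]
    by (cases "x \<ge> int n") auto
  ultimately show ?thesis by auto
qed

lemma lp_left_of: "h \<in> LP \<Longrightarrow> h x \<le> int m \<Longrightarrow> - int m < x"
  using lp_left[of h x] by (cases "x \<le> - int m") auto

lemma lp_right_of: "h \<in> LP \<Longrightarrow> h x \<le> int n \<Longrightarrow> x < int n"
  using lp_right[of h x] by (cases "x \<ge> int n") auto

text \<open>
  An order ideal of the rectangle is a partition because every row of it is an initial segment, so
  that its length is the number of its tiles.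
\<close>

lemma Pmn_iff:
  "\<mu> \<in> Pmn m n \<longleftrightarrow> \<mu> \<subseteq> {1..n} \<times> {1..m} \<and>
     (\<forall>r c r' c'. (r, c) \<in> \<mu> \<and> 1 \<le> r' \<and> r' \<le> r \<and> 1 \<le> c' \<and> c' \<le> c \<longrightarrow> (r', c') \<in> \<mu>)"
    (is "?L \<longleftrightarrow> ?R")
proof
  assume ?L
  then obtain l where l: "\<mu> = young l" "\<And>r. 1 \<le> r \<Longrightarrow> l (Suc r) \<le> l r" "l 1 \<le> m" "\<And>r. n < r \<Longrightarrow> l r = 0"
    by (auto simp: Pmn_def)
  have mono: "l r \<le> l r'" if "1 \<le> r'" "r' \<le> r" for r r'
    using that(2)
  proof (induction r rule: dec_induct)
    case (step k)
    then show ?case using l(2)[of k] that(1) by simp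
  qed simp
  show ?R
  proof (intro conjI allI impI subsetI)
    fix t assume t: "t \<in> \<mu>"
    obtain r c where rc: "t = (r, c)" by (cases t)
    with t l have "1 \<le> r" "1 \<le> c" "c \<le> l r" by (auto simp: young_def)
    moreover have "r \<le> n" using l(4)[of r] calculation by (cases "n < r") auto
    moreover have "c \<le> m" using mono[of 1 r] l(3) calculation by linarith
    ultimately show "t \<in> {1..n} \<times> {1..m}" using rc by auto
  next
    fix r c r' c' assume "(r, c) \<in> \<mu> \<and> 1 \<le> r' \<and> r' \<le> r \<and> 1 \<le> c' \<and> c' \<le> c"
    then show "(r', c') \<in> \<mu>" using mono[of r' r] l(1) by (auto simp: young_def)
  qed
next
  assume R: ?R
  define l where "l r = card {c. (r, c) \<in> \<mu>}" for r
  have sub: "{c. (r, c) \<in> \<mu>} \<subseteq> {1..m}" for r using R by auto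
  have fin: "finite {c. (r, c) \<in> \<mu>}" for r using sub finite_subset by blast
  have seg: "{c. (r, c) \<in> \<mu>} = {1..l r}" for r
  proof (cases "{c. (r, c) \<in> \<mu>} = {}")
    case False
    let ?C = "{c. (r, c) \<in> \<mu>}"
    have "1 \<le> r" using False R by auto
    have "?C = {1..Max ?C}"
    proof (intro equalityI subsetI)
      fix c assume "c \<in> ?C" then show "c \<in> {1..Max ?C}" using sub[of r] fin[of r] by auto
    next
      fix c assume "c \<in> {1..Max ?C}"
      moreover have "(r, Max ?C) \<in> \<mu>" using Max_in[OF fin False] by simp
      ultimately show "c \<in> ?C"
        using R[THEN conjunct2, rule_format, of r "Max ?C" r c] \<open>1 \<le> r\<close> by auto
    qed
    then show ?thesis unfolding l_def by (metis card_atLeastAtMost diff_Suc_1)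
  qed (simp add: l_def)
  have "(r, c) \<in> \<mu> \<longleftrightarrow> 1 \<le> r \<and> 1 \<le> c \<and> c \<le> l r" for r c
    using R[THEN conjunct1] seg[of r] by auto
  then have "\<mu> = young l" by (auto simp: young_def)
  moreover have "l (Suc r) \<le> l r" if "1 \<le> r" for r
  proof -
    have "(r, c) \<in> \<mu>" if c: "(Suc r, c) \<in> \<mu>" for c
      using R[THEN conjunct1] R[THEN conjunct2, rule_format, of "Suc r" c r c] c \<open>1 \<le> r\<close> by auto
    then show ?thesis unfolding l_def by (intro card_mono fin) auto
  qed
  moreover have "l 1 \<le> m" using card_mono[OF _ sub[of 1]] by (simp add: l_def)
  moreover have "l r = 0" if "n < r" for r
    using R that unfolding l_def by (subst card_0_eq[OF fin]) auto
  ultimately show ?L unfolding Pmn_def by blast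
qed

lemma finite_Pmn: "finite (Pmn m n)"
  by (rule finite_subset[of _ "Pow ({1..n} \<times> {1..m})"]) (use Pmn_iff in blast, simp)

lemma shape_Pmn: assumes "h \<in> LP" shows "shape h \<in> Pmn m n"
  unfolding Pmn_iff
proof (intro conjI allI impI subsetI)
  fix t assume t: "t \<in> shape h"
  obtain r c where rc: "t = (r, c)" by (cases t)
  have *: "1 \<le> r" "1 \<le> c" "int r + int c - 1 < h (int r - int c)"
    using t rc by (auto simp: shape_def)
  have "c \<le> m"
    using lp_lipschitz[OF assms, of "int r - int c" "- int m"] lp_left[OF assms, of "- int m"]
      lp_left[OF assms, of "int r - int c"] * by (cases "int r - int c \<le> - int m") auto
  moreover have "r \<le> n"
    using lp_lipschitz[OF assms, of "int r - int c" "int n"] lp_right[OF assms, of "int n"]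
      lp_right[OF assms, of "int r - int c"] * by (cases "int r - int c \<ge> int n") auto
  ultimately show "t \<in> {1..n} \<times> {1..m}" using * rc by auto
next
  fix r c r' c'
  assume *: "(r, c) \<in> shape h \<and> 1 \<le> r' \<and> r' \<le> r \<and> 1 \<le> c' \<and> c' \<le> c"
  then show "(r', c') \<in> shape h"
    using lp_lipschitz[OF assms, of "int r - int c" "int r' - int c'"]
    by (auto simp: shape_def)
qed

lemma tile_at_in_shape:
  assumes "even (l + x + 1)" "\<bar>x\<bar> + 1 \<le> l"
  shows "tile_at x l \<in> shape h \<longleftrightarrow> l < h x"
  using tile_at_props[OF assms] by (auto simp: shape_def case_prod_beta)

lemma shape_subset_iff:
  assumes "h \<in> LP" "h' \<in> LP"
  shows "shape h \<subseteq> shape h' \<longleftrightarrow> (\<forall>x. h x \<le> h' x)"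
proof
  assume sub: "shape h \<subseteq> shape h'"
  show "\<forall>x. h x \<le> h' x"
  proof (rule allI, rule ccontr)
    fix x assume "\<not> h x \<le> h' x"
    then have "tile_at x (h' x) \<in> shape h" "tile_at x (h' x) \<notin> shape h'"
      using tile_at_in_shape[OF lp_parity[OF assms(2)] lp_lower[OF assms(2)]] by auto
    with sub show False by blast
  qed
next
  assume "\<forall>x. h x \<le> h' x"
  then show "shape h \<subseteq> shape h'"
    by (auto simp: shape_def intro: less_le_trans)
qed

lemma shape_eq_iff:
  assumes "h \<in> LP" "h' \<in> LP"
  shows "shape h = shape h' \<longleftrightarrow> h = h'"
  using shape_subset_iff[OF assms] shape_subset_iff[OF assms(2,1)]
  by (auto intro!: ext antisym)

text \<open>
  Every diagonal meets a partition in an initial segment; the height is read off from its length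
  \<open>t x\<close>. Heights of neighbouring diagonals have different parity. If they differed by three or more,
  the last tile on the longer diagonal would have its neighbour towards the corner missing.
\<close>

lemma Pmn_obtain:
  assumes "\<mu> \<in> Pmn m n"
  obtains h where "h \<in> LP" "\<mu> = shape h"
proof -
  have sub: "\<mu> \<subseteq> {1..n} \<times> {1..m}"
    using assms unfolding Pmn_iff by (rule conjunct1)
  have dc: "\<And>r c r' c'. (r, c) \<in> \<mu> \<Longrightarrow> 1 \<le> r' \<Longrightarrow> r' \<le> r \<Longrightarrow> 1 \<le> c' \<Longrightarrow> c' \<le> c \<Longrightarrow> (r', c') \<in> \<mu>"
    using assms[unfolded Pmn_iff, THEN conjunct2, rule_format] by simp
  have dc': "t \<in> \<mu>" if "s \<in> \<mu>" "1 \<le> fst t" "fst t \<le> fst s" "1 \<le> snd t" "snd t \<le> snd s" for s t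
    using dc[of "fst s" "snd s" "fst t" "snd t"] that by simp
  define f where "f x j = (nat x + j + 1, nat (- x) + j + 1)" for x :: int and j :: nat
  define t where "t x = (LEAST j. f x j \<notin> \<mu>)" for x
  have ex: "\<exists>j. f x j \<notin> \<mu>" for x
    using sub by (intro exI[of _ n]) (auto simp: f_def)
  have t1: "f x (t x) \<notin> \<mu>" for x unfolding t_def by (rule LeastI_ex[OF ex])
  have ft: "f x j \<in> \<mu> \<longleftrightarrow> j < t x" for x j
  proof
    assume "f x j \<in> \<mu>"
    show "j < t x"
    proof (rule ccontr)
      assume "\<not> j < t x"
      then have "f x (t x) \<in> \<mu>" using dc[of "nat x + j + 1" "nat (- x) + j + 1"] \<open>f x j \<in> \<mu>\<close>
        by (auto simp: f_def)
      with t1 show False by blast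
    qed
  next
    assume "j < t x"
    then show "f x j \<in> \<mu>" using not_less_Least unfolding t_def by blast
  qed
  define h where "h x = \<bar>x\<bar> + 1 + 2 * int (t x)" for x
  have low: "\<bar>x\<bar> + 1 \<le> h x" for x by (simp add: h_def)
  have par: "even (h x + x + 1)" for x by (auto simp: h_def)
  have dg: "\<mu> = shape h"
  proof (rule Set.set_eqI)
    fix y :: tile
    obtain r c where y: "y = (r, c)" by (cases y)
    show "y \<in> \<mu> \<longleftrightarrow> y \<in> shape h"
    proof (cases "1 \<le> r \<and> 1 \<le> c")
      case True
      have "y = f (int r - int c) (min r c - 1)" using True y by (auto simp: f_def)
      then have "y \<in> \<mu> \<longleftrightarrow> min r c - 1 < t (int r - int c)" using ft by metis
      also have "\<dots> \<longleftrightarrow> y \<in> shape h"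
        using True y by (auto simp: shape_def h_def)
      finally show ?thesis .
    qed (use sub y in \<open>auto simp: shape_def\<close>)
  qed
  have up: "h (x + 1) < h x + 3" for x
  proof (rule ccontr)
    assume neg: "\<not> h (x + 1) < h x + 3"
    define l where "l = h (x + 1) - 3"
    have l: "even (l + x + 1)" "\<bar>x\<bar> + 1 \<le> l" "even ((l + 1) + (x + 1) + 1)" "\<bar>x + 1\<bar> + 1 \<le> l + 1"
      using par[of "x + 1"] low[of x] neg by (auto simp: l_def)
    have "tile_at (x + 1) (l + 1) \<in> \<mu>"
      unfolding dg using tile_at_in_shape[OF l(3,4)] by (simp add: l_def)
    moreover have "fst (tile_at x l) \<le> fst (tile_at (x + 1) (l + 1))"
      "snd (tile_at x l) = snd (tile_at (x + 1) (l + 1))"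
      by (auto simp: tile_at_def)
    ultimately have "tile_at x l \<in> \<mu>"
      using dc' tile_at_props(3,4)[OF l(1,2)] by (metis order_refl)
    then show False
      unfolding dg using tile_at_in_shape[OF l(1,2)] neg by (simp add: l_def)
  qed
  have down: "h x < h (x + 1) + 3" for x
  proof (rule ccontr)
    assume neg: "\<not> h x < h (x + 1) + 3"
    define l where "l = h x - 3"
    have l: "even (l + (x + 1) + 1)" "\<bar>x + 1\<bar> + 1 \<le> l" "even ((l + 1) + x + 1)" "\<bar>x\<bar> + 1 \<le> l + 1"
      using par[of "x"] low[of "x + 1"] neg by (auto simp: l_def)
    have "tile_at x (l + 1) \<in> \<mu>"
      unfolding dg using tile_at_in_shape[OF l(3,4)] by (simp add: l_def)
    moreover have "fst (tile_at (x + 1) l) = fst (tile_at x (l + 1))"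
      "snd (tile_at (x + 1) l) \<le> snd (tile_at x (l + 1))"
      by (auto simp: tile_at_def algebra_simps)
    ultimately have "tile_at (x + 1) l \<in> \<mu>"
      using dc' tile_at_props(3,4)[OF l(1,2)] by (metis order_refl)
    then show False
      unfolding dg using tile_at_in_shape[OF l(1,2)] neg by (simp add: l_def)
  qed
  have "\<bar>h (x + 1) - h x\<bar> = 1" for x
  proof -
    have "odd (h (x + 1) - h x)" using par[of x] par[of "x + 1"] by auto
    then show ?thesis using up[of x] down[of x] by presburger
  qed
  moreover have "h x = 1 - x" if "x \<le> - int m" for x
  proof -
    have "f x 0 \<notin> \<mu>" using sub that by (auto simp: f_def)
    then have "t x = 0" using ft[of x 0] by simp
    then show ?thesis using that by (simp add: h_def)
  qed
  moreover have "h x = x + 1" if "x \<ge> int n" for x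
  proof -
    have "f x 0 \<notin> \<mu>" using sub that by (auto simp: f_def)
    then have "t x = 0" using ft[of x 0] by simp
    then show ?thesis using that by (simp add: h_def)
  qed
  ultimately have "h \<in> LP" by (auto simp: lattice_paths_def)
  with dg that show thesis by blast
qed

end

section \<open>Dyck paths as arcs of a lattice path\<close>

text \<open>
  Reading up steps and down steps of \<open>h\<close> as opening and closing parentheses, the conditions say that
  the step into \<open>a\<close> and the step out of \<open>b\<close> are matched. The first two are what makes \<open>cut h a b\<close> a
  lattice path again; the others say that the removed strip is a Dyck path.
\<close>

definition removable_at :: "(int \<Rightarrow> int) \<Rightarrow> int \<Rightarrow> int \<Rightarrow> bool" where
  "removable_at h a b \<longleftrightarrow> a \<le> b \<and> h (a - 1) = h a - 1 \<and> h (b + 1) = h b - 1 \<and> h a = h b \<and>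
     (\<forall>x. a \<le> x \<and> x \<le> b \<longrightarrow> h a \<le> h x)"

definition addable_at :: "(int \<Rightarrow> int) \<Rightarrow> int \<Rightarrow> int \<Rightarrow> bool" where
  "addable_at h a b \<longleftrightarrow> a \<le> b \<and> h (a - 1) = h a + 1 \<and> h (b + 1) = h b + 1 \<and> h a = h b \<and>
     (\<forall>x. a \<le> x \<and> x \<le> b \<longrightarrow> h a \<le> h x)"

definition cut :: "(int \<Rightarrow> int) \<Rightarrow> int \<Rightarrow> int \<Rightarrow> int \<Rightarrow> int" where
  "cut h a b x = (if a \<le> x \<and> x \<le> b then h x - 2 else h x)"

definition lift :: "(int \<Rightarrow> int) \<Rightarrow> int \<Rightarrow> int \<Rightarrow> int \<Rightarrow> int" where
  "lift h a b x = (if a \<le> x \<and> x \<le> b then h x + 2 else h x)"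

lemma cut_lift [simp]: "cut (lift h a b) a b = h"
  and lift_cut [simp]: "lift (cut h a b) a b = h"
  by (auto simp: cut_def lift_def)

lemma removable_lift_iff: "removable_at (lift h a b) a b \<longleftrightarrow> addable_at h a b"
  by (auto simp: removable_at_def addable_at_def lift_def)

lemma dyck_step_content: "dyck_step s t \<Longrightarrow> content t = content s + 1"
  by (auto simp: dyck_step_def content_def)

lemma contents_of_steps:
  assumes "successively dyck_step p" "p \<noteq> []"
  shows "content ` set p = {content (hd p)..content (last p)} \<and>
    content (hd p) \<le> content (last p) \<and> inj_on content (set p)"
  using assms
proof (induction p)
  case (Cons t q)
  show ?case
  proof (cases "q = []")
    case False
    then have IH: "content ` set q = {content (hd q)..content (last q)}"
      "content (hd q) \<le> content (last q)" "inj_on content (set q)"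
      using Cons by (auto simp: successively_Cons)
    have "content (hd q) = content t + 1"
      using Cons.prems False by (intro dyck_step_content) (auto simp: successively_Cons)
    then have "content ` set (t # q) = {content t..content (last q)}" "content t \<notin> content ` set q"
      using IH(1,2) by auto
    then show ?thesis using IH(2,3) False \<open>content (hd q) = content t + 1\<close> by auto
  qed auto
qed simp

context rectangle begin

lemma cut_LP:
  assumes "h \<in> LP" "removable_at h a b"
  shows "cut h a b \<in> LP"
proof -
  have r: "a \<le> b" "h (a - 1) = h a - 1" "h (b + 1) = h b - 1"
    using assms(2) by (auto simp: removable_at_def)
  have a: "- int m < a"
    using r lp_left[OF assms(1), of a] lp_left[OF assms(1), of "a - 1"] by (cases "a \<le> - int m") auto
  have b: "b < int n"
    using r lp_right[OF assms(1), of b] lp_right[OF assms(1), of "b + 1"] by (cases "b \<ge> int n") auto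
  have "\<bar>cut h a b (x + 1) - cut h a b x\<bar> = 1" for x
  proof -
    consider "x = a - 1" | "x = b" | "x \<noteq> a - 1" "x \<noteq> b" by blast
    then show ?thesis using r lp_step[OF assms(1), of x] by cases (auto simp: cut_def)
  qed
  then show ?thesis
    using a b lp_left[OF assms(1)] lp_right[OF assms(1)] by (auto simp: lattice_paths_def cut_def)
qed

lemma lift_LP:
  assumes "h \<in> LP" "addable_at h a b" "- int m < a" "b < int n"
  shows "lift h a b \<in> LP"
proof -
  have r: "a \<le> b" "h (a - 1) = h a + 1" "h (b + 1) = h b + 1"
    using assms(2) by (auto simp: addable_at_def)
  have "\<bar>lift h a b (x + 1) - lift h a b x\<bar> = 1" for x
  proof -
    consider "x = a - 1" | "x = b" | "x \<noteq> a - 1" "x \<noteq> b" by blast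
    then show ?thesis using r lp_step[OF assms(1), of x] by cases (auto simp: lift_def)
  qed
  then show ?thesis
    using assms(3,4) lp_left[OF assms(1)] lp_right[OF assms(1)] by (auto simp: lattice_paths_def lift_def)
qed

lemma tile_of_lp:
  assumes "t \<in> shape h" "h \<in> LP"
  shows "1 \<le> fst t" "1 \<le> snd t" "even (int (level t) + content t + 1)" "\<bar>content t\<bar> + 1 \<le> int (level t)"
    "tile_at (content t) (int (level t)) = t"
proof -
  show "1 \<le> fst t" "1 \<le> snd t" using assms by (auto simp: shape_def)
  then show "tile_at (content t) (int (level t)) = t" by (rule tile_at_content_level)
  show "\<bar>content t\<bar> + 1 \<le> int (level t)" "even (int (level t) + content t + 1)"
    using \<open>1 \<le> fst t\<close> \<open>1 \<le> snd t\<close> by (auto simp: content_def level_def of_nat_diff)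
qed

text \<open>
  A removable Dyck path has one tile on each of its diagonals, and removal leaves initial segments of
  them, so this tile is the last one: the path is the strip of tiles of level \<open>h x - 2\<close>. In
  particular the path is determined by its contents.
\<close>

lemma removable_at_of_removable:
  assumes h: "h \<in> LP" and p: "removable m n (shape h) p"
  obtains a b where "removable_at h a b" "contents p = {a..b}"
    "shape h - set p = shape (cut h a b)" "int (level (hd p)) = h a - 2"
proof -
  have sub: "set p \<subseteq> shape h" and dp: "dyck_path m n p" and
    minus: "shape h - set p \<in> Pmn m n"
    using p by (auto simp: removable_def)
  have p0: "p \<noteq> []" and st: "successively dyck_step p"
    and lv: "Min (level ` set p) = level (hd p)" "level (hd p) = level (last p)"
    using dp by (auto simp: dyck_path_def)
  define a where "a = content (hd p)"
  define b where "b = content (last p)"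
  have cont: "content ` set p = {a..b}" and ab: "a \<le> b" and inj: "inj_on content (set p)"
    using contents_of_steps[OF st p0] by (auto simp: a_def b_def)
  obtain g where g: "g \<in> LP" "shape h - set p = shape g"
    using Pmn_obtain[OF minus] by metis
  \<comment> \<open>The tiles of the path on the diagonal \<open>x\<close> fill the levels from \<open>g x\<close> up to \<open>h x\<close>.\<close>
  have in_p: "tile_at x l \<in> set p \<longleftrightarrow> g x \<le> l \<and> l < h x"
    if "even (l + x + 1)" "\<bar>x\<bar> + 1 \<le> l" for x l
    using tile_at_in_shape[OF that, of h] tile_at_in_shape[OF that, of g] g(2) sub
    by (metis DiffD1 DiffD2 DiffI linorder_not_le subsetD)
  have outside: "g x = h x" if "x \<notin> {a..b}" for x
  proof -
    have "tile_at x (g x) \<notin> set p"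
      using cont that tile_at_props(1)[OF lp_parity[OF g(1)] lp_lower[OF g(1)], of x] by force
    then have "h x \<le> g x" using in_p[OF lp_parity[OF g(1)] lp_lower[OF g(1)], of x] by auto
    moreover have "g x \<le> h x" using shape_subset_iff[OF g(1) h] g(2) by blast
    ultimately show ?thesis by simp
  qed
  have inside: "g x = h x - 2 \<and> tile_at x (h x - 2) \<in> set p" if x: "x \<in> {a..b}" for x
  proof -
    from x cont obtain t where t: "t \<in> set p" "content t = x" by (metis imageE)
    have tl: "even (int (level t) + x + 1)" "\<bar>x\<bar> + 1 \<le> int (level t)" "tile_at x (int (level t)) = t"
      using tile_of_lp[OF _ h, of t] sub t by auto
    have gl: "g x \<le> int (level t)" "int (level t) < h x" using in_p[OF tl(1,2)] tl(3) t by auto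
    have *: "\<not> g x + 2 < h x"
    proof
      assume "g x + 2 < h x"
      have e1: "even (g x + x + 1)" "\<bar>x\<bar> + 1 \<le> g x" using lp_parity[OF g(1)] lp_lower[OF g(1)] by auto
      then have e2: "even (g x + 2 + x + 1)" "\<bar>x\<bar> + 1 \<le> g x + 2" by auto
      have "tile_at x (g x) = tile_at x (g x + 2)"
        using in_p[OF e1] in_p[OF e2] \<open>g x + 2 < h x\<close> inj tile_at_props(1)[OF e1] tile_at_props(1)[OF e2]
        by (simp add: inj_on_def)
      then show False using tile_at_props(5)[OF e1] tile_at_props(5)[OF e2] by simp
    qed
    have "even (g x + x + 1)" "even (h x + x + 1)" using lp_parity[OF g(1)] lp_parity[OF h] by auto
    with * gl have "g x = h x - 2" by presburger
    moreover have "tile_at x (g x) \<in> set p"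
      using in_p[OF lp_parity[OF g(1)] lp_lower[OF g(1)], of x] calculation by simp
    ultimately show ?thesis by simp
  qed
  have gcut: "g = cut h a b" using inside outside by (auto simp: cut_def)
  have lev: "int (level t) = h (content t) - 2" if "t \<in> set p" for t
  proof -
    have ct: "content t \<in> {a..b}" using cont that by auto
    then have gx: "g (content t) = h (content t) - 2" and T: "tile_at (content t) (g (content t)) \<in> set p"
      using inside by auto
    note e = lp_parity[OF g(1), of "content t"] lp_lower[OF g(1), of "content t"]
    have "t = tile_at (content t) (g (content t))"
      using inj T that tile_at_props(1)[OF e] by (simp add: inj_on_def)
    then have "level t = nat (g (content t))" using tile_at_props(2)[OF e] by metis
    then show ?thesis using e(2) gx by simp
  qed
  have hd: "int (level (hd p)) = h a - 2" using lev[of "hd p"] p0 by (simp add: a_def)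
  have la: "int (level (last p)) = h b - 2" using lev[of "last p"] p0 by (simp add: b_def)
  have "h a \<le> h x" if "a \<le> x" "x \<le> b" for x
  proof -
    from that cont obtain t where t: "t \<in> set p" "content t = x" by (metis atLeastAtMost_iff imageE)
    have "level (hd p) \<le> level t" using lv(1) t(1) by (metis List.finite_set Min_le finite_imageI imageI)
    then show ?thesis using lev[OF t(1)] t(2) hd by simp
  qed
  moreover have "h (a - 1) = h a - 1"
    using lp_step_cases'[OF h, of a] lp_step_cases'[OF g(1), of a] inside[of a] outside[of "a - 1"] ab
    by auto
  moreover have "h (b + 1) = h b - 1"
    using lp_step_cases[OF h, of b] lp_step_cases[OF g(1), of b] inside[of b] outside[of "b + 1"] ab
    by auto
  moreover have "h a = h b" using hd la lv(2) by simp
  ultimately have "removable_at h a b" using ab by (auto simp: removable_at_def)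
  with that g gcut hd cont show thesis by (auto simp: contents_def)
qed

lemma removable_of_removable_at:
  assumes h: "h \<in> LP" and r: "removable_at h a b"
  obtains p where "removable m n (shape h) p" "contents p = {a..b}"
    "shape h - set p = shape (cut h a b)" "int (level (hd p)) = h a - 2"
proof -
  have ab: "a \<le> b" "h a = h b" and ge: "\<And>x. a \<le> x \<Longrightarrow> x \<le> b \<Longrightarrow> h a \<le> h x"
    using r unfolding removable_at_def by blast+
  have g: "cut h a b \<in> LP" by (rule cut_LP[OF h r])
  define f where "f x = tile_at x (h x - 2)" for x
  define p where "p = map f [a..b]"
  have e: "even (h x - 2 + x + 1)" "\<bar>x\<bar> + 1 \<le> h x - 2" if "a \<le> x" "x \<le> b" for x
    using lp_parity[OF g, of x] lp_lower[OF g, of x] that by (auto simp: cut_def)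
  have fp: "content (f x) = x" "level (f x) = nat (h x - 2)" "1 \<le> fst (f x)" "1 \<le> snd (f x)"
    "int (fst (f x)) + int (snd (f x)) - 1 = h x - 2" "int (fst (f x)) - int (snd (f x)) = x"
    if "a \<le> x" "x \<le> b" for x
    unfolding f_def by (rule tile_at_props[OF e[OF that]])+
  have setp: "set p = f ` {a..b}" by (simp add: p_def)
  have p0: "p \<noteq> []" using ab by (simp add: p_def)
  have "p = f a # map f [a + 1..b]" using ab by (simp add: p_def upto_rec1)
  moreover have "p = map f [a..b - 1] @ [f b]" using ab by (simp add: p_def upto_rec2)
  ultimately have hdlast: "hd p = f a" "last p = f b" by (metis list.sel(1), metis last_snoc)
  have sub: "set p \<subseteq> shape h"
    using tile_at_in_shape[OF e, where h = h] by (auto simp: setp f_def)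
  have mem: "f x \<in> set p" if "a \<le> x" "x \<le> b" for x using that by (auto simp: setp)
  have minus: "shape h - set p = shape (cut h a b)"
  proof (intro equalityI subsetI)
    fix t assume t: "t \<in> shape h - set p"
    then have ht: "t \<in> shape h" by simp
    note tl = tile_of_lp[OF ht h]
    have lt: "int (level t) < h (content t)" using tile_at_in_shape[OF tl(3,4)] ht tl(5) by simp
    have "int (level t) < cut h a b (content t)"
    proof (cases "a \<le> content t \<and> content t \<le> b")
      case True
      then have "t \<noteq> f (content t)" using t setp by (metis DiffD2 mem)
      then have "int (level t) \<noteq> h (content t) - 2" using tl(5) f_def by metis
      then have "int (level t) < h (content t) - 2"
        using lt tl(3) lp_parity[OF h, of "content t"] by presburger
      then show ?thesis using True by (simp add: cut_def)
    qed (use lt in \<open>auto simp: cut_def\<close>)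
    then show "t \<in> shape (cut h a b)" using tile_at_in_shape[OF tl(3,4)] tl(5) by simp
  next
    fix t assume t: "t \<in> shape (cut h a b)"
    note tl = tile_of_lp[OF t g]
    have lt: "int (level t) < cut h a b (content t)"
      using tile_at_in_shape[OF tl(3,4)] t tl(5) by simp
    then have "int (level t) < h (content t)" by (auto simp: cut_def split: if_splits)
    then have "t \<in> shape h" using tile_at_in_shape[OF tl(3,4)] tl(5) by simp
    moreover have "t \<notin> set p"
    proof
      assume "t \<in> set p"
      then obtain x where x: "a \<le> x" "x \<le> b" "t = f x" by (auto simp: setp)
      then have "content t = x" "int (level t) = h x - 2" using fp(1,2)[of x] e(2)[of x] by auto
      with lt x show False by (simp add: cut_def)
    qed
    ultimately show "t \<in> shape h - set p" by simp
  qed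
  have step: "dyck_step (f x) (f (x + 1))" if "a \<le> x" "x + 1 \<le> b" for x
    using fp(3-6)[of x] fp(3-6)[of "x + 1"] that lp_step_cases[OF h, of x]
    by (auto simp: dyck_step_def)
  have "dyck_step (p ! i) (p ! Suc i)" if "Suc i < length p" for i
    using that step[of "a + int i"] by (simp add: p_def nth_upto algebra_simps)
  then have "successively dyck_step p" unfolding successively_conv_nth by blast
  moreover have "set p \<subseteq> {1..n} \<times> {1..m}"
    using sub shape_Pmn[OF h] Pmn_iff by blast
  moreover have lev: "level (f x) = nat (h x - 2)" if "a \<le> x" "x \<le> b" for x using fp(2) that by simp
  moreover have "Min (level ` set p) = level (hd p)"
  proof (rule Min_eqI)
    fix y assume "y \<in> level ` set p"
    then obtain x where "a \<le> x" "x \<le> b" "y = level (f x)" by (auto simp: setp)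
    then show "level (hd p) \<le> y" using lev ge ab hdlast by (auto intro: nat_mono)
  qed (use p0 in auto)
  moreover have "level (hd p) = level (last p)" using hdlast lev ab by simp
  ultimately have "dyck_path m n p" using p0 by (simp add: dyck_path_def)
  then have "removable m n (shape h) p"
    using sub minus shape_Pmn[OF g] by (simp add: removable_def)
  moreover have "contents p = {a..b}" unfolding contents_def setp image_image
    using fp(1) by (auto simp: image_def)
  moreover have "int (level (hd p)) = h a - 2" using hdlast lev[of a] e(2)[of a] ab by simp
  ultimately show thesis using that minus by blast
qed

lemma DRem_shape:
  assumes "h \<in> LP"
  shows "P \<in> DRem m n (shape h) \<longleftrightarrow> (\<exists>a b. P = {a..b} \<and> removable_at h a b)"
proof
  assume "P \<in> DRem m n (shape h)"
  then show "\<exists>a b. P = {a..b} \<and> removable_at h a b"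
    using removable_at_of_removable[OF assms] by (auto simp: DRem_def) metis
next
  assume "\<exists>a b. P = {a..b} \<and> removable_at h a b"
  then show "P \<in> DRem m n (shape h)"
    using removable_of_removable_at[OF assms] by (auto simp: DRem_def) metis
qed

lemma dminus_shape:
  assumes h: "h \<in> LP" and r: "removable_at h a b"
  shows "dminus m n (shape h) {a..b} = shape (cut h a b)"
  unfolding dminus_def
proof (rule the_equality)
  show "\<exists>p. removable m n (shape h) p \<and> contents p = {a..b} \<and>
      shape (cut h a b) = shape h - set p"
    using removable_of_removable_at[OF assms] by metis
next
  fix \<nu> assume "\<exists>p. removable m n (shape h) p \<and> contents p = {a..b} \<and> \<nu> = shape h - set p"
  then obtain p where p: "removable m n (shape h) p" "contents p = {a..b}" "\<nu> = shape h - set p"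
    by blast
  obtain a' b' where *: "removable_at h a' b'" "contents p = {a'..b'}"
    "shape h - set p = shape (cut h a' b')"
    using removable_at_of_removable[OF h p(1)] by metis
  then have "a' = a" "b' = b" using p(2) r by (auto simp: removable_at_def Icc_eq_Icc)
  with * p show "\<nu> = shape (cut h a b)" by simp
qed

text \<open>
  A path is addable to a partition iff it is removable from the larger partition that it produces;
  this reduces adding to removing.
\<close>

lemma addable_at_of_addable:
  assumes h: "h \<in> LP" and p: "addable m n (shape h) p"
  obtains a b where "addable_at h a b" "lift h a b \<in> LP" "contents p = {a..b}"
    "shape h \<union> set p = shape (lift h a b)" "height m p = h a - int m"
proof -
  have sub: "shape h \<union> set p \<in> Pmn m n" and dis: "set p \<inter> shape h = {}"
    using p by (auto simp: addable_def)
  obtain g where g: "g \<in> LP" "shape h \<union> set p = shape g"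
    using Pmn_obtain[OF sub] by metis
  have minus: "shape g - set p = shape h" using dis g(2) by blast
  have "removable m n (shape g) p"
    using p minus g shape_Pmn[OF h] by (auto simp: removable_def addable_def)
  then obtain a b where ab: "removable_at g a b" "contents p = {a..b}"
    "shape g - set p = shape (cut g a b)" "int (level (hd p)) = g a - 2"
    using removable_at_of_removable[OF g(1)] by metis
  then have hg: "h = cut g a b" using minus shape_eq_iff[OF h cut_LP[OF g(1) ab(1)]] by simp
  then have gh: "g = lift h a b" by simp
  then have "addable_at h a b" using ab(1) removable_lift_iff by metis
  moreover have "height m p = h a - int m"
    using ab hg by (auto simp: height_def cut_def removable_at_def)
  ultimately show thesis using that g gh ab by blast
qed

lemma addable_of_addable_at:
  assumes h: "h \<in> LP" and r: "addable_at h a b" and g: "lift h a b \<in> LP"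
  obtains p where "addable m n (shape h) p" "contents p = {a..b}"
    "shape h \<union> set p = shape (lift h a b)" "height m p = h a - int m"
proof -
  have "removable_at (lift h a b) a b" using r removable_lift_iff by blast
  from removable_of_removable_at[OF g this] obtain p where
    p: "removable m n (shape (lift h a b)) p" "contents p = {a..b}"
    "shape (lift h a b) - set p = shape h" "int (level (hd p)) = lift h a b a - 2"
    by auto
  have "shape h \<union> set p = shape (lift h a b)" "set p \<inter> shape h = {}"
    using p(1,3) by (auto simp: removable_def)
  moreover have "addable m n (shape h) p"
    using p(1) calculation shape_Pmn[OF g] by (auto simp: removable_def addable_def)
  moreover have "height m p = h a - int m"
    using p(4) r by (auto simp: height_def lift_def addable_at_def)
  ultimately show thesis using that p by blast
qed

lemma DAdd_shape:
  assumes "h \<in> LP"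
  shows "P \<in> DAdd m n k (shape h) \<longleftrightarrow>
    (\<exists>a b. P = {a..b} \<and> addable_at h a b \<and> lift h a b \<in> LP \<and> k = h a - int m)"
proof
  assume "P \<in> DAdd m n k (shape h)"
  then obtain p where p: "addable m n (shape h) p" "contents p = P" "height m p = k"
    by (auto simp: DAdd_def)
  from addable_at_of_addable[OF assms p(1)] p(2,3)
  show "\<exists>a b. P = {a..b} \<and> addable_at h a b \<and> lift h a b \<in> LP \<and> k = h a - int m" by metis
next
  assume "\<exists>a b. P = {a..b} \<and> addable_at h a b \<and> lift h a b \<in> LP \<and> k = h a - int m"
  then obtain a b where ab: "P = {a..b}" "addable_at h a b" "lift h a b \<in> LP" "k = h a - int m" by blast
  from addable_of_addable_at[OF assms ab(2,3)] ab(1,4)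
  show "P \<in> DAdd m n k (shape h)" by (auto simp: DAdd_def) metis
qed

lemma dplus_shape:
  assumes h: "h \<in> LP" and r: "addable_at h a b" and g: "lift h a b \<in> LP"
  shows "dplus m n (shape h) {a..b} = shape (lift h a b)"
  unfolding dplus_def
proof (rule the_equality)
  show "\<exists>p. addable m n (shape h) p \<and> contents p = {a..b} \<and>
      shape (lift h a b) = shape h \<union> set p"
    using addable_of_addable_at[OF assms] by metis
next
  fix \<nu> assume "\<exists>p. addable m n (shape h) p \<and> contents p = {a..b} \<and> \<nu> = shape h \<union> set p"
  then obtain p where p: "addable m n (shape h) p" "contents p = {a..b}" "\<nu> = shape h \<union> set p"
    by blast
  obtain a' b' where *: "addable_at h a' b'" "contents p = {a'..b'}"
    "shape h \<union> set p = shape (lift h a' b')"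
    using addable_at_of_addable[OF h p(1)] by metis
  then have "a' = a" "b' = b" using p(2) r by (auto simp: addable_at_def Icc_eq_Icc)
  with * p show "\<nu> = shape (lift h a b)" by simp
qed

end

section \<open>Lowest arcs and the regularisation\<close>

text \<open>
  The interval from the first to the last position at which the minimum of \<open>h\<close> is attained. Lifting it
  is one step of the regularisation.
\<close>

definition lowest_arc :: "(int \<Rightarrow> int) \<Rightarrow> int \<Rightarrow> int \<Rightarrow> bool" where
  "lowest_arc h a b \<longleftrightarrow> h a = h b \<and> (\<forall>x. h a \<le> h x) \<and> (\<forall>x. h x = h a \<longrightarrow> a \<le> x \<and> x \<le> b)"

lemma lowest_arcD:
  assumes "lowest_arc h a b"
  shows "h a = h b" "h a \<le> h x" "h x \<le> h a \<Longrightarrow> a \<le> x \<and> x \<le> b" "a \<le> b"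
  using assms unfolding lowest_arc_def by (blast, blast, metis order_antisym, metis)

lemma lowest_arc_unique: "lowest_arc h a b \<Longrightarrow> lowest_arc h c d \<Longrightarrow> c = a \<and> d = b"
  by (metis lowest_arcD order_antisym)

lemma removable_atD:
  assumes "removable_at h a b"
  shows "a \<le> b" "h (a - 1) = h a - 1" "h (b + 1) = h b - 1" "h a = h b"
    "a \<le> x \<Longrightarrow> x \<le> b \<Longrightarrow> h a \<le> h x"
  using assms unfolding removable_at_def by blast+

lemma addable_atD:
  assumes "addable_at h a b"
  shows "a \<le> b" "h (a - 1) = h a + 1" "h (b + 1) = h b + 1" "h a = h b"
    "a \<le> x \<Longrightarrow> x \<le> b \<Longrightarrow> h a \<le> h x"
  using assms unfolding addable_at_def by blast+

text \<open>
  Matched pairs of parentheses do not cross. Disjoint arcs are even separated by a gap, since the step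
  out of the one is a down step and the step into the other is an up step.
\<close>

lemma removable_at_trichotomy:
  assumes "removable_at h a b" "removable_at h c d"
  shows "(c = a \<and> d = b) \<or> b + 1 < c \<or> d + 1 < a \<or> (a < c \<and> d < b) \<or> (c < a \<and> b < d)"
proof -
  note 1 = removable_atD[OF assms(1)] and 2 = removable_atD[OF assms(2)]
  have right: "d \<le> b \<or> b < c" if "a \<le> c"
  proof (rule ccontr)
    assume "\<not> (d \<le> b \<or> b < c)"
    then have "h c \<le> h (b + 1)" "h a \<le> h c" using 1(5)[of c] 2(5)[of "b + 1"] that by auto
    then show False using 1(3,4) by auto
  qed
  have left: "b \<le> d \<or> d < a" if "c \<le> a"
  proof (rule ccontr)
    assume "\<not> (b \<le> d \<or> d < a)"
    then have "h a \<le> h (d + 1)" "h c \<le> h a" using 2(5)[of a] 1(5)[of "d + 1"] that by auto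
    then show False using 2(3,4) by auto
  qed
  have ne: "c \<noteq> b + 1" "a \<noteq> d + 1" using 1(2,3) 2(2,3) by auto
  have strict: "d < b" if "a < c" "d \<le> b"
  proof (rule ccontr)
    assume "\<not> d < b"
    then have "d = b" using that by simp
    then have "h a \<le> h (c - 1)" using 1(5)[of "c - 1"] 2(1) that by auto
    then show False using 1(4) 2(2,4) \<open>d = b\<close> by auto
  qed
  have strict': "b < d" if "c < a" "b \<le> d"
  proof (rule ccontr)
    assume "\<not> b < d"
    then have "d = b" using that by simp
    then have "h c \<le> h (a - 1)" using 2(5)[of "a - 1"] 1(1) that by auto
    then show False using 2(4) 1(2,4) \<open>d = b\<close> by auto
  qed
  show ?thesis using right left ne strict strict' 1(1) 2(1) by force
qed

lemma removable_cut_disjoint: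
  assumes "removable_at h a b" "removable_at h c d" "b + 1 < c \<or> d + 1 < a"
  shows "removable_at (cut h a b) c d"
  using assms(2,3) removable_atD(1)[OF assms(1)] unfolding removable_at_def cut_def by auto

lemma removable_cut_inner:
  assumes "removable_at h a b" "removable_at h c d" "a < c" "d < b" "h a + 2 \<le> h c"
  shows "removable_at (cut h a b) c d" "removable_at (cut h c d) a b"
proof -
  note 1 = removable_atD[OF assms(1)] and 2 = removable_atD[OF assms(2)]
  show "removable_at (cut h a b) c d"
    using assms(3,4) 2 unfolding removable_at_def cut_def by auto
  have "h a \<le> h x - 2" if "c \<le> x" "x \<le> d" for x using 2(5)[OF that] assms(5) by simp
  then show "removable_at (cut h c d) a b"
    using assms(3,4) 1 2(1) unfolding removable_at_def cut_def by auto
qed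

text \<open>
  If the inner arc lies directly above the outer one, then its removal creates a new minimum that
  divides the outer arc into the parts on the left and on the right.
\<close>

lemma removable_cut_split:
  assumes "removable_at h a b" "removable_at h c d" "a < c" "d < b" "h c = h a + 1"
  shows "removable_at (cut h c d) a (c - 1)" "removable_at (cut h c d) (d + 1) b"
    "\<not> removable_at (cut h c d) a b"
proof -
  note 1 = removable_atD[OF assms(1)] and 2 = removable_atD[OF assms(2)]
  show "removable_at (cut h c d) a (c - 1)" "removable_at (cut h c d) (d + 1) b"
    using assms(3-5) 1 2(1-4) unfolding removable_at_def cut_def by auto
  have "cut h c d c < cut h c d a" using assms(3-5) 2(1) by (simp add: cut_def)
  then show "\<not> removable_at (cut h c d) a b"
    using removable_atD(5)[of "cut h c d" a b c] assms(3,4) 2(1) by fastforce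
qed

lemma nested_height:
  assumes "removable_at h a b" "removable_at h c d" "a < c" "d < b"
  shows "h a + 1 \<le> h c"
  using removable_atD(5)[OF assms(1), of "c - 1"] removable_atD(1,2)[OF assms(2)] assms(3,4) by auto

context rectangle begin

lemma lowest_arc_exists:
  assumes h: "h \<in> LP"
  obtains a b where "lowest_arc h a b" "1 \<le> h a" "h a \<le> int m + 1"
proof -
  let ?I = "{- int m - int n .. int m + int n}"
  define M where "M = Min (h ` ?I)"
  have big: "int m + 1 < h x" if "x \<notin> ?I" for x
    using lp_lower[OF h, of x] that by auto
  have Mle: "M \<le> int m + 1"
    using lp_left[OF h, of "- int m"] unfolding M_def by (intro Min_le) (auto intro!: image_eqI[of _ _ "- int m"])
  have Mmin: "M \<le> h x" for x
  proof (cases "x \<in> ?I")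
    case True then show ?thesis unfolding M_def by (intro Min_le) auto
  qed (use big[of x] Mle in auto)
  let ?S = "{x \<in> ?I. h x = M}"
  have "M \<in> h ` ?I" unfolding M_def by (intro Min_in) auto
  then have ne: "?S \<noteq> {}" by auto
  have fin: "finite ?S" by (rule finite_subset[of _ ?I]) auto
  have aS: "Min ?S \<in> ?S" and bS: "Max ?S \<in> ?S" using Min_in[OF fin ne] Max_in[OF fin ne] by auto
  have "Min ?S \<le> x \<and> x \<le> Max ?S" if "h x = M" for x
  proof -
    have "x \<in> ?S" using that big[of x] Mle by auto
    then show ?thesis using fin by simp
  qed
  then have "lowest_arc h (Min ?S) (Max ?S)" using aS bS Mmin by (auto simp: lowest_arc_def)
  moreover have "1 \<le> h (Min ?S)" using lp_lower[OF h, of "Min ?S"] by simp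
  ultimately show thesis using that aS Mle by auto
qed

lemma lowest_arc_addable:
  assumes h: "h \<in> LP" and l: "lowest_arc h a b" and M: "h a \<le> int m" and mn: "m \<le> n"
  shows "addable_at h a b" "lift h a b \<in> LP"
proof -
  note L = lowest_arcD[OF l]
  have "h (a - 1) = h a + 1" using lp_step_cases'[OF h, of a] L(3)[of "a - 1"] by auto
  moreover have "h (b + 1) = h b + 1" using lp_step_cases[OF h, of b] L(3)[of "b + 1"] L(1) by auto
  ultimately show add: "addable_at h a b" using L(1,2,4) by (auto simp: addable_at_def)
  have "- int m < a" by (rule lp_left_of[OF h M])
  moreover have "b < int n" using lp_right_of[OF h, of b] L(1) M mn by simp
  ultimately show "lift h a b \<in> LP" by (rule lift_LP[OF h add])
qed

text \<open>
  Lifting the lowest arc puts the new minima at its outer neighbours \<open>a - 1\<close> and \<open>b + 1\<close>, so the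
  paths added by successive steps of the regularisation are strictly nested.
\<close>

lemma lowest_arc_lift:
  assumes h: "h \<in> LP" and l: "lowest_arc h a b" and M: "h a \<le> int m" and mn: "m \<le> n"
    and L: "lowest_arc (lift h a b) A B"
  shows "lift h a b A = h a + 1" "A < a" "b < B"
proof -
  note add = addable_atD[OF lowest_arc_addable(1)[OF h l M mn]]
  note lo = lowest_arcD[OF l] and Lo = lowest_arcD[OF L]
  have ge: "h a + 1 \<le> lift h a b x" for x
    using lo(2)[of x] lo(3)[of x] by (cases "h x = h a") (auto simp: lift_def)
  have 1: "lift h a b (a - 1) = h a + 1" "lift h a b (b + 1) = h a + 1"
    using add(2,3,4) by (auto simp: lift_def)
  then show 2: "lift h a b A = h a + 1" using ge[of A] Lo(2)[of "a - 1"] by simp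
  show "A < a" "b < B" using Lo(3)[of "a - 1"] Lo(3)[of "b + 1"] 1 2 by auto
qed

definition up_step :: "(int \<Rightarrow> int) \<Rightarrow> (int \<Rightarrow> int) \<Rightarrow> bool" where
  "up_step g g' \<longleftrightarrow> g \<in> LP \<and> g' \<in> LP \<and> (\<exists>a b. addable_at g a b \<and> g' = lift g a b)"

text \<open>
  Moving the lift of the lowest arc to the front of an upward path may turn a later step into a
  removal. Such removals always take place strictly inside the lowest arc; they preserve the minimum
  and the lowest arc, so the argument can be repeated at the following levels.
\<close>

definition inner_down_step :: "(int \<Rightarrow> int) \<Rightarrow> (int \<Rightarrow> int) \<Rightarrow> bool" where
  "inner_down_step g g' \<longleftrightarrow> g \<in> LP \<and> g' \<in> LP \<and> (\<exists>a b c d. lowest_arc g a b \<and> removable_at g c d \<and>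
     a < c \<and> d < b \<and> g a + 2 \<le> g c \<and> g' = cut g c d)"

definition admissible :: "(int \<Rightarrow> int) \<Rightarrow> (int \<Rightarrow> int) \<Rightarrow> bool" where
  "admissible g g' \<longleftrightarrow> up_step g g' \<or> inner_down_step g g'"

text \<open>
  A staircase consists of all tiles up to a given level, so it is contained in the partition iff the
  first missing tile on every diagonal lies above that level.
\<close>

lemma staircase_subset_iff:
  assumes h: "h \<in> LP"
  shows "staircase d \<subseteq> shape h \<longleftrightarrow> (\<forall>x. int d < h x)"
proof
  assume *: "staircase d \<subseteq> shape h"
  show "\<forall>x. int d < h x"
  proof (rule allI, rule ccontr)
    fix x assume "\<not> int d < h x"
    note e = lp_parity[OF h, of x] lp_lower[OF h, of x]
    have "tile_at x (h x) \<in> staircase d"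
      using tile_at_props[OF e] \<open>\<not> int d < h x\<close> by (auto simp: staircase_def young_def case_prod_beta)
    with * show False using tile_at_in_shape[OF e, of h] by auto
  qed
next
  assume *: "\<forall>x. int d < h x"
  show "staircase d \<subseteq> shape h"
  proof
    fix t assume "t \<in> staircase d"
    then obtain r c where t: "t = (r, c)" "1 \<le> r" "1 \<le> c" "c \<le> d + 1 - r"
      by (auto simp: staircase_def young_def)
    then show "t \<in> shape h"
      using *[rule_format, of "int r - int c"] by (auto simp: shape_def)
  qed
qed

lemma defect_shape:
  assumes h: "h \<in> LP" and l: "lowest_arc h a b"
  shows "defect m (shape h) = h a - 1 - int m"
proof -
  obtain a' b' where "lowest_arc h a' b'" "1 \<le> h a'" "h a' \<le> int m + 1" by (rule lowest_arc_exists[OF h])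
  then have M: "1 \<le> h a" "h a \<le> int m + 1" using lowest_arc_unique[OF l] by auto
  have "d \<le> m \<and> (\<forall>x. int d < h x) \<longleftrightarrow> d \<le> nat (h a - 1)" for d
    using M lowest_arcD(2)[OF l] by (auto simp: le_nat_iff intro: less_le_trans)
  then have "{d. d \<le> m \<and> staircase d \<subseteq> shape h} = {..nat (h a - 1)}"
    unfolding staircase_subset_iff[OF h] by blast
  moreover have "Max {..k} = k" for k :: nat by (rule Max_eqI) auto
  ultimately show ?thesis using M by (simp add: defect_def)
qed

lemma Rmn_shape:
  assumes h: "h \<in> LP"
  shows "shape h \<in> Rmn m n \<longleftrightarrow> (\<forall>x. int m + 1 \<le> h x)"
  by (simp add: Rmn_def staircase_subset_iff[OF h] shape_Pmn[OF h] add1_zle_eq)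

text \<open>
  An addable path at the level of the minimum has both ends at minima. The one from the first to the
  last minimum therefore contains all others and is the only one of maximal breadth.
\<close>

lemma reg_step_shape:
  assumes h: "h \<in> LP" and l: "lowest_arc h a b" and M: "h a \<le> int m" and mn: "m \<le> n"
  shows "reg_step m n (h a - int m) (shape h) = shape (lift h a b)"
proof -
  note add = lowest_arc_addable[OF h l M mn]
  let ?D = "DAdd m n (h a - int m) (shape h)"
  have mem: "{a..b} \<in> ?D" using add DAdd_shape[OF h] by blast
  have breadth: "int (breadth {c..d}) = (d - c) div 2 + 1" if "c \<le> d" for c d :: int
    using that by (simp add: breadth_def nat_add_distrib zdiv_int nat_div_distrib)
  have other: "breadth P < breadth {a..b}" if P: "P \<in> ?D" "P \<noteq> {a..b}" for P
  proof -
    from P(1)[unfolded DAdd_shape[OF h]]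
    obtain c d where cd: "P = {c..d}" "addable_at h c d" "h a - int m = h c - int m" by blast
    have le: "a \<le> c" "d \<le> b" "c \<le> d" "h d = h a"
      using lowest_arcD(3)[OF l, of c] lowest_arcD(3)[OF l, of d] addable_atD(1,4)[OF cd(2)] cd(3) by auto
    have ab: "a \<le> b" "h b = h a" using lowest_arcD[OF l] by auto
    have "even (d - c)" "even (b - a)" "even (c - a)"
      using lp_parity[OF h, of a] lp_parity[OF h, of b] lp_parity[OF h, of c] lp_parity[OF h, of d] le ab cd(3)
      by auto
    moreover have "d - c < b - a" using P(2) cd(1) le by auto
    ultimately have "(d - c) div 2 < (b - a) div 2" by presburger
    then have "int (breadth P) < int (breadth {a..b})" using breadth le ab cd(1) by simp
    then show ?thesis by simp
  qed
  have "(ARG_MAX breadth P. P \<in> ?D) = {a..b}"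
    unfolding arg_max_def
  proof (rule some_equality)
    show "is_arg_max breadth (\<lambda>P. P \<in> ?D) {a..b}"
      using mem other unfolding is_arg_max_def by (metis order.asym order.irrefl)
    show "P = {a..b}" if "is_arg_max breadth (\<lambda>P. P \<in> ?D) P" for P
      using that mem other[of P] unfolding is_arg_max_def by blast
  qed
  then show ?thesis using dplus_shape[OF h add] by (simp add: reg_step_def)
qed

definition lowest_lift :: "(int \<Rightarrow> int) \<Rightarrow> (int \<Rightarrow> int)" where
  "lowest_lift h = (THE g. \<exists>a b. lowest_arc h a b \<and> g = lift h a b)"

lemma lowest_lift_eq: "lowest_arc h a b \<Longrightarrow> lowest_lift h = lift h a b"
  unfolding lowest_lift_def by (rule the_equality) (use lowest_arc_unique in blast)+

definition reg_chain :: "(int \<Rightarrow> int) \<Rightarrow> nat \<Rightarrow> (int \<Rightarrow> int)" where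
  "reg_chain h i = (lowest_lift ^^ i) h"

lemma reg_chain_lowest:
  assumes h: "h \<in> LP" and l: "lowest_arc h a b" and mn: "m \<le> n" and i: "h a + int i \<le> int m + 1"
  obtains A B where "reg_chain h i \<in> LP" "lowest_arc (reg_chain h i) A B" "reg_chain h i A = h a + int i"
proof -
  have "reg_chain h i \<in> LP \<and> (\<exists>A B. lowest_arc (reg_chain h i) A B \<and> reg_chain h i A = h a + int i)"
    using i
  proof (induction i)
    case 0
    then show ?case using h l by (auto simp: reg_chain_def)
  next
    case (Suc i)
    then obtain A B where *: "reg_chain h i \<in> LP" "lowest_arc (reg_chain h i) A B" "reg_chain h i A = h a + int i"
      by auto
    have M: "reg_chain h i A \<le> int m" using Suc.prems *(3) by simp
    have eq: "reg_chain h (Suc i) = lift (reg_chain h i) A B"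
      using lowest_lift_eq[OF *(2)] by (simp add: reg_chain_def)
    have LP: "reg_chain h (Suc i) \<in> LP" using lowest_arc_addable(2)[OF *(1,2) M mn] eq by simp
    obtain C D where "lowest_arc (reg_chain h (Suc i)) C D" by (rule lowest_arc_exists[OF LP])
    then show ?case using LP lowest_arc_lift(1)[OF *(1,2) M mn] *(3) eq by auto
  qed
  then show thesis using that by blast
qed

lemma reg_iter_shape:
  assumes h: "h \<in> LP" and l: "lowest_arc h a b" and mn: "m \<le> n" and i: "h a + int i \<le> int m + 1"
  shows "reg_iter m n (shape h) i = shape (reg_chain h i)"
  using i
proof (induction i)
  case (Suc i)
  then have i: "h a + int i \<le> int m + 1" by simp
  obtain A B where *: "reg_chain h i \<in> LP" "lowest_arc (reg_chain h i) A B" "reg_chain h i A = h a + int i"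
    by (rule reg_chain_lowest[OF h l mn i])
  have M: "reg_chain h i A \<le> int m" using Suc.prems *(3) by simp
  have eq: "reg_chain h (Suc i) = lift (reg_chain h i) A B"
    using lowest_lift_eq[OF *(2)] by (simp add: reg_chain_def)
  have k: "defect m (shape h) + int (Suc i) = reg_chain h i A - int m"
    using defect_shape[OF h l] *(3) by simp
  show ?case using Suc.IH[OF i] reg_step_shape[OF *(1,2) M mn] k eq by (simp add: add.commute)
qed (simp add: reg_chain_def)


text \<open>
  An addable path that leaves the minimum unchanged either avoids both ends of the lowest arc, and then
  lies beside it or strictly inside, or it shares exactly one of them and lies at the minimal level.
\<close>

lemma addable_overlap_cases:
  assumes g: "g \<in> LP" and l: "lowest_arc g a b" and add: "addable_at g c d"
    and low: "lift g c d y \<le> g a"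
  obtains "d + 1 < a \<or> b + 1 < c \<or> (a < c \<and> d < b)"
  | "c = a" "d < b" "g d = g a" | "d = b" "a < c" "g c = g a"
proof -
  note L = lowest_arcD[OF l] and D = addable_atD[OF add]
  have a: "c = a \<and> g d = g a \<and> d \<le> b" if "c \<le> a" "a \<le> d"
    using D(4) D(5)[OF that] L(3)[of c] L(2)[of c] L(3)[of d] that by auto
  have b: "d = b \<and> g c = g a \<and> a \<le> c" if "c \<le> b" "b \<le> d"
  proof -
    have "g c \<le> g a" using D(5)[OF that] unfolding L(1) .
    then have "a \<le> c" "d \<le> b" "g c = g a" using L(3)[of c] L(3)[of d] L(2)[of c] D(4) by linarith+
    then show ?thesis using that by simp
  qed
  have ne: "d + 1 \<noteq> a" "c \<noteq> b + 1"
    using D(2,3,4) L(1) L(2)[of d] L(2)[of c] by auto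
  have "\<not> (c = a \<and> d = b)"
  proof
    assume "c = a \<and> d = b"
    then show False using low L(2)[of y] L(3)[of y] by (auto simp: lift_def split: if_splits)
  qed
  then show thesis using that a b ne D(1) L(4) by (metis linorder_le_less_linear order_le_less zless_add1_eq)
qed

text \<open>
  Once the lowest arc is lifted, the gap between two consecutive minima is a removable arc directly
  above it. Removing this arc undoes the lift in the gap, which amounts to lifting the two sides
  separately.
\<close>

lemma lowest_arc_split:
  assumes g: "g \<in> LP" and l: "lowest_arc g a b" and M: "g a \<le> int m" and mn: "m \<le> n"
    and s: "a \<le> d" "d < c" "c \<le> b" "g d = g a" "g c = g a" "\<And>x. d < x \<Longrightarrow> x < c \<Longrightarrow> g a < g x"
  shows "removable_at (lift g a b) (d + 1) (c - 1)" "lift g a b (d + 1) = g a + 3" "d + 2 \<le> c"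
proof -
  note L = lowest_arcD[OF l]
  show gap: "d + 2 \<le> c" using lp_step[OF g, of d] s by (cases "c = d + 1") auto
  have 1: "g (d + 1) = g a + 1" using lp_step_cases[OF g, of d] s(4) s(6)[of "d + 1"] gap by auto
  have 2: "g (c - 1) = g a + 1" using lp_step_cases'[OF g, of c] s(5) s(6)[of "c - 1"] gap by auto
  show "lift g a b (d + 1) = g a + 3" using 1 s gap by (simp add: lift_def)
  have 3: "g a + 1 \<le> g x" if "d + 1 \<le> x" "x \<le> c - 1" for x using s(6)[of x] that by auto
  have 4: "lift g a b (d + 1) = g a + 3" "lift g a b (c - 1) = g a + 3" "lift g a b d = g a + 2"
    "lift g a b c = g a + 2"
    using gap s 1 2 by (simp_all add: lift_def)
  have 5: "g a + 3 \<le> lift g a b x" if "d + 1 \<le> x" "x \<le> c - 1" for x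
    using 3[OF that] that s(1,3) by (simp add: lift_def)
  show "removable_at (lift g a b) (d + 1) (c - 1)"
    unfolding removable_at_def using gap 4 5 by simp
qed

definition commuting_at :: "(int \<Rightarrow> int) \<Rightarrow> int \<Rightarrow> int \<Rightarrow> int \<Rightarrow> int \<Rightarrow> bool" where
  "commuting_at h a b c d \<longleftrightarrow> removable_at h a b \<and> removable_at h c d \<and>
     removable_at (cut h a b) c d \<and> removable_at (cut h c d) a b"

text \<open>
  The arcs \<open>[c, d]\<close> and \<open>[a, b]\<close> are nested without room in between; these are the pairs of removable
  paths that do not commute.
\<close>

definition splitting_at :: "(int \<Rightarrow> int) \<Rightarrow> int \<Rightarrow> int \<Rightarrow> int \<Rightarrow> int \<Rightarrow> bool" where
  "splitting_at h a b c d \<longleftrightarrow> removable_at h a b \<and> removable_at h c d \<and> a < c \<and> d < b \<and> h c = h a + 1"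

lemma removable_pair_cases:
  assumes "removable_at h a b" "removable_at h c d"
  obtains "c = a" "d = b" | "commuting_at h a b c d" | "splitting_at h a b c d" | "splitting_at h c d a b"
proof -
  consider "c = a \<and> d = b" | "b + 1 < c \<or> d + 1 < a" | "a < c \<and> d < b" | "c < a \<and> b < d"
    using removable_at_trichotomy[OF assms] by blast
  then show thesis
  proof cases
    case 2
    then have "commuting_at h a b c d"
      using assms removable_cut_disjoint[OF assms] removable_cut_disjoint[OF assms(2,1)]
      by (auto simp: commuting_at_def)
    then show thesis by (rule that)
  next
    case 3
    show thesis
    proof (cases "h c = h a + 1")
      case False
      then have "h a + 2 \<le> h c" using nested_height[OF assms] 3 by simp
      then have "commuting_at h a b c d"
        using removable_cut_inner[OF assms] assms 3 by (auto simp: commuting_at_def)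
      then show thesis by (rule that)
    qed (use that(3) assms 3 in \<open>simp add: splitting_at_def\<close>)
  next
    case 4
    show thesis
    proof (cases "h a = h c + 1")
      case False
      then have "h c + 2 \<le> h a" using nested_height[OF assms(2,1)] 4 by simp
      then have "commuting_at h a b c d"
        using removable_cut_inner[OF assms(2,1)] assms 4 by (auto simp: commuting_at_def)
      then show thesis by (rule that)
    qed (use that(4) assms 4 in \<open>simp add: splitting_at_def\<close>)
  qed (use that(1) in blast)
qed

text \<open>
  The lift of the lowest arc after an admissible step can be carried out first. If the step is a
  removal, or adds a path that avoids the ends of the lowest arc, then the two operations commute. If
  the step fills part of the minima, then its path and the subsequent lift fill two sides of a gap;
  lifting the whole lowest arc and removing the gap gives the same result.
\<close>

lemma admissible_exchange:
  assumes g: "g \<in> LP" and l: "lowest_arc g a b" and M: "g a \<le> int m" and mn: "m \<le> n"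
    and adm: "admissible g g'" and l': "lowest_arc g' a' b'" and M': "g' a' = g a"
  shows "admissible (lift g a b) (lift g' a' b')"
    and "(\<exists>c d. commuting_at (lift g' a' b') a b c d \<and> cut (lift g' a' b') a b = g' \<and>
            cut (lift g' a' b') c d = lift g a b \<and> cut g' c d = g) \<or>
         (\<exists>c d. commuting_at (lift g a b) a b c d \<and> g' = cut g c d \<and>
            lift g' a' b' = cut (lift g a b) c d) \<or>
         (\<exists>c d. splitting_at (lift g a b) a b c d \<and> lift g' a' b' = cut (lift g a b) c d \<and>
            (g' = cut (cut (lift g a b) c d) a (c - 1) \<or> g' = cut (cut (lift g a b) c d) (d + 1) b))"
      (is "?up \<or> ?down \<or> ?split")
proof -
  let ?G = "lift g a b" and ?G' = "lift g' a' b'"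
  note L = lowest_arcD[OF l] and L' = lowest_arcD[OF l']
  note add = lowest_arc_addable[OF g l M mn]
  have G: "?G \<in> LP" by (rule add(2))
  have g': "g' \<in> LP" using adm by (auto simp: admissible_def up_step_def inner_down_step_def)
  have M'': "g' a' \<le> int m" using M M' by simp
  note add' = lowest_arc_addable[OF g' l' M'' mn]
  have G': "?G' \<in> LP" by (rule add'(2))
  obtain A B where AB: "lowest_arc ?G A B" using lowest_arc_exists[OF G] by blast
  note ABp = lowest_arc_lift[OF g l M mn AB]
  have remG: "removable_at ?G a b" using add(1) removable_lift_iff by blast
  have "admissible ?G ?G' \<and> (?up \<or> ?down \<or> ?split)"
    using adm unfolding admissible_def[of g g']
  proof
    assume "inner_down_step g g'"
    then obtain a'' b'' c d where "lowest_arc g a'' b''" "a'' < c" "d < b''" "g a'' + 2 \<le> g c"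
      and cd0: "removable_at g c d" "g' = cut g c d"
      unfolding inner_down_step_def by blast
    then have cd: "removable_at g c d" "a < c" "d < b" "g a + 2 \<le> g c" "g' = cut g c d"
      using lowest_arc_unique[OF l] cd0 by blast+
    note D = removable_atD[OF cd(1)]
    have ge: "g a \<le> g x - 2" if "c \<le> x" "x \<le> d" for x using D(5)[OF that] cd(4) by simp
    have "g' a = g a" "g' b = g a" using cd L(1) D(1) by (auto simp: cut_def)
    moreover have "g a \<le> g' x" for x using L(2)[of x] ge[of x] cd(5) by (auto simp: cut_def)
    moreover have "a \<le> x \<and> x \<le> b" if "g' x = g a" for x
      using that L(3)[of x] cd(2,3,5) by (auto simp: cut_def split: if_splits)
    ultimately have "lowest_arc g' a b" unfolding lowest_arc_def by metis
    then have [simp]: "a' = a" "b' = b" using lowest_arc_unique[OF l'] by auto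
    have G'eq: "?G' = cut ?G c d" using cd by (auto simp: cut_def lift_def)
    have remc: "removable_at ?G c d"
      using D cd(2,3) unfolding removable_at_def lift_def by auto
    have "removable_at (cut ?G c d) a b" using add'(1) removable_lift_iff[of g' a b] G'eq by simp
    then have "commuting_at ?G a b c d" using remG remc cd(1) by (simp add: commuting_at_def)
    then have ?down using cd(5) G'eq by blast
    moreover have "inner_down_step ?G ?G'"
      unfolding inner_down_step_def
      using G G' AB remc G'eq ABp cd(2-4) D(1)
      by (intro conjI exI[of _ A] exI[of _ B] exI[of _ c] exI[of _ d]) (auto simp: lift_def)
    ultimately show ?thesis by (simp add: admissible_def)
  next
    assume "up_step g g'"
    then obtain c d where cd: "addable_at g c d" "g' = lift g c d" by (auto simp: up_step_def)
    note D = addable_atD[OF cd(1)]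
    have low: "lift g c d a' \<le> g a" using M' cd(2) by simp
    show ?thesis
    proof (rule addable_overlap_cases[OF g l cd(1) low])
      assume pos: "d + 1 < a \<or> b + 1 < c \<or> (a < c \<and> d < b)"
      have "g' a = g a" "g' b = g a" using pos cd(2) L(1) D(1) L(4) by (auto simp: lift_def)
      moreover have "g a \<le> g' x" "g x \<le> g' x" for x using L(2)[of x] cd(2) by (auto simp: lift_def)
      ultimately have "lowest_arc g' a b" unfolding lowest_arc_def using L(3) by metis
      then have [simp]: "a' = a" "b' = b" using lowest_arc_unique[OF l'] by auto
      have G'eq: "?G' = lift ?G c d" using cd by (auto simp: lift_def)
      have addc: "addable_at ?G c d"
        using D pos unfolding addable_at_def lift_def by auto
      have cG: "cut ?G' c d = ?G" and cG': "cut ?G' a b = g'" unfolding G'eq by simp (simp flip: G'eq)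
      have "removable_at ?G' a b" using add'(1) removable_lift_iff[of g' a b] by simp
      moreover have "removable_at ?G' c d" using addc removable_lift_iff[of ?G c d] G'eq by simp
      moreover have "removable_at g' c d" using cd removable_lift_iff[of g c d] by simp
      ultimately have "commuting_at ?G' a b c d" using remG by (simp only: commuting_at_def cG cG')
      moreover have "cut g' c d = g" using cd(2) by simp
      ultimately have ?up using cG cG' by (simp only:) blast
      moreover have "up_step ?G ?G'" using addc G'eq G G' by (auto simp: up_step_def)
      ultimately show ?thesis by (simp add: admissible_def)
    next
      assume *: "c = a" "d < b" "g d = g a"
      have b': "b' = b" and a': "d < a'"
      proof -
        have "g' b = g a" using cd(2) * L(1) by (simp add: lift_def)
        then have "b \<le> b'" using L'(3)[of b] M' by simp
        moreover have "g b' \<le> g a" using L'(1) M' cd(2) by (auto simp: lift_def split: if_splits)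
        then have "b' \<le> b" using L(3)[of b'] by simp
        ultimately show "b' = b" by simp
        have "g a' \<le> g a" using M' cd(2) by (auto simp: lift_def split: if_splits)
        then have "a \<le> a'" using L(3) by blast
        moreover have "\<not> a' \<le> d"
        proof
          assume "a' \<le> d"
          then have "g' a' = g a' + 2" using \<open>a \<le> a'\<close> cd(2) * by (simp add: lift_def)
          then show False using M' L(2)[of a'] by simp
        qed
        ultimately show "d < a'" by simp
      qed
      have ga': "g a' = g a" using M' cd(2) a' by (simp add: lift_def)
      have between: "g a < g x" if "d < x" "x < a'" for x
        using L'(2)[of x] L'(3)[of x] M' cd(2) that by (force simp: lift_def)
      have a'b: "a' \<le> b" using L'(4) b' by simp
      note S = lowest_arc_split[OF g l M mn _ a' a'b *(3) ga' between]
      have ad: "a \<le> d" using D(1) * by simp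
      have rem: "removable_at ?G (d + 1) (a' - 1)" using S(1) ad by blast
      have hd: "?G (d + 1) = g a + 3" and gap: "d + 2 \<le> a'" using S(2,3) ad by blast+
      have G'eq: "?G' = cut ?G (d + 1) (a' - 1)"
        using cd(2) * b' gap ad a'b by (auto simp: lift_def cut_def fun_eq_iff)
      have spl: "splitting_at ?G a b (d + 1) (a' - 1)"
        unfolding splitting_at_def using remG rem hd ad a'b L(4) by (auto simp: lift_def)
      have "g' = cut (cut ?G (d + 1) (a' - 1)) (a' - 1 + 1) b"
        using cd(2) * gap ad a'b by (auto simp: lift_def cut_def fun_eq_iff)
      then have ?split using spl G'eq by blast
      moreover have "inner_down_step ?G ?G'"
        unfolding inner_down_step_def
        using G G' AB rem G'eq ABp hd ad a'b
        by (intro conjI exI[of _ A] exI[of _ B] exI[of _ "d + 1"] exI[of _ "a' - 1"]) auto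
      ultimately show ?thesis by (simp add: admissible_def)
    next
      assume *: "d = b" "a < c" "g c = g a"
      have a': "a' = a" and b': "b' < c"
      proof -
        have "g' a = g a" using cd(2) * by (simp add: lift_def)
        then have "a' \<le> a" using L'(3)[of a] M' by simp
        moreover have "g a' \<le> g a" using M' cd(2) by (auto simp: lift_def split: if_splits)
        then have "a \<le> a'" using L(3)[of a'] by simp
        ultimately show "a' = a" by simp
        have "g b' \<le> g a" using L'(1) M' cd(2) by (auto simp: lift_def split: if_splits)
        then have "b' \<le> b" using L(3) by blast
        moreover have "\<not> c \<le> b'"
        proof
          assume "c \<le> b'"
          then have "g' b' = g b' + 2" using \<open>b' \<le> b\<close> cd(2) * by (simp add: lift_def)
          then show False using M' L'(1) L(2)[of b'] by simp
        qed
        ultimately show "b' < c" by simp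
      qed
      have gb': "g b' = g a" using M' L'(1) cd(2) b' by (simp add: lift_def)
      have between: "g a < g x" if "b' < x" "x < c" for x
        using L'(2)[of x] L'(3)[of x] M' cd(2) that by (force simp: lift_def)
      have ab': "a \<le> b'" using L'(4) a' by simp
      have cb: "c \<le> b" using D(1) * by simp
      note S = lowest_arc_split[OF g l M mn ab' b' cb gb' *(3) between]
      have rem: "removable_at ?G (b' + 1) (c - 1)" using S(1) by blast
      have hd: "?G (b' + 1) = g a + 3" and gap: "b' + 2 \<le> c" using S(2,3) by blast+
      have G'eq: "?G' = cut ?G (b' + 1) (c - 1)"
        using cd(2) * a' gap ab' cb by (auto simp: lift_def cut_def fun_eq_iff)
      have spl: "splitting_at ?G a b (b' + 1) (c - 1)"
        unfolding splitting_at_def using remG rem hd ab' cb L(4) by (auto simp: lift_def)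
      have "g' = cut (cut ?G (b' + 1) (c - 1)) a (b' + 1 - 1)"
        using cd(2) * gap ab' cb by (auto simp: lift_def cut_def fun_eq_iff)
      then have ?split using spl G'eq by blast
      moreover have "inner_down_step ?G ?G'"
        unfolding inner_down_step_def
        using G G' AB rem G'eq ABp hd ab' cb
        by (intro conjI exI[of _ A] exI[of _ B] exI[of _ "b' + 1"] exI[of _ "c - 1"]) auto
      ultimately show ?thesis by (simp add: admissible_def)
    qed
  qed
  then show "admissible ?G ?G'" "?up \<or> ?down \<or> ?split" by blast+
qed

lemma admissible_raises_lowest:
  assumes g: "g \<in> LP" and l: "lowest_arc g a b" and adm: "admissible g g'" and ge: "\<And>x. g a < g' x"
  shows "g' = lift g a b"
proof -
  note L = lowest_arcD[OF l]
  have "\<not> inner_down_step g g'"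
  proof
    assume "inner_down_step g g'"
    then obtain a' b' c d where "lowest_arc g a' b'" "a' < c" and cd: "g' = cut g c d"
      unfolding inner_down_step_def by blast
    then have "a < c" using lowest_arc_unique[OF l] by blast
    then show False using ge[of a] cd by (simp add: cut_def)
  qed
  then obtain c d where cd: "addable_at g c d" "g' = lift g c d"
    using adm by (auto simp: admissible_def up_step_def)
  note D = addable_atD[OF cd(1)]
  have le: "c \<le> a" "a \<le> d" "b \<le> d"
    using ge[of a] ge[of b] cd(2) L(1) by (auto simp: lift_def split: if_splits)
  then have "g c \<le> g a" using D(5)[of a] by simp
  then have "a \<le> c" "d \<le> b" using L(3)[of c] L(3)[of d] D(4) by (blast, metis)
  then show ?thesis using le cd(2) by simp
qed

lemma admissible_lowest_mono:
  assumes l: "lowest_arc g a b" and adm: "admissible g g'"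
  shows "g a \<le> g' x"
proof -
  note L = lowest_arcD[OF l]
  from adm show ?thesis unfolding admissible_def
  proof
    assume "up_step g g'"
    then show ?thesis using L(2)[of x] by (auto simp: up_step_def lift_def)
  next
    assume "inner_down_step g g'"
    then obtain a' b' c d where "lowest_arc g a' b'" "g a' + 2 \<le> g c"
      and cd: "removable_at g c d" "g' = cut g c d"
      unfolding inner_down_step_def by blast
    then have "g a + 2 \<le> g c" using lowest_arc_unique[OF l] by blast
    with cd have cd: "removable_at g c d" "g a + 2 \<le> g c" "g' = cut g c d" by auto
    then show ?thesis using L(2)[of x] removable_atD(5)[OF cd(1), of x] by (auto simp: cut_def)
  qed
qed

end

section \<open>Relations modulo the defining ideal\<close>

abbreviation scalar :: "'k::field \<Rightarrow> 'k free_elem" where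
  "scalar c \<equiv> Poly_Mapping.single 0 c"

lemma poly_mapping_sum_singles:
  fixes f :: "'a \<Rightarrow>\<^sub>0 'b::comm_monoid_add"
  shows
  "f = (\<Sum>w\<in>Poly_Mapping.keys f. Poly_Mapping.single w (Poly_Mapping.lookup f w))"
  by (rule poly_mapping_eqI)
    (auto simp: lookup_sum lookup_single when_def in_keys_iff sum.delta)

lemma scalar_commute: "scalar c * f = f * scalar c"
proof -
  have "scalar c * f = (\<Sum>w\<in>Poly_Mapping.keys f. scalar c * Poly_Mapping.single w (Poly_Mapping.lookup f w))"
    by (subst poly_mapping_sum_singles[of f]) (simp add: sum_distrib_left)
  also have "\<dots> = (\<Sum>w\<in>Poly_Mapping.keys f. Poly_Mapping.single w (Poly_Mapping.lookup f w) * scalar c)"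
    by (simp add: mult_single mult.commute)
  also have "\<dots> = f * scalar c"
    by (subst (2) poly_mapping_sum_singles[of f]) (simp add: sum_distrib_right)
  finally show ?thesis .
qed

global_interpretation fs: vector_space "\<lambda>(c::'k::field) (f::'k free_elem). scalar c * f"
  by standard (simp_all add: distrib_left distrib_right single_add mult_single flip: mult.assoc)

lemma lookup_dual: "Poly_Mapping.lookup (dual f) w = Poly_Mapping.lookup f (dual_word w)"
  by (simp add: dual_def map_key.rep_eq inj_dual_word)

lemma dual_diff: "dual (f - g) = dual f - dual g"
  by (rule poly_mapping_eqI) (simp add: lookup_dual lookup_minus)

locale arc_presentation = rectangle m n for m n :: nat +
  fixes ground_field :: "'k::field itself"
begin

abbreviation FA :: "'k free_elem ring" where "FA \<equiv> free_algebra (generators m n)"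
abbreviation RI :: "'k free_elem set" where "RI \<equiv> rel_ideal m n"

lemma ring_FA: "ring FA" by (rule ring_free_algebra)

lemma ideal_RI: "ideal RI FA"
  unfolding rel_ideal_def by (intro ring.genideal_ideal ring_FA relations_carrier)

lemma FA_ops: "mult FA = (*)" "add FA = (+)" "zero FA = 0" "one FA = 1"
  by (simp_all add: free_algebra_def)

lemma F_zero [simp, intro]: "0 \<in> carrier FA"
  using ring.ring_simprules(2)[OF ring_FA] by (simp only: FA_ops)

lemma F_one [simp, intro]: "1 \<in> carrier FA"
  using ring.ring_simprules(6)[OF ring_FA] by (simp only: FA_ops)

lemma F_mult [simp, intro]: "f \<in> carrier FA \<Longrightarrow> g \<in> carrier FA \<Longrightarrow> f * g \<in> carrier FA"
  using ring.ring_simprules(5)[OF ring_FA] by (simp only: FA_ops)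

lemma F_add [simp, intro]: "f \<in> carrier FA \<Longrightarrow> g \<in> carrier FA \<Longrightarrow> f + g \<in> carrier FA"
  using ring.ring_simprules(1)[OF ring_FA] by (simp only: FA_ops)

lemma F_uminus [simp, intro]: "f \<in> carrier FA \<Longrightarrow> - f \<in> carrier FA"
  by (simp add: free_algebra_def)

lemma F_diff [simp, intro]: "f \<in> carrier FA \<Longrightarrow> g \<in> carrier FA \<Longrightarrow> f - g \<in> carrier FA"
  using F_add[of f "- g"] by simp

lemma F_scalar [simp, intro]: "scalar c \<in> carrier FA"
  by (auto simp: free_algebra_def zero_free_monoid_def)

lemma F_sum [intro]: "(\<And>x. x \<in> X \<Longrightarrow> f x \<in> carrier FA) \<Longrightarrow> sum f X \<in> carrier FA"
  by (induction X rule: infinite_finite_induct) auto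

lemma F_power [simp, intro]: "f \<in> carrier FA \<Longrightarrow> f ^ k \<in> carrier FA"
  by (induction k) auto

lemma F_arr [simp, intro]: "arr m n a b \<in> carrier FA"
  by (auto simp: arr_def free_algebra_def generators_def)

lemma F_idem [simp, intro]: "a \<in> Pmn m n \<Longrightarrow> idem a \<in> carrier FA"
  by (auto simp: idem_def free_algebra_def generators_def)

lemma RI_sub: "f \<in> RI \<Longrightarrow> f \<in> carrier FA"
  using ideal.Icarr[OF ideal_RI] .

lemma RI_zero [simp, intro]: "0 \<in> RI"
  using additive_subgroup.zero_closed[OF ideal.axioms(1)[OF ideal_RI]] by (simp add: FA_ops)

lemma RI_add [intro]: "f \<in> RI \<Longrightarrow> g \<in> RI \<Longrightarrow> f + g \<in> RI"
  using additive_subgroup.a_closed[OF ideal.axioms(1)[OF ideal_RI]] by (simp add: FA_ops)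

lemma RI_left [intro]: "f \<in> carrier FA \<Longrightarrow> g \<in> RI \<Longrightarrow> f * g \<in> RI"
  using ideal.I_l_closed[OF ideal_RI] by (simp add: FA_ops)

lemma RI_right [intro]: "g \<in> RI \<Longrightarrow> f \<in> carrier FA \<Longrightarrow> g * f \<in> RI"
  using ideal.I_r_closed[OF ideal_RI] by (simp add: FA_ops)

lemma RI_uminus [intro]: "f \<in> RI \<Longrightarrow> - f \<in> RI"
  using RI_left[of "- 1" f] by (simp add: F_uminus)

lemma RI_diff [intro]: "f \<in> RI \<Longrightarrow> g \<in> RI \<Longrightarrow> f - g \<in> RI"
  using RI_add[of f "- g"] RI_uminus[of g] by simp

lemma RI_sym: "f - g \<in> RI \<Longrightarrow> g - f \<in> RI"
  using RI_uminus[of "f - g"] by simp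

lemma RI_relation: "f \<in> relations m n \<Longrightarrow> f \<in> RI"
  unfolding rel_ideal_def using ring.genideal_self[OF ring_FA relations_carrier] by blast

text \<open>
  Linear span in the free algebra modulo the relations.
\<close>

definition rspan :: "'k free_elem set \<Rightarrow> 'k free_elem set" where
  "rspan B = fs.span (RI \<union> B)"

lemma rspan_RI: "f \<in> RI \<Longrightarrow> f \<in> rspan B"
  and rspan_base: "f \<in> B \<Longrightarrow> f \<in> rspan B"
  and rspan_zero: "0 \<in> rspan B"
  and rspan_add: "f \<in> rspan B \<Longrightarrow> g \<in> rspan B \<Longrightarrow> f + g \<in> rspan B"
  and rspan_diff: "f \<in> rspan B \<Longrightarrow> g \<in> rspan B \<Longrightarrow> f - g \<in> rspan B"
  and rspan_uminus: "f \<in> rspan B \<Longrightarrow> - f \<in> rspan B"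
  and rspan_scale: "f \<in> rspan B \<Longrightarrow> scalar c * f \<in> rspan B"
  and rspan_sum: "(\<And>x. x \<in> X \<Longrightarrow> \<phi> x \<in> rspan B) \<Longrightarrow> sum \<phi> X \<in> rspan B"
  unfolding rspan_def
  by (auto intro: fs.span_base fs.span_zero fs.span_add fs.span_diff fs.span_neg fs.span_scale fs.span_sum)

lemma rspan_cong: "f - g \<in> RI \<Longrightarrow> g \<in> rspan B \<Longrightarrow> f \<in> rspan B"
  using rspan_add[of "f - g" B g] rspan_RI by fastforce

lemma rspan_induct [consumes 1, case_names rel base zero add scale]:
  assumes "f \<in> rspan B" "\<And>f. f \<in> RI \<Longrightarrow> P f" "\<And>f. f \<in> B \<Longrightarrow> P f" "P 0"
    "\<And>f g. P f \<Longrightarrow> P g \<Longrightarrow> P (f + g)" "\<And>c f. P f \<Longrightarrow> P (scalar c * f)"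
  shows "P f"
  using assms(1) unfolding rspan_def
  by (rule fs.span_induct) (use assms in \<open>auto simp: fs.subspace_def\<close>)

lemma rspan_subset: assumes "B \<subseteq> rspan C" shows "rspan B \<subseteq> rspan C"
proof
  fix f assume "f \<in> rspan B" then show "f \<in> rspan C"
    by (induction rule: rspan_induct) (use assms in \<open>auto intro: rspan_RI rspan_zero rspan_add rspan_scale\<close>)
qed

lemma rspan_mult:
  assumes "f \<in> rspan B" "a \<in> carrier FA" "b \<in> carrier FA" "\<And>x. x \<in> B \<Longrightarrow> a * x * b \<in> rspan C"
  shows "a * f * b \<in> rspan C"
  using assms(1)
proof (induction rule: rspan_induct)
  case (rel f)
  then show ?case using assms(2,3) by (intro rspan_RI) auto
next
  case (scale c f)
  have "a * (scalar c * f) * b = scalar c * (a * f * b)"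
    using scalar_commute[of c a] by (metis mult.assoc)
  then show ?case using scale by (simp add: rspan_scale)
qed (use assms in \<open>auto simp: distrib_left distrib_right intro: rspan_zero rspan_add\<close>)

lemma sign_mult: "(- 1) ^ k * f \<in> rspan B" if "f \<in> rspan B"
  using that by (cases "even k") (auto intro: rspan_uminus)

lemma two_mult: "2 * f \<in> rspan B" if "f \<in> rspan B"
  using rspan_add[OF that that] by (simp add: mult_2)

definition D :: "(int \<Rightarrow> int) \<Rightarrow> (int \<Rightarrow> int) \<Rightarrow> 'k free_elem" where
  "D g h = arr m n (shape g) (shape h)"

definition E :: "(int \<Rightarrow> int) \<Rightarrow> 'k free_elem" where
  "E h = idem (shape h)"

lemma F_D [simp, intro]: "D g h \<in> carrier FA" by (simp add: D_def)

lemma F_E [simp, intro]: "h \<in> LP \<Longrightarrow> E h \<in> carrier FA" by (simp add: E_def shape_Pmn)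

lemma up_step_iff_cut:
  "up_step g h \<longleftrightarrow> h \<in> LP \<and> (\<exists>a b. removable_at h a b \<and> g = cut h a b)"
proof
  assume "up_step g h"
  then obtain a b where "h \<in> LP" "addable_at g a b" "h = lift g a b" by (auto simp: up_step_def)
  then show "h \<in> LP \<and> (\<exists>a b. removable_at h a b \<and> g = cut h a b)"
    by (intro conjI exI[of _ a] exI[of _ b]) (simp_all add: removable_lift_iff)
next
  assume "h \<in> LP \<and> (\<exists>a b. removable_at h a b \<and> g = cut h a b)"
  then obtain a b where h: "h \<in> LP" "removable_at h a b" "g = cut h a b" by blast
  then have "addable_at g a b" using removable_lift_iff[of g a b] by simp
  moreover have "h = lift g a b" using h by simp
  moreover have "g \<in> LP" unfolding h(3) by (rule cut_LP[OF h(1,2)])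
  ultimately show "up_step g h" using h(1) unfolding up_step_def by blast
qed

lemma linked_shape:
  assumes "g \<in> LP" "h \<in> LP"
  shows "linked m n (shape g) (shape h) \<longleftrightarrow> up_step g h \<or> up_step h g"
proof -
  have *: "(\<exists>P \<in> DRem m n (shape h). shape g = dminus m n (shape h) P) \<longleftrightarrow> up_step g h"
    if gL: "g \<in> LP" and hL: "h \<in> LP" for g h
  proof
    assume "\<exists>P \<in> DRem m n (shape h). shape g = dminus m n (shape h) P"
    then obtain a b where ab: "removable_at h a b" "shape g = dminus m n (shape h) {a..b}"
      by (auto simp: DRem_shape[OF hL])
    have "shape g = shape (cut h a b)"
      unfolding ab(2) by (rule dminus_shape[OF hL ab(1)])
    then have "g = cut h a b" by (simp only: shape_eq_iff[OF gL cut_LP[OF hL ab(1)]])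
    then show "up_step g h" unfolding up_step_iff_cut using hL ab(1) by blast
  next
    assume "up_step g h"
    then obtain a b where ab: "removable_at h a b" "g = cut h a b" unfolding up_step_iff_cut by blast
    show "\<exists>P \<in> DRem m n (shape h). shape g = dminus m n (shape h) P"
      unfolding ab(2) dminus_shape[OF hL ab(1), symmetric]
      using ab(1) by (intro bexI[of _ "{a..b}"] refl) (auto simp: DRem_shape[OF hL])
  qed
  show ?thesis
    unfolding linked_def *[OF assms] *[OF assms(2,1)] using assms shape_Pmn by simp
qed

lemma linked_sym: "linked m n a b \<longleftrightarrow> linked m n b a"
  by (auto simp: linked_def)

lemma D_not_linked: "g \<in> LP \<Longrightarrow> h \<in> LP \<Longrightarrow> \<not> up_step g h \<Longrightarrow> \<not> up_step h g \<Longrightarrow> D g h = 0"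
  by (simp add: D_def arr_def linked_shape)

lemma dual_arr: "dual (arr m n a b) = arr m n b a"
  by (auto simp: arr_def dual_single dual_word_def linked_sym) (simp add: dual_def poly_mapping_eq_iff map_key.rep_eq inj_dual_word fun_eq_iff)

lemma dual_arr2: "dual (arr m n a b * arr m n c d) = arr m n d c * arr m n b a"
  by (auto simp: arr_def mult_single dual_single dual_word_def plus_free_monoid_def linked_sym)
    (simp_all add: dual_def poly_mapping_eq_iff map_key.rep_eq inj_dual_word fun_eq_iff)

lemma E_mult: "g \<in> LP \<Longrightarrow> h \<in> LP \<Longrightarrow> E g * E h - (if g = h then E h else 0) \<in> RI"
  using relations.idempotent[of "shape g" m n "shape h"]
  by (auto simp: E_def shape_Pmn shape_eq_iff intro!: RI_relation split: if_splits)

text \<open>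
  For arrows that remove a path this is among the given relations; for those that add a path it is the
  dual of one.
\<close>

lemma D_sandwich: assumes "g \<in> LP" "h \<in> LP" shows "E g * D g h * E h - D g h \<in> RI"
proof -
  have up: "E g * D g h * E h - D g h \<in> relations m n" if gh: "up_step g h" for g h
  proof -
    obtain a b where ab: "h \<in> LP" "removable_at h a b" "g = cut h a b" using gh unfolding up_step_iff_cut by blast
    show ?thesis unfolding E_def D_def
      by (rule relations.idempotent_arr[of _ _ _ "{a..b}"])
        (use ab dminus_shape DRem_shape shape_Pmn in auto)
  qed
  show ?thesis
  proof (cases "up_step g h \<or> up_step h g")
    case True
    then show ?thesis
    proof
      assume "up_step h g"
      from relations.dual[OF up[OF this]]
      have "dual (E h * D h g * E g - D h g) \<in> RI" by (rule RI_relation)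
      moreover have "dual (E h * D h g * E g) = E g * D g h * E h"
        using assms \<open>up_step h g\<close> linked_shape[OF assms] linked_shape[OF assms(2,1)]
        by (simp add: E_def D_def idem_def arr_def mult_single dual_single dual_word_def plus_free_monoid_def)
      ultimately show ?thesis by (simp add: dual_diff D_def dual_arr)
    qed (use up in \<open>blast intro: RI_relation\<close>)
  qed (simp add: D_not_linked[OF assms])
qed

lemma E_D: assumes "g \<in> LP" "h \<in> LP" shows "E g * D g h - D g h \<in> RI"
proof -
  have "E g * (E g * D g h * E h - D g h) \<in> RI" using D_sandwich[OF assms] assms by auto
  moreover have "(E g * E g - E g) * (D g h * E h) \<in> RI" using E_mult[OF assms(1,1)] assms by auto
  ultimately have "(E g * E g - E g) * (D g h * E h) - E g * (E g * D g h * E h - D g h) +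
      (E g * D g h * E h - D g h) \<in> RI"
    using D_sandwich[OF assms] by blast
  then show ?thesis by (simp add: algebra_simps)
qed

lemma D_E: assumes "g \<in> LP" "h \<in> LP" shows "D g h * E h - D g h \<in> RI"
proof -
  have "(E g * D g h * E h - D g h) * E h \<in> RI" using D_sandwich[OF assms] assms by auto
  moreover have "(E g * D g h) * (E h * E h - E h) \<in> RI" using E_mult[OF assms(2,2)] assms by auto
  ultimately have "(E g * D g h) * (E h * E h - E h) - (E g * D g h * E h - D g h) * E h +
      (E g * D g h * E h - D g h) \<in> RI"
    using D_sandwich[OF assms] by blast
  then show ?thesis by (simp add: algebra_simps)
qed

lemma commuting_shape:
  assumes "h \<in> LP" "commuting_at h a b c d"
  shows "commuting m n (shape h) {a..b} {c..d}"
  using assms cut_LP unfolding commuting_def commuting_at_def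
  by (metis DRem_shape dminus_shape)

lemma commuting_up:
  assumes h: "h \<in> LP" and c: "commuting_at h a b c d"
  shows "D (cut (cut h a b) c d) (cut h a b) * D (cut h a b) h -
     D (cut (cut h a b) c d) (cut h c d) * D (cut h c d) h \<in> RI"
  unfolding D_def using c
  by (intro RI_relation relations.commuting_down[of _ _ _ "{a..b}" "{c..d}"] commuting_shape)
    (auto simp: h shape_Pmn dminus_shape commuting_at_def cut_LP)

lemma commuting_mixed:
  assumes h: "h \<in> LP" and c: "commuting_at h a b c d"
  shows "D (cut h a b) h * D h (cut h c d) -
     D (cut h a b) (cut (cut h a b) c d) * D (cut (cut h a b) c d) (cut h c d) \<in> RI"
  unfolding D_def using c
  by (intro RI_relation relations.commuting_mixed[of _ _ _ "{a..b}" "{c..d}"] commuting_shape)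
    (auto simp: h shape_Pmn dminus_shape commuting_at_def cut_LP)

lemma prec_interval: "c \<le> d \<Longrightarrow> a \<le> b \<Longrightarrow> {c..d} \<prec> {a..b} \<longleftrightarrow> a < c \<and> d < (b::int)"
proof -
  have "Min {x..y} = x" "Max {x..y} = y" if "x \<le> y" for x y :: int
    using that by (auto intro: Min_eqI Max_eqI)
  then show "c \<le> d \<Longrightarrow> a \<le> b \<Longrightarrow> {c..d} \<prec> {a..b} \<longleftrightarrow> a < c \<and> d < b" by (simp add: prec_def)
qed

lemma splitting_relation:
  assumes h: "h \<in> LP" and s: "splitting_at h a b c d"
    and r: "r = cut (cut h c d) a (c - 1) \<or> r = cut (cut h c d) (d + 1) b"
  shows "D (cut h a b) h * D h (cut h c d) - D (cut h a b) r * D r (cut h c d) \<in> relations m n"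
proof -
  have ab: "removable_at h a b" and cd: "removable_at h c d" and n: "a < c" "d < b" "h c = h a + 1"
    using s by (auto simp: splitting_at_def)
  note S = removable_cut_split[OF ab cd n]
  have le: "c \<le> d" "a \<le> b" using removable_atD(1) ab cd by auto
  have g: "cut h c d \<in> LP" by (rule cut_LP[OF h cd])
  have nc: "\<not> commuting m n (shape h) {c..d} {a..b}"
  proof
    assume "commuting m n (shape h) {c..d} {a..b}"
    then have "{a..b} \<in> DRem m n (shape (cut h c d))"
      using dminus_shape[OF h cd] by (simp add: commuting_def)
    then obtain a' b' where "{a..b} = {a'..b'}" "removable_at (cut h c d) a' b'"
      using DRem_shape[OF g] by blast
    then show False using S(3) le by (auto simp: Icc_eq_Icc)
  qed
  let ?Q1 = "{a..c - 1}" and ?Q2 = "{d + 1..b}"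
  have R: "\<exists>R \<in> {?Q1, ?Q2}. shape r = dminus m n (shape (cut h c d)) R"
    using r
  proof
    assume "r = cut (cut h c d) a (c - 1)"
    then show ?thesis using dminus_shape[OF g S(1)] by simp
  next
    assume "r = cut (cut h c d) (d + 1) b"
    then show ?thesis using dminus_shape[OF g S(2)] by simp
  qed
  then obtain R where R: "R \<in> {?Q1, ?Q2}" "shape r = dminus m n (shape (cut h c d)) R"
    by blast
  have mem: "{c..d} \<in> DRem m n (shape h)" "{a..b} \<in> DRem m n (shape h)"
    "?Q1 \<in> DRem m n (shape (cut h c d))" "?Q2 \<in> DRem m n (shape (cut h c d))"
    unfolding DRem_shape[OF h] DRem_shape[OF g] using ab cd S by blast+
  have sets: "{a..b} - {c..d} = ?Q1 \<union> ?Q2" "?Q1 \<inter> ?Q2 = {}" using n(1,2) le by auto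
  have pr: "{c..d} \<prec> {a..b}" using prec_interval[OF le] n by simp
  show ?thesis unfolding D_def R(2)
    by (rule relations.non_commuting[OF shape_Pmn[OF h] mem(1,2) pr nc
          dminus_shape[OF h cd, symmetric] dminus_shape[OF h ab, symmetric]
          mem(3,4) sets R(1)])
qed

text \<open>
  The dual of the previous relation reverses the two words; it is needed when the outer arc is the
  second one.
\<close>

lemma splitting_dual_relation:
  assumes h: "h \<in> LP" and s: "splitting_at h a b c d"
    and r: "r = cut (cut h c d) a (c - 1) \<or> r = cut (cut h c d) (d + 1) b"
  shows "D (cut h c d) h * D h (cut h a b) - D (cut h c d) r * D r (cut h a b) \<in> relations m n"
  using relations.dual[OF splitting_relation[OF assms]] by (simp add: dual_diff D_def dual_arr2)

text \<open>
  Removing a path decreases the area. This makes straightening terminate and bounds the length of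
  upward paths.
\<close>

definition area :: "(int \<Rightarrow> int) \<Rightarrow> nat" where
  "area h = nat (\<Sum>x\<in>{- int m..int n}. h x)"

lemma area_less:
  assumes "g \<in> LP" "h \<in> LP" "\<And>x. g x \<le> h x" "g \<noteq> h"
  shows "area g < area h"
proof -
  obtain x where x: "g x \<noteq> h x" using assms(4) by blast
  have "x \<in> {- int m..int n}"
    using x lp_left[OF assms(1), of x] lp_left[OF assms(2), of x] lp_right[OF assms(1), of x]
      lp_right[OF assms(2), of x] by force
  then have "(\<Sum>x\<in>{- int m..int n}. g x) < (\<Sum>x\<in>{- int m..int n}. h x)"
    using assms(3) x by (intro sum_strict_mono_ex1) (auto simp: order_less_le)
  moreover have "0 \<le> (\<Sum>x\<in>{- int m..int n}. g x)"
    using lp_lower[OF assms(1)] by (intro sum_nonneg) (smt (verit))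
  ultimately show ?thesis unfolding area_def by simp
qed

lemma cut_le: "cut h a b x \<le> h x" by (simp add: cut_def)

lemma cut_neq: "a \<le> b \<Longrightarrow> cut h a b \<noteq> h" by (auto simp: cut_def fun_eq_iff)

lemma area_cut: "h \<in> LP \<Longrightarrow> removable_at h a b \<Longrightarrow> area (cut h a b) < area h"
  using area_less[OF cut_LP _ cut_le cut_neq] removable_atD(1) by blast

lemma up_step_area: "up_step g h \<Longrightarrow> area g < area h"
  by (auto simp: up_step_iff_cut intro: area_cut)

lemma area_bound: "h \<in> LP \<Longrightarrow> area h \<le> nat (\<Sum>x\<in>{- int m..int n}. int m + 1 + \<bar>x + int m\<bar>)"
proof -
  assume h: "h \<in> LP"
  have *: "h x \<le> int m + 1 + \<bar>x + int m\<bar>" for x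
    using lp_lipschitz[OF h, of x "- int m"] lp_left[OF h, of "- int m"] by auto
  show ?thesis unfolding area_def by (intro nat_mono sum_mono *)
qed

text \<open>
  Two removable arcs of the middle partition coincide, commute, or are nested without room in one of two
  orders. Correspondingly the self-dual relation, the mixed commutation relation, the non-commuting
  relation or its dual replaces the peak by two-step paths through strictly smaller partitions.
\<close>

lemma peak_rewrite:
  assumes "up_step g h" "up_step g' h"
  shows "D g h * D h g' \<in> rspan {D g r * D r g' | r. r \<in> LP \<and> area r < area h}" (is "_ \<in> rspan ?B")
proof -
  obtain a b where h: "h \<in> LP" and ab: "removable_at h a b" and g: "g = cut h a b"
    using assms(1) unfolding up_step_iff_cut by blast
  obtain c d where cd: "removable_at h c d" and g': "g' = cut h c d"
    using assms(2) unfolding up_step_iff_cut by blast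
  have gL: "g \<in> LP" and gL': "g' \<in> LP" using cut_LP[OF h] ab cd g g' by auto
  have base: "D g r * D r g' \<in> rspan ?B" if "r \<in> LP" "area r < area h" for r
    using that by (blast intro: rspan_base)
  have via: "D g h * D h g' \<in> rspan ?B" if "D g h * D h g' - D g r * D r g' \<in> RI" "r \<in> LP" "area r < area h" for r
    using rspan_cong[OF that(1) base[OF that(2,3)]] .
  from ab cd show ?thesis
  proof (cases rule: removable_pair_cases)
    case 1
    then have gg: "g' = g" using g g' by simp
    let ?C = "{D g r * D r g | r. r \<in> LP \<and> area r < area h}"
    have summand: "(- 1) ^ breadth Q * arr m n (shape g) (dminus m n (shape g) Q) *
        arr m n (dminus m n (shape g) Q) (shape g) \<in> rspan ?C"
      if Q: "Q \<in> DRem m n (shape g)" for Q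
    proof -
      obtain x y where xy: "Q = {x..y}" "removable_at g x y" using Q unfolding DRem_shape[OF gL] by blast
      have "area (cut g x y) < area h" "cut g x y \<in> LP"
        using area_cut[OF gL xy(2)] area_cut[OF h ab, folded g] cut_LP[OF gL xy(2)] by auto
      then have "D g (cut g x y) * D (cut g x y) g \<in> rspan ?C" by (blast intro: rspan_base)
      from sign_mult[OF this] show ?thesis
        unfolding xy(1) dminus_shape[OF gL xy(2)] D_def mult.assoc .
    qed
    have P: "{a..b} \<in> DRem m n (shape h)" "shape g = dminus m n (shape h) {a..b}"
      unfolding DRem_shape[OF h] g dminus_shape[OF h ab] using ab by blast+
    note rel = RI_relation[OF relations.self_dual[OF shape_Pmn[OF h] P], folded D_def]
    show ?thesis
      unfolding gg
      by (rule rspan_cong[OF rel])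
        (intro sign_mult rspan_add two_mult rspan_sum; use summand in \<open>simp add: D_def\<close>)
  next
    case 2
    then have "removable_at g c d" using g by (simp add: commuting_at_def)
    then have "area (cut g c d) < area h" "cut g c d \<in> LP"
      using area_cut[OF gL, of c d] area_cut[OF h ab] cut_LP[OF gL, of c d] g by auto
    then show ?thesis using via commuting_mixed[OF h 2] g g' by auto
  next
    case 3
    then have n: "a < c" "d < b" "h c = h a + 1" by (auto simp: splitting_at_def)
    let ?r = "cut (cut h c d) a (c - 1)"
    have "removable_at g' a (c - 1)" using removable_cut_split(1)[OF ab cd n] g' by simp
    then have "area ?r < area h" "?r \<in> LP"
      using area_cut[OF gL', of a "c - 1"] area_cut[OF h cd] cut_LP[OF gL', of a "c - 1"] g' by auto
    then show ?thesis using via RI_relation[OF splitting_relation[OF h 3, of ?r]] g g' by auto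
  next
    case 4
    then have n: "c < a" "b < d" "h a = h c + 1" by (auto simp: splitting_at_def)
    let ?r = "cut (cut h a b) c (a - 1)"
    have "removable_at g c (a - 1)" using removable_cut_split(1)[OF cd ab n] g by simp
    then have "area ?r < area h" "?r \<in> LP"
      using area_cut[OF gL, of c "a - 1"] area_cut[OF h ab] cut_LP[OF gL, of c "a - 1"] g by auto
    then show ?thesis using via RI_relation[OF splitting_dual_relation[OF h 4, of ?r]] g g' by auto
  qed
qed

end

section \<open>Straightening and exchange of paths\<close>

lemma not_successively_split:
  assumes "\<not> successively P hs"
  obtains xs u d ys where "hs = xs @ u # d # ys" "\<not> P u d" "successively P (xs @ [u])"
  using assms
proof (induction hs arbitrary: thesis)
  case (Cons h hs)
  show ?case
  proof (cases "\<exists>d ys. hs = d # ys \<and> \<not> P h d")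
    case True
    then show ?thesis using Cons.prems(1)[of "[]" h] by auto
  next
    case False
    then have "\<not> successively P hs" using Cons.prems(2) by (auto simp: successively_Cons neq_Nil_conv)
    then obtain xs u d ys where *: "hs = xs @ u # d # ys" "\<not> P u d" "successively P (xs @ [u])"
      using Cons.IH by metis
    have "successively P ((h # xs) @ [u])"
      using *(1,3) False by (cases xs) (auto simp: successively_Cons)
    then show ?thesis using Cons.prems(1)[of "h # xs" u d ys] * by simp
  qed
qed simp

lemma geometric_sum_noncommutative:
  fixes q :: "'a::ring_1"
  shows "(1 - q) * (\<Sum>j<N. q ^ j) = 1 - q ^ N"
proof (induction N)
  case (Suc N)
  have "(1 - q) * (\<Sum>j<Suc N. q ^ j) = (1 - q) * (\<Sum>j<N. q ^ j) + (1 - q) * q ^ N"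
    by (simp add: distrib_left)
  then show ?case unfolding Suc by (simp add: left_diff_distrib)
qed simp

context arc_presentation begin

fun arrows :: "(int \<Rightarrow> int) list \<Rightarrow> 'k free_elem" where
  "arrows (g # h # hs) = D g h * arrows (h # hs)"
| "arrows _ = 1"

definition path :: "(int \<Rightarrow> int) list \<Rightarrow> 'k free_elem" where
  "path hs = E (hd hs) * arrows hs"

text \<open>
  Spanning elements, modulo the relations, for what is divided out in the standard module of \<open>h\<close>.
\<close>

definition low :: "(int \<Rightarrow> int) \<Rightarrow> 'k free_elem set" where
  "low h = {E h * x * E g * y | x g y. x \<in> carrier FA \<and> y \<in> carrier FA \<and>
     g \<in> LP \<and> (\<forall>z. g z \<le> h z) \<and> g \<noteq> h}"

lemma F_arrows [simp, intro]: "arrows hs \<in> carrier FA"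
  by (induction hs rule: arrows.induct) auto

lemma F_path [intro]: "hs \<noteq> [] \<Longrightarrow> set hs \<subseteq> LP \<Longrightarrow> path hs \<in> carrier FA"
  unfolding path_def by (cases hs) auto

lemma arrows_append: "arrows (xs @ h # ys) = arrows (xs @ [h]) * arrows (h # ys)"
proof (induction xs)
  case (Cons x xs)
  then show ?case by (cases xs) (simp_all add: mult.assoc)
qed simp

lemma path_Cons: "g \<in> LP \<Longrightarrow> h \<in> LP \<Longrightarrow> path (g # h # hs) - D g h * path (h # hs) \<in> RI"
proof -
  assume gh: "g \<in> LP" "h \<in> LP"
  have "(E g * D g h - D g h) * arrows (h # hs) - (D g h * E h - D g h) * arrows (h # hs) \<in> RI"
    by (rule RI_diff[OF RI_right[OF E_D[OF gh] F_arrows] RI_right[OF D_E[OF gh] F_arrows]])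
  then show ?thesis by (simp add: path_def algebra_simps)
qed

lemma E_path: assumes "h \<in> LP" "hs \<noteq> []" "set hs \<subseteq> LP"
  shows "E h * path hs - (if h = hd hs then path hs else 0) \<in> RI"
proof -
  have "hd hs \<in> LP" using assms by (cases hs) auto
  then have "(E h * E (hd hs) - (if h = hd hs then E (hd hs) else 0)) * arrows hs \<in> RI"
    by (intro RI_right E_mult assms(1) F_arrows)
  then show ?thesis by (simp add: path_def algebra_simps split: if_splits)
qed

lemma path_E: assumes "h \<in> LP" "hs \<noteq> []" "set hs \<subseteq> LP"
  shows "path hs * E h - (if h = last hs then path hs else 0) \<in> RI"
  using assms(2,3)
proof (induction hs rule: arrows.induct)
  case (1 g u hs)
  then have LP: "g \<in> LP" "u \<in> LP" and IH: "path (u # hs) * E h - (if h = last (u # hs) then path (u # hs) else 0) \<in> RI"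
    by auto
  have P: "path (g # u # hs) - D g u * path (u # hs) \<in> RI" by (rule path_Cons[OF LP])
  have "(path (g # u # hs) - D g u * path (u # hs)) * E h
      + D g u * (path (u # hs) * E h - (if h = last (u # hs) then path (u # hs) else 0))
      - (if h = last (u # hs) then path (g # u # hs) - D g u * path (u # hs) else 0) \<in> RI"
    by (rule RI_diff[OF RI_add[OF RI_right[OF P F_E[OF assms(1)]] RI_left[OF F_D IH]]]) (simp add: P)
  then show ?case by (simp add: algebra_simps split: if_splits)
next
  case ("2_2" v)
  then show ?case using E_mult[of v h] assms(1) by (simp add: path_def split: if_splits)
qed simp

lemma path_mult:
  assumes "hs \<noteq> []" "set hs \<subseteq> LP" "us \<noteq> []" "set us \<subseteq> LP" "last hs = hd us"
  shows "path hs * path us - path (hs @ tl us) \<in> RI"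
proof -
  obtain xs where xs: "hs = xs @ [hd us]" using assms(1,5) by (metis append_butlast_last_id)
  have "hd us \<in> LP" using assms(3,4) by (cases us) auto
  then have "(path hs * E (hd us) - path hs) * arrows us \<in> RI"
    using path_E[of "hd us" hs] assms by (intro RI_right F_arrows) simp
  moreover have "path (hs @ tl us) = path hs * arrows us"
    using arrows_append[of xs "hd us" "tl us"] assms(1,3) xs by (cases xs) (simp_all add: path_def mult.assoc)
  ultimately show ?thesis by (simp add: path_def algebra_simps)
qed

definition connections :: "(int \<Rightarrow> int) \<Rightarrow> (int \<Rightarrow> int) \<Rightarrow> 'k free_elem set" where
  "connections g h = {path hs | hs. hs \<noteq> [] \<and> set hs \<subseteq> LP \<and> hd hs = g \<and> last hs = h}"

definition loops :: "(int \<Rightarrow> int) \<Rightarrow> 'k free_elem set" where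
  "loops g = {path hs | hs. hs \<noteq> [] \<and> set hs \<subseteq> LP \<and> hd hs = g \<and> last hs = g \<and> 2 \<le> length hs}"

definition up_paths :: "(int \<Rightarrow> int) \<Rightarrow> (int \<Rightarrow> int) \<Rightarrow> nat \<Rightarrow> (int \<Rightarrow> int) list set" where
  "up_paths g h l = {us. us \<noteq> [] \<and> set us \<subseteq> LP \<and> successively up_step us \<and> hd us = g \<and> last us = h \<and> length us = l}"

text \<open>
  The standard module is spanned by paths that only add tiles. Consider the first step of a path that
  does not: if it is the very first step, the path factors through a smaller partition; otherwise it
  completes a peak, and rewriting the peak lowers the total area of the partitions on the path.
\<close>

lemma straighten:
  assumes "hs \<noteq> []" "set hs \<subseteq> LP"
  shows "path hs \<in> rspan (path ` up_paths (hd hs) (last hs) (length hs) \<union> low (hd hs))"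
  using assms
proof (induction "sum_list (map area hs)" arbitrary: hs rule: less_induct)
  case less
  let ?B = "\<lambda>hs. path ` up_paths (hd hs) (last hs) (length hs) \<union> low (hd hs)"
  show ?case
  proof (cases "successively up_step hs")
    case True
    then have "hs \<in> up_paths (hd hs) (last hs) (length hs)" using less.prems by (simp add: up_paths_def)
    then show ?thesis by (blast intro: rspan_base)
  next
    case False
    then obtain xs u d ys where hs: "hs = xs @ u # d # ys" and nup: "\<not> up_step u d"
      and up: "successively up_step (xs @ [u])" by (rule not_successively_split)
    have LP: "u \<in> LP" "d \<in> LP" "set xs \<subseteq> LP" "set ys \<subseteq> LP" using less.prems hs by auto
    have hdE: "E (hd hs) \<in> carrier FA" using less.prems by (cases hs) auto
    show ?thesis
    proof (cases "up_step d u")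
      case False
      then have "D u d = 0" using D_not_linked[OF LP(1,2)] nup by simp
      then have "path hs = 0" using arrows_append[of xs u "d # ys"] by (simp add: path_def hs)
      then show ?thesis by (simp add: rspan_zero)
    next
      case True
      show ?thesis
      proof (cases xs rule: rev_cases)
        case Nil
        have "E u * (D u d * E d - D u d) * arrows (d # ys) \<in> RI"
          by (rule RI_right[OF RI_left[OF F_E[OF LP(1)] D_E[OF LP(1,2)]] F_arrows])
        then have "path hs - E u * D u d * E d * arrows (d # ys) \<in> RI"
          using RI_sym Nil by (fastforce simp: path_def hs algebra_simps)
        moreover obtain a b where ab: "removable_at u a b" "d = cut u a b"
          using True unfolding up_step_iff_cut by blast
        have "(\<forall>z. d z \<le> u z) \<and> d \<noteq> u"
          unfolding ab(2) using cut_le cut_neq[OF removable_atD(1)[OF ab(1)]] by blast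
        then have "E u * D u d * E d * arrows (d # ys) \<in> low u"
          unfolding low_def using LP by blast
        ultimately show ?thesis using Nil by (intro rspan_cong[OF _ rspan_base]) (auto simp: hs)
      next
        case (snoc xs' l)
        then have "up_step l u" using up by (simp add: successively_append_iff)
        have l: "l \<in> LP" "set xs' \<subseteq> LP" using LP(3) snoc by auto
        have eq: "path (xs' @ l # r # d # ys) = (E (hd hs) * arrows (xs' @ [l])) * (D l r * D r d) * arrows (d # ys)" for r
          using arrows_append[of xs' l "r # d # ys"] snoc by (cases xs') (simp_all add: path_def hs mult.assoc)
        have "(E (hd hs) * arrows (xs' @ [l])) * (D l u * D u d) * arrows (d # ys) \<in> rspan (?B hs)"
        proof (rule rspan_mult[OF peak_rewrite[OF \<open>up_step l u\<close> True]])
          fix x assume "x \<in> {D l r * D r d |r. r \<in> LP \<and> area r < area u}"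
          then obtain r where r: "x = D l r * D r d" "r \<in> LP" "area r < area u" by blast
          let ?hs = "xs' @ l # r # d # ys"
          have "path ?hs \<in> rspan (?B ?hs)"
            using less.hyps[of ?hs] r LP l by (auto simp: hs snoc)
          moreover have "hd ?hs = hd hs" "last ?hs = last hs" "length ?hs = length hs"
            by (cases xs'; simp add: hs snoc)+
          ultimately have "path ?hs \<in> rspan (?B hs)" by simp
          then show "(E (hd hs) * arrows (xs' @ [l])) * x * arrows (d # ys) \<in> rspan (?B hs)"
            unfolding eq r(1) .
        qed (use hdE in auto)
        then show ?thesis using eq[of u] by (simp add: hs snoc)
      qed
    qed
  qed
qed

definition max_area :: nat where
  "max_area = nat (\<Sum>x\<in>{- int m..int n}. int m + 1 + \<bar>x + int m\<bar>)"

lemma up_path_length: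
  assumes "us \<in> up_paths g h l" shows "l \<le> max_area + 1"
proof -
  have "length us \<le> area (last us) + 1" if "us \<noteq> []" "successively up_step us" for us
    using that
  proof (induction us rule: rev_induct)
    case (snoc u us)
    then show ?case
      by (cases us rule: rev_cases) (auto simp: successively_append_iff dest: up_step_area)
  qed simp
  moreover obtain us where us: "us \<noteq> []" "successively up_step us" "set us \<subseteq> LP" "length us = l"
    using assms by (auto simp: up_paths_def)
  moreover have "area (last us) \<le> max_area"
    unfolding max_area_def using us(1,3) by (intro area_bound) auto
  ultimately show ?thesis by fastforce
qed

lemma long_path_low:
  assumes "hs \<noteq> []" "set hs \<subseteq> LP" "max_area + 1 < length hs"
  shows "path hs \<in> rspan (low (hd hs))"
proof -
  have "up_paths (hd hs) (last hs) (length hs) = {}" using up_path_length assms(3) by fastforce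
  then show ?thesis using straighten[OF assms(1,2)] by simp
qed

text \<open>
  Words in the generators are paths up to idempotents: those that do not fit vanish, and the unit is the
  sum of all paths of length zero.
\<close>

lemma E_sandwich_paths:
  assumes f: "f \<in> carrier FA" and ab: "\<alpha> \<in> LP" "\<beta> \<in> LP"
  shows "E \<alpha> * f * E \<beta> \<in> rspan (connections \<alpha> \<beta>)"
proof -
  let ?P = "{path hs | hs. hs \<noteq> [] \<and> set hs \<subseteq> LP}"
  have word: "Poly_Mapping.single (Word ls) 1 \<in> rspan ?P" if "set ls \<subseteq> generators m n" for ls
    using that
  proof (induction ls)
    case Nil
    have "(\<Sum>\<mu>\<in>Pmn m n. idem \<mu>) - 1 \<in> RI" by (rule RI_relation[OF relations.unit])
    moreover have "(\<Sum>\<mu>\<in>Pmn m n. idem \<mu>) \<in> rspan ?P"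
    proof (rule rspan_sum)
      fix \<mu> assume "\<mu> \<in> Pmn m n"
      then obtain h where "h \<in> LP" "\<mu> = shape h" by (rule Pmn_obtain)
      then have "idem \<mu> = path [h]" by (simp add: path_def E_def)
      then show "idem \<mu> \<in> rspan ?P" using \<open>h \<in> LP\<close> by (intro rspan_base CollectI exI[of _ "[h]"]) simp
    qed
    ultimately have "1 \<in> rspan ?P" using rspan_cong RI_sym by blast
    then show ?case by (simp flip: zero_free_monoid_def)
  next
    case (Cons g ls)
    have IH: "Poly_Mapping.single (Word ls) 1 \<in> rspan ?P" and g: "g \<in> generators m n" using Cons by auto
    let ?g = "Poly_Mapping.single (Word [g]) (1::'k)"
    have gF: "?g \<in> carrier FA" using g by (simp add: free_algebra_def)
    have "?g * Poly_Mapping.single (Word ls) 1 * 1 \<in> rspan ?P"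
    proof (rule rspan_mult[OF IH gF F_one])
      fix x assume "x \<in> ?P"
      then obtain hs where hs: "x = path hs" "hs \<noteq> []" "set hs \<subseteq> LP" by blast
      then have xP: "x \<in> ?P" by blast
      have hdLP: "hd hs \<in> LP" using hs by (cases hs) auto
      show "?g * x * 1 \<in> rspan ?P"
      proof (cases g)
        case (IdemGen \<mu>)
        then have "\<mu> \<in> Pmn m n" using g by (auto simp: generators_def linked_def)
        then obtain h where h: "h \<in> LP" "\<mu> = shape h" by (rule Pmn_obtain)
        then have "?g = E h" by (simp add: E_def idem_def IdemGen)
        have "?g * x * 1 - (if h = hd hs then x else 0) \<in> RI"
          unfolding \<open>?g = E h\<close> hs(1) mult_1_right by (rule E_path[OF h(1) hs(2,3)])
        then show ?thesis by (rule rspan_cong) (use xP in \<open>auto intro: rspan_base rspan_zero\<close>)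
      next
        case (ArrGen \<kappa> \<mu>)
        then have lk: "linked m n \<kappa> \<mu>" using g by (auto simp: generators_def)
        then have "\<kappa> \<in> Pmn m n" "\<mu> \<in> Pmn m n" by (auto simp: linked_def)
        obtain k where k: "k \<in> LP" "\<kappa> = shape k" by (rule Pmn_obtain[OF \<open>\<kappa> \<in> Pmn m n\<close>])
        obtain h where h: "h \<in> LP" "\<mu> = shape h" by (rule Pmn_obtain[OF \<open>\<mu> \<in> Pmn m n\<close>])
        have gD: "?g = D k h" using lk by (simp add: D_def arr_def ArrGen k h)
        show ?thesis
        proof (cases "h = hd hs")
          case True
          then have hs': "hs = h # tl hs" using hs(2) by simp
          have "path (k # hs) - ?g * x * 1 \<in> RI"
            using path_Cons[OF k(1) h(1), of "tl hs"] hs' hs(1) gD by simp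
          moreover have "path (k # hs) \<in> rspan ?P" using hs k by (intro rspan_base CollectI exI[of _ "k # hs"]) auto
          ultimately show ?thesis using rspan_cong RI_sym by blast
        next
          case False
          have "D k h * (E h * path hs - 0) - (D k h * E h - D k h) * path hs \<in> RI"
            using E_path[OF h(1) hs(2,3)] False
            by (intro RI_diff[OF RI_left RI_right] D_E[OF k(1) h(1)] F_path[OF hs(2,3)] F_D) simp
          then have "?g * x * 1 \<in> RI" using gD hs(1) by (simp add: algebra_simps)
          then show ?thesis by (rule rspan_RI)
        qed
      qed
    qed
    then show ?case by (simp add: mult_single plus_free_monoid_def)
  qed
  have "f \<in> rspan ?P"
  proof (subst poly_mapping_sum_singles[of f], rule rspan_sum)
    fix w assume "w \<in> Poly_Mapping.keys f"
    then have "set (letters w) \<subseteq> generators m n" using f by (auto simp: free_algebra_def)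
    from word[OF this] have "Poly_Mapping.single w 1 \<in> rspan ?P" by simp
    from rspan_scale[OF this, of "Poly_Mapping.lookup f w"]
    show "Poly_Mapping.single w (Poly_Mapping.lookup f w) \<in> rspan ?P" by (simp add: mult_single)
  qed
  then show ?thesis
  proof (rule rspan_mult)
    fix x assume "x \<in> ?P"
    then obtain hs where hs: "x = path hs" "hs \<noteq> []" "set hs \<subseteq> LP" by blast
    let ?z = "if \<alpha> = hd hs \<and> \<beta> = last hs then path hs else 0"
    have "(E \<alpha> * path hs - (if \<alpha> = hd hs then path hs else 0)) * E \<beta> +
        (if \<alpha> = hd hs then path hs * E \<beta> - (if \<beta> = last hs then path hs else 0) else 0) \<in> RI"
      using path_E[OF ab(2) hs(2,3)]
      by (intro RI_add[OF RI_right[OF E_path[OF ab(1) hs(2,3)] F_E[OF ab(2)]]]) (simp only: RI_zero if_True if_False split: if_split, simp)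
    then have "E \<alpha> * x * E \<beta> - ?z \<in> RI" using hs(1) by (auto simp: algebra_simps split: if_splits)
    then show "E \<alpha> * x * E \<beta> \<in> rspan (connections \<alpha> \<beta>)"
      by (rule rspan_cong) (use hs in \<open>auto simp: connections_def intro: rspan_zero rspan_base\<close>)
  qed (use ab in auto)
qed

lemma exchange_relation:
  assumes g: "g \<in> LP" and l: "lowest_arc g a b" and M: "g a \<le> int m" and mn: "m \<le> n"
    and adm: "admissible g g'" and l': "lowest_arc g' a' b'" and M': "g' a' = g a"
  shows "D g g' * D g' (lift g' a' b') - D g (lift g a b) * D (lift g a b) (lift g' a' b') \<in> RI"
proof -
  let ?G = "lift g a b" and ?G' = "lift g' a' b'"
  have g': "g' \<in> LP" using adm by (auto simp: admissible_def up_step_def inner_down_step_def)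
  have G: "?G \<in> LP" by (rule lowest_arc_addable(2)[OF g l M mn])
  have M'': "g' a' \<le> int m" using M M' by simp
  have G': "?G' \<in> LP" by (rule lowest_arc_addable(2)[OF g' l' M'' mn])
  from admissible_exchange(2)[OF assms] show ?thesis
  proof (elim disjE exE conjE)
    fix c d assume *: "commuting_at ?G' a b c d" "cut ?G' a b = g'" "cut ?G' c d = ?G" "cut g' c d = g"
    show ?thesis using commuting_up[OF G' *(1)] unfolding *(2-4) .
  next
    fix c d assume *: "commuting_at ?G a b c d" "g' = cut g c d" "?G' = cut ?G c d"
    show ?thesis using RI_sym[OF commuting_mixed[OF G *(1)]] unfolding cut_lift *(2,3)[symmetric] .
  next
    fix c d assume *: "splitting_at ?G a b c d" "?G' = cut ?G c d" "g' = cut (cut ?G c d) a (c - 1)"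
    show ?thesis
      using RI_sym[OF RI_relation[OF splitting_relation[OF G *(1) disjI1[OF *(3)]]]]
      unfolding cut_lift *(2)[symmetric] .
  next
    fix c d assume *: "splitting_at ?G a b c d" "?G' = cut ?G c d" "g' = cut (cut ?G c d) (d + 1) b"
    show ?thesis
      using RI_sym[OF RI_relation[OF splitting_relation[OF G *(1) disjI2[OF *(3)]]]]
      unfolding cut_lift *(2)[symmetric] .
  qed
qed

lemma admissible_LP: "admissible g g' \<Longrightarrow> g \<in> LP \<and> g' \<in> LP"
  by (auto simp: admissible_def up_step_def inner_down_step_def)

text \<open>
  A path that finally leaves the minimal level of its start must at some point lift a whole lowest arc,
  since nothing smaller raises the minimum. This lift is exchanged with the preceding steps, one after
  the other, until it is the first step.
\<close>

lemma exchange_path: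
  assumes "m \<le> n" "g \<in> LP" "lowest_arc g a b" "g a \<le> int m" "successively admissible (g # gs)"
    "\<And>x. g a < last (g # gs) x"
  shows "\<exists>ws. ws \<noteq> [] \<and> hd ws = lift g a b \<and> last ws = last (g # gs) \<and> set ws \<subseteq> LP \<and>
    successively admissible ws \<and> arrows (g # gs) - D g (lift g a b) * arrows ws \<in> RI"
  using assms(2-)
proof (induction gs arbitrary: g a b)
  case (Cons g' gs)
  have adm: "admissible g g'" and rest: "successively admissible (g' # gs)"
    using Cons.prems(4) by auto
  have g': "g' \<in> LP" using admissible_LP[OF adm] by simp
  obtain a' b' where l': "lowest_arc g' a' b'" by (rule lowest_arc_exists[OF g'])
  have mono: "g a \<le> g' x" for x by (rule admissible_lowest_mono[OF Cons.prems(2) adm])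
  show ?case
  proof (cases "g' a' = g a")
    case False
    then have "g a < g' x" for x using mono[of a'] lowest_arcD(2)[OF l', of x] by simp
    then have eq: "g' = lift g a b" by (rule admissible_raises_lowest[OF Cons.prems(1,2) adm])
    have "set (g' # gs) \<subseteq> LP"
    proof -
      have "set ws \<subseteq> LP" if "successively admissible ws" "ws \<noteq> []" "hd ws \<in> LP" for ws
        using that
      proof (induction ws)
        case (Cons w ws)
        then show ?case by (cases ws) (auto dest: admissible_LP)
      qed simp
      then show ?thesis using rest g' by (metis list.discI list.sel(1))
    qed
    then show ?thesis using rest eq by (intro exI[of _ "g' # gs"]) simp
  next
    case True
    have last: "g' a' < last (g' # gs) x" for x using Cons.prems(5) True by simp
    have "g' a' \<le> int m" using True Cons.prems(3) by simp
    from Cons.IH[OF g' l' this rest last] obtain ws where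
      ws: "ws \<noteq> []" "hd ws = lift g' a' b'" "last ws = last (g' # gs)" "set ws \<subseteq> LP" "successively admissible ws"
      and eq: "arrows (g' # gs) - D g' (lift g' a' b') * arrows ws \<in> RI" by blast
    let ?G = "lift g a b"
    have G: "?G \<in> LP" by (rule lowest_arc_addable(2)[OF Cons.prems(1-3) assms(1)])
    have admG: "admissible ?G (hd ws)"
      unfolding ws(2) by (rule admissible_exchange(1)[OF Cons.prems(1-3) assms(1) adm l' True])
    have ar: "arrows (?G # ws) = D ?G (lift g' a' b') * arrows ws"
      using ws(1,2) by (cases ws) auto
    have "D g g' * (arrows (g' # gs) - D g' (lift g' a' b') * arrows ws)
      + (D g g' * D g' (lift g' a' b') - D g ?G * D ?G (lift g' a' b')) * arrows ws \<in> RI"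
      by (rule RI_add[OF RI_left[OF F_D eq]
            RI_right[OF exchange_relation[OF Cons.prems(1-3) assms(1) adm l' True] F_arrows]])
    then have "arrows (g # g' # gs) - D g ?G * arrows (?G # ws) \<in> RI"
      unfolding ar by (simp add: algebra_simps)
    moreover have "successively admissible (?G # ws)" using admG ws(1,5) by (simp add: successively_Cons)
    ultimately show ?thesis using ws G by (intro exI[of _ "?G # ws"]) auto
  qed
next
  case Nil
  then show ?case using Nil.prems(5)[of a] by simp
qed


definition reg_arrows :: "(int \<Rightarrow> int) \<Rightarrow> nat \<Rightarrow> 'k free_elem" where
  "reg_arrows h i = arrows (map (reg_chain h) [0..<Suc i])"

lemma reg_arrows_Suc: "reg_arrows h (Suc i) = reg_arrows h i * D (reg_chain h i) (reg_chain h (Suc i))"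
  using arrows_append[of "map (reg_chain h) [0..<i]" "reg_chain h i" "[reg_chain h (Suc i)]"]
  by (simp add: reg_arrows_def)

lemma F_reg_arrows [simp, intro]: "reg_arrows h i \<in> carrier FA"
  by (simp add: reg_arrows_def)

text \<open>
  Applying the exchange at every level up to that of regular partitions splits off the steps of the
  regularisation.
\<close>

lemma reg_factorisation:
  assumes h: "h \<in> LP" and l: "lowest_arc h a b" and mn: "m \<le> n" and i: "h a + int i \<le> int m + 1"
    and us: "us \<noteq> []" "hd us = h" "successively admissible us" "set us \<subseteq> LP" "\<And>x. int m + 1 \<le> last us x"
  shows "\<exists>ws. ws \<noteq> [] \<and> hd ws = reg_chain h i \<and> last ws = last us \<and> set ws \<subseteq> LP \<and>
    successively admissible ws \<and> arrows us - reg_arrows h i * arrows ws \<in> RI"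
  using i
proof (induction i)
  case 0
  show ?case using us by (intro exI[of _ us]) (simp add: reg_chain_def reg_arrows_def)
next
  case (Suc i)
  then have i: "h a + int i \<le> int m + 1" by simp
  from Suc.IH[OF i] obtain ws where ws: "ws \<noteq> []" "hd ws = reg_chain h i" "last ws = last us"
    "set ws \<subseteq> LP" "successively admissible ws" and eq: "arrows us - reg_arrows h i * arrows ws \<in> RI" by blast
  obtain A B where *: "reg_chain h i \<in> LP" "lowest_arc (reg_chain h i) A B" "reg_chain h i A = h a + int i"
    by (rule reg_chain_lowest[OF h l mn i])
  have M: "reg_chain h i A \<le> int m" using Suc.prems *(3) by simp
  have S: "reg_chain h (Suc i) = lift (reg_chain h i) A B"
    using lowest_lift_eq[OF *(2)] by (simp add: reg_chain_def)
  obtain gs where gs: "ws = reg_chain h i # gs" using ws(1,2) by (cases ws) auto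
  have last: "reg_chain h i A < last (reg_chain h i # gs) x" for x
    using us(5)[of x] ws(3) gs M by simp
  from exchange_path[OF mn *(1,2) M ws(5)[unfolded gs] last] obtain vs where
    vs: "vs \<noteq> []" "hd vs = reg_chain h (Suc i)" "last vs = last us" "set vs \<subseteq> LP" "successively admissible vs"
    and eq': "arrows ws - D (reg_chain h i) (reg_chain h (Suc i)) * arrows vs \<in> RI"
    unfolding S using ws(3) gs by auto
  have "(arrows us - reg_arrows h i * arrows ws) +
      reg_arrows h i * (arrows ws - D (reg_chain h i) (reg_chain h (Suc i)) * arrows vs) \<in> RI"
    by (rule RI_add[OF eq RI_left[OF F_reg_arrows eq']])
  then have "arrows us - reg_arrows h (Suc i) * arrows vs \<in> RI"
    unfolding reg_arrows_Suc by (simp add: algebra_simps)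
  then show ?case using vs by blast
qed

lemma generation:
  assumes h: "h \<in> LP" and l: "lowest_arc h a b" and mn: "m \<le> n" and i: "h a + int i \<le> int m + 1"
    and \<beta>: "\<beta> \<in> LP" "\<And>x. int m + 1 \<le> \<beta> x" and f: "f \<in> carrier FA"
  shows "E h * f * E \<beta> \<in> rspan ({E h * reg_arrows h i * x | x. x \<in> carrier FA} \<union> low h)" (is "_ \<in> rspan ?B")
proof -
  have "connections h \<beta> \<subseteq> rspan ?B"
  proof
    fix y assume "y \<in> connections h \<beta>"
    then obtain hs where y: "y = path hs" and hs: "hs \<noteq> []" "set hs \<subseteq> LP" "h = hd hs" "\<beta> = last hs"
      unfolding connections_def by blast
    have "path ` up_paths (hd hs) (last hs) (length hs) \<subseteq> rspan ?B"
    proof clarify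
      fix us assume "us \<in> up_paths (hd hs) (last hs) (length hs)"
      then have us: "us \<noteq> []" "set us \<subseteq> LP" "successively up_step us" "hd us = h" "last us = \<beta>"
        using hs by (auto simp: up_paths_def)
      have "successively admissible us"
        using us(3) by (rule successively_mono) (simp add: admissible_def)
      from reg_factorisation[OF h l mn i us(1,4) this us(2)] us(5) \<beta>(2) obtain ws where
        "arrows us - reg_arrows h i * arrows ws \<in> RI" by auto
      then have "E h * (arrows us - reg_arrows h i * arrows ws) \<in> RI" using h by (intro RI_left F_E)
      then have "path us - E h * reg_arrows h i * arrows ws \<in> RI"
        using us(4) by (simp add: path_def algebra_simps)
      then show "path us \<in> rspan ?B" by (rule rspan_cong) (intro rspan_base UnI1 CollectI exI[of _ "arrows ws"]; simp)
    qed
    moreover have "low (hd hs) \<subseteq> rspan ?B" using hs(3) by (auto intro: rspan_base)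
    ultimately show "y \<in> rspan ?B"
      unfolding y by (intro subsetD[OF rspan_subset straighten[OF hs(1,2)]] Un_least)
  qed
  from rspan_subset[OF this] show ?thesis using E_sandwich_paths[OF f h \<beta>(1)] by blast
qed

text \<open>
  Loops of positive length are nilpotent on the standard module, because long paths straighten to zero
  in it. Hence \<open>f\<close>, a non-zero multiple \<open>c\<close> of the idempotent plus loops, can be inverted on the path
  by a geometric series.
\<close>

lemma local_inverse:
  assumes vs: "vs \<noteq> []" "set vs \<subseteq> LP" and lam: "\<nu> = last vs"
    and f: "f - scalar c * E \<nu> \<in> rspan (loops \<nu>)"
    and fF: "f \<in> carrier FA" and c: "c \<noteq> 0"
  shows "\<exists>x \<in> carrier FA. path vs * f * x - path vs \<in> rspan (low (hd vs))"
proof -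
  let ?Q = "\<lambda>N. {path hs | hs. hs \<noteq> [] \<and> set hs \<subseteq> LP \<and> hd hs = hd vs \<and> last hs = \<nu> \<and> N < length hs}"
  have \<nu>: "\<nu> \<in> LP" using vs lam by auto
  define p where "p = f - scalar c * E \<nu>"
  have pF: "p \<in> carrier FA" unfolding p_def using fF \<nu> by auto
  have pB: "p \<in> rspan (loops \<nu>)" using f by (simp add: p_def)
  have vF: "path vs \<in> carrier FA" using vs by (rule F_path)
  have pow: "path vs * p ^ N \<in> rspan (?Q N)" for N
  proof (induction N)
    case 0
    show ?case using vs lam by (auto intro!: rspan_base)
  next
    case (Suc N)
    have "1 * (path vs * p ^ N) * p \<in> rspan (?Q (Suc N))"
    proof (rule rspan_mult[OF Suc.IH F_one pF])
      fix x assume "x \<in> ?Q N"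
      then obtain hs where hs: "x = path hs" "hs \<noteq> []" "set hs \<subseteq> LP" "hd hs = hd vs" "last hs = \<nu>" "N < length hs"
        by blast
      have xF: "x \<in> carrier FA" using hs F_path by simp
      have "x * p * 1 \<in> rspan (?Q (Suc N))"
      proof (rule rspan_mult[OF pB xF F_one])
        fix y assume "y \<in> loops \<nu>"
        then obtain us where us: "y = path us" "us \<noteq> []" "set us \<subseteq> LP" "hd us = \<nu>" "last us = \<nu>" "2 \<le> length us"
          unfolding loops_def by blast
        have "path hs * path us - path (hs @ tl us) \<in> RI"
          using path_mult[OF hs(2,3) us(2,3)] hs(5) us(4) by simp
        moreover have tl: "tl us \<noteq> []" "last (tl us) = \<nu>" "set (tl us) \<subseteq> LP"
          using us by (cases us; auto split: if_splits)+
        have "path (hs @ tl us) \<in> ?Q (Suc N)"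
          using hs us tl by (intro CollectI exI[of _ "hs @ tl us"]) auto
        ultimately show "x * y * 1 \<in> rspan (?Q (Suc N))"
          using rspan_cong rspan_base hs(1) us(1) by (metis (no_types, lifting) mult.right_neutral)
      qed
      then show "1 * x * p \<in> rspan (?Q (Suc N))" by simp
    qed
    then show ?case by (simp add: mult.assoc power_commutes)
  qed
  \<comment> \<open>From this length on all paths are zero modulo smaller partitions.\<close>
  define N where "N = max_area + 1"
  have "?Q N \<subseteq> rspan (low (hd vs))"
  proof clarify
    fix hs assume "hs \<noteq> []" "set hs \<subseteq> LP" "hd hs = hd vs" "N < length hs"
    then show "path hs \<in> rspan (low (hd vs))" using long_path_low[of hs] by (simp add: N_def)
  qed
  then have low: "path vs * p ^ N \<in> rspan (low (hd vs))" using pow[of N] rspan_subset by blast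
  define q where "q = scalar (- (1 / c)) * p"
  have qpow: "q ^ j = scalar ((- (1 / c)) ^ j) * p ^ j" for j
  proof (induction j)
    case (Suc j)
    have "q ^ Suc j = scalar (- (1 / c)) * (p * scalar ((- (1 / c)) ^ j)) * p ^ j"
      unfolding power_Suc Suc by (simp only: q_def mult.assoc)
    also have "\<dots> = (scalar (- (1 / c)) * scalar ((- (1 / c)) ^ j)) * (p * p ^ j)"
      by (simp only: scalar_commute[of "(- (1 / c)) ^ j" p, symmetric] mult.assoc)
    also have "\<dots> = scalar ((- (1 / c)) ^ Suc j) * p ^ Suc j" by (simp add: mult_single)
    finally show ?case .
  qed simp
  define s where "s = (\<Sum>j<N. q ^ j)"
  define x where "x = s * scalar (1 / c)"
  have qF: "q \<in> carrier FA" unfolding q_def using pF by auto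
  have sF: "s \<in> carrier FA" unfolding s_def using qF by (intro F_sum) auto
  have xF: "x \<in> carrier FA" unfolding x_def using sF by auto
  have cc: "scalar c * scalar (1 / c) = 1" "scalar c * scalar (- (1 / c)) = - 1"
    using c by (simp_all add: mult_single single_uminus)
  have "scalar c * (1 - q) = scalar c - (scalar c * scalar (- (1 / c))) * p"
    unfolding q_def by (simp only: right_diff_distrib mult_1_right mult.assoc)
  then have cq: "scalar c * (1 - q) = scalar c + p" unfolding cc(2) by simp
  have "(scalar c + p) * x = scalar c * ((1 - q) * s) * scalar (1 / c)"
    unfolding x_def cq[symmetric] by (simp only: mult.assoc)
  also have "(1 - q) * s = 1 - q ^ N" unfolding s_def by (rule geometric_sum_noncommutative)
  also have "scalar c * (1 - q ^ N) * scalar (1 / c) = (scalar c * scalar (1 / c)) * (1 - q ^ N)"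
    by (simp only: mult.assoc scalar_commute[of "1 / c" "1 - q ^ N"])
  finally have cx: "(scalar c + p) * x = 1 - q ^ N" using cc(1) by simp
  have "path vs * E \<nu> - path vs \<in> RI" using path_E[OF \<nu> vs] lam by simp
  then have "(path vs * E \<nu> - path vs) * (scalar c * x) \<in> RI" using xF by (intro RI_right F_mult F_scalar)
  moreover have "path vs * f * x - path vs = (path vs * E \<nu> - path vs) * (scalar c * x) - path vs * q ^ N"
  proof -
    have "f = E \<nu> * scalar c + p" by (simp add: p_def scalar_commute)
    then have "path vs * f * x = (path vs * E \<nu> - path vs) * (scalar c * x) + path vs * ((scalar c + p) * x)"
      by (simp add: algebra_simps)
    then show ?thesis unfolding cx by (simp add: algebra_simps)
  qed
  moreover have "path vs * q ^ N \<in> rspan (low (hd vs))"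
  proof -
    have "path vs * q ^ N = scalar ((- (1 / c)) ^ N) * (path vs * p ^ N)"
      unfolding qpow mult.assoc[symmetric] scalar_commute[of _ "path vs"] ..
    then show ?thesis using rspan_scale[OF low] by simp
  qed
  ultimately show ?thesis using xF rspan_diff rspan_RI by metis
qed

lemma loop_decomposition:
  assumes f: "f \<in> carrier FA" and \<nu>: "\<nu> \<in> LP"
  shows "\<exists>c. E \<nu> * f * E \<nu> - scalar c * E \<nu> \<in>
    rspan (loops \<nu>)"
  using E_sandwich_paths[OF f \<nu> \<nu>]
proof (induction rule: rspan_induct)
  case (rel f)
  then show ?case by (intro exI[of _ 0]) (simp add: rspan_RI)
next
  case (base f)
  then obtain hs where hs: "f = path hs" "hs \<noteq> []" "set hs \<subseteq> LP" "hd hs = \<nu>" "last hs = \<nu>"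
    unfolding connections_def by blast
  show ?case
  proof (cases "2 \<le> length hs")
    case True
    then have "f \<in> loops \<nu>" unfolding loops_def using hs by blast
    then show ?thesis by (intro exI[of _ 0]) (simp add: rspan_base)
  next
    case False
    then have "hs = [hd hs]" using hs(2) by (cases hs; cases "tl hs") auto
    then have "hs = [\<nu>]" using hs(4) by simp
    then have "f = E \<nu>" using hs by (simp add: path_def)
    then show ?thesis by (intro exI[of _ 1]) (simp add: rspan_zero)
  qed
next
  case zero
  show ?case by (intro exI[of _ 0]) (simp add: rspan_zero)
next
  case (add f g)
  then obtain c d where *: "f - scalar c * E \<nu> \<in> rspan (loops \<nu>)"
    "g - scalar d * E \<nu> \<in> rspan (loops \<nu>)"
    by blast
  have "f + g - scalar (c + d) * E \<nu> = (f - scalar c * E \<nu>) + (g - scalar d * E \<nu>)"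
    by (simp add: single_add algebra_simps)
  from rspan_add[OF *, folded this] show ?case by blast
next
  case (scale d f)
  then obtain c where *: "f - scalar c * E \<nu> \<in> rspan (loops \<nu>)"
    by blast
  have "scalar d * f - scalar (d * c) * E \<nu> = scalar d * (f - scalar c * E \<nu>)"
    by (simp add: right_diff_distrib mult_single flip: mult.assoc)
  from rspan_scale[OF *, of d, folded this] show ?case by blast
qed

end

section \<open>A representation that detects the regularisation\<close>

lemma poly_mapping_additive_induct [case_names single add]:
  fixes f :: "'a \<Rightarrow>\<^sub>0 'b::comm_monoid_add"
  assumes "\<And>w c. P (Poly_Mapping.single w c)" "\<And>f g. P f \<Longrightarrow> P g \<Longrightarrow> P (f + g)"
  shows "P f"
proof -
  have "P (\<Sum>w\<in>A. Poly_Mapping.single w (Poly_Mapping.lookup f w))" if "finite A" for A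
    using that
  proof (induction A)
    case empty
    show ?case using assms(1)[of undefined 0] by simp
  qed (use assms in simp)
  then show ?thesis using poly_mapping_sum_singles[of f] by (metis finite_keys)
qed

lemma dual_dual [simp]: "dual (dual f) = f"
  by (rule poly_mapping_eqI) (simp add: lookup_dual)

lemma dual_zero [simp]: "dual 0 = 0"
  by (rule poly_mapping_eqI) (simp add: lookup_dual)

lemma dual_add: "dual (f + g) = dual f + dual g"
  by (rule poly_mapping_eqI) (simp add: lookup_dual lookup_add)

lemma dual_uminus: "dual (- f) = - dual f"
  by (rule poly_mapping_eqI) (simp add: lookup_dual)

text \<open>
  A deterministic automaton that reads words: its states are partitions, an idempotent is accepted only
  in its own state, and an arrow changes the state only if it belongs to \<open>T\<close>.
\<close>

fun run :: "(diagram \<times> diagram) set \<Rightarrow> diagram \<Rightarrow> generator list \<Rightarrow> diagram option" where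
  "run T \<kappa> [] = Some \<kappa>"
| "run T \<kappa> (IdemGen \<mu> # w) = (if \<kappa> = \<mu> then run T \<kappa> w else None)"
| "run T \<kappa> (ArrGen \<rho> \<nu> # w) = (if \<kappa> = \<rho> \<and> (\<rho>, \<nu>) \<in> T then run T \<nu> w else None)"

lemma run_append: "run T \<kappa> (u @ w) = Option.bind (run T \<kappa> u) (\<lambda>\<nu>. run T \<nu> w)"
  by (induction T \<kappa> u rule: run.induct) auto

lemma run_closed:
  assumes "run T \<kappa> w = Some \<nu>" "\<kappa> \<in> W" "\<And>\<rho> \<mu>. (\<rho>, \<mu>) \<in> T \<Longrightarrow> \<rho> \<in> W \<Longrightarrow> \<mu> \<in> W"
  shows "\<nu> \<in> W"
  using assms(1,2)
proof (induction w arbitrary: \<kappa>)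
  case (Cons g w)
  then show ?case by (cases g) (auto split: if_splits dest: assms(3))
qed simp

text \<open>
  The matrix coefficients of the representation of the free algebra given by the automaton.
\<close>

definition transition :: "(diagram \<times> diagram) set \<Rightarrow> diagram \<Rightarrow> diagram \<Rightarrow> 'k::field free_elem \<Rightarrow> 'k" where
  "transition T \<kappa> \<mu> f =
     (\<Sum>w\<in>Poly_Mapping.keys f. if run T \<kappa> (letters w) = Some \<mu> then Poly_Mapping.lookup f w else 0)"

lemma transition_superset:
  assumes "finite A" "Poly_Mapping.keys f \<subseteq> A"
  shows "transition T \<kappa> \<mu> f = (\<Sum>w\<in>A. if run T \<kappa> (letters w) = Some \<mu> then Poly_Mapping.lookup f w else 0)"
  unfolding transition_def using assms by (intro sum.mono_neutral_left) (auto simp: in_keys_iff)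

lemma transition_add: "transition T \<kappa> \<mu> (f + g) = transition T \<kappa> \<mu> f + transition T \<kappa> \<mu> g"
proof -
  let ?A = "Poly_Mapping.keys f \<union> Poly_Mapping.keys g"
  show ?thesis
    using transition_superset[of ?A f] transition_superset[of ?A g] transition_superset[of ?A "f + g"] keys_add[of f g]
    by (simp add: lookup_add flip: sum.distrib) (intro sum.cong; simp add: lookup_add)
qed

lemma transition_zero [simp]: "transition T \<kappa> \<mu> 0 = 0"
  by (simp add: transition_def)

lemma transition_uminus: "transition T \<kappa> \<mu> (- f) = - transition T \<kappa> \<mu> f"
  using transition_add[of T \<kappa> \<mu> f "- f"] by (simp add: eq_neg_iff_add_eq_0 add.commute)

lemma transition_diff: "transition T \<kappa> \<mu> (f - g) = transition T \<kappa> \<mu> f - transition T \<kappa> \<mu> g"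
  using transition_add[of T \<kappa> \<mu> f "- g"] transition_uminus[of T \<kappa> \<mu> g] by simp

lemma transition_sum: "transition T \<kappa> \<mu> (sum f A) = (\<Sum>x\<in>A. transition T \<kappa> \<mu> (f x))"
  by (induction A rule: infinite_finite_induct) (simp_all add: transition_add)

lemma transition_single:
  "transition T \<kappa> \<mu> (Poly_Mapping.single w c) = (if run T \<kappa> (letters w) = Some \<mu> then c else 0)"
  using transition_superset[of "{w}" "Poly_Mapping.single w c" T \<kappa> \<mu>] by (simp add: keys_single)

lemma transition_scale: "transition T \<kappa> \<mu> (scalar c * f) = c * transition T \<kappa> \<mu> f"
  by (induction f rule: poly_mapping_additive_induct)
    (simp_all add: mult_single transition_single distrib_left transition_add)

lemma transition_mult:
  assumes "finite W" "\<kappa> \<in> W" "\<And>\<rho> \<mu>. (\<rho>, \<mu>) \<in> T \<Longrightarrow> \<rho> \<in> W \<Longrightarrow> \<mu> \<in> W"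
  shows "transition T \<kappa> \<mu> (f * g) = (\<Sum>\<nu>\<in>W. transition T \<kappa> \<nu> f * transition T \<nu> \<mu> g)"
proof (induction f rule: poly_mapping_additive_induct)
  case (add f f')
  then show ?case by (simp add: distrib_right transition_add sum.distrib)
next
  case (single u c)
  show ?case
  proof (induction g rule: poly_mapping_additive_induct)
    case (add g g')
    then show ?case by (simp add: distrib_left transition_add sum.distrib)
  next
    case (single v d)
    show ?case
    proof (cases "run T \<kappa> (letters u)")
      case None
      then show ?thesis by (simp add: mult_single transition_single plus_free_monoid_def run_append)
    next
      case (Some \<nu>)
      then have "\<nu> \<in> W" using run_closed[OF Some] assms by blast
      have "(\<Sum>\<nu>'\<in>W. (if \<nu> = \<nu>' then c else 0) * (if run T \<nu>' (letters v) = Some \<mu> then d else 0)) =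
        (\<Sum>\<nu>'\<in>W. if \<nu> = \<nu>' then c * (if run T \<nu> (letters v) = Some \<mu> then d else 0) else 0)"
        by (intro sum.cong) auto
      also have "\<dots> = c * (if run T \<nu> (letters v) = Some \<mu> then d else 0)"
        using \<open>\<nu> \<in> W\<close> assms(1) by (simp add: sum.delta')
      finally show ?thesis using Some
        by (simp add: mult_single transition_single plus_free_monoid_def run_append)
    qed
  qed
qed

lemma transition_arr2:
  "transition T \<kappa> \<mu> (arr m n a b * arr m n c d) =
     (if linked m n a b \<and> linked m n c d \<and> \<kappa> = a \<and> b = c \<and> \<mu> = d \<and> (a, b) \<in> T \<and> (c, d) \<in> T then 1 else 0)"
  by (auto simp: arr_def mult_single transition_single plus_free_monoid_def)

context arc_presentation begin

text \<open>
  The arrows that occur as steps of regularisations. Each partition has at most one of them leaving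
  it.
\<close>

definition lifts :: "(diagram \<times> diagram) set" where
  "lifts = {(shape h, shape (lift h a b)) | h a b.
     h \<in> LP \<and> lowest_arc h a b \<and> h a \<le> int m}"

definition vanishing :: "diagram set \<Rightarrow> 'k free_elem set" where
  "vanishing W = {f \<in> carrier FA. \<forall>\<kappa>\<in>W. \<forall>\<mu>. transition lifts \<kappa> \<mu> f = 0}"

end

locale arc_rectangle = arc_presentation m n ground_field
  for m n :: nat and ground_field :: "'k::field itself" +
  assumes m_le_n: "m \<le> n"
begin

abbreviation tr :: "diagram \<Rightarrow> diagram \<Rightarrow> 'k free_elem \<Rightarrow> 'k" where
  "tr \<equiv> transition lifts"

lemma liftsE:
  assumes "(\<kappa>, \<mu>) \<in> lifts"
  obtains h a b where "\<kappa> = shape h" "\<mu> = shape (lift h a b)" "h \<in> LP" "lift h a b \<in> LP"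
    "lowest_arc h a b" "h a \<le> int m" "a \<le> b"
  using assms lowest_arc_addable[OF _ _ _ m_le_n] lowest_arcD(4) unfolding lifts_def by blast

lemma lifts_Pmn: "(\<kappa>, \<mu>) \<in> lifts \<Longrightarrow> \<kappa> \<in> Pmn m n \<and> \<mu> \<in> Pmn m n"
  by (elim liftsE) (simp add: shape_Pmn)

lemma lifts_less:
  assumes "g \<in> LP" "h \<in> LP" "(shape g, shape h) \<in> lifts"
  shows "(\<forall>x. g x \<le> h x) \<and> g \<noteq> h"
  using assms(3)
proof (rule liftsE)
  fix k a b assume *: "shape g = shape k" "shape h = shape (lift k a b)"
    "k \<in> LP" "lift k a b \<in> LP" "a \<le> b"
  then have "g = k" "h = lift k a b" using assms shape_eq_iff by blast+
  then show ?thesis using * by (auto simp: lift_def fun_eq_iff)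
qed

lemma lifts_not_le:
  assumes "g \<in> LP" "h \<in> LP" "\<And>x. h x \<le> g x"
  shows "(shape g, shape h) \<notin> lifts"
  using lifts_less[OF assms(1,2)] assms(3) by (metis order_antisym ext)

text \<open>
  Two successive lifts overlap: the second arc \<open>[P, Q]\<close> strictly contains the first.
\<close>

lemma lifts_two_path:
  assumes "g \<in> LP" "k \<in> LP" "h \<in> LP"
    "(shape g, shape k) \<in> lifts" "(shape k, shape h) \<in> lifts"
  obtains p q P Q where "k = lift g p q" "h = lift k P Q" "P < p" "q < Q" "p \<le> q" "k P = g p + 1"
proof -
  obtain p q where g: "k = lift g p q" "lowest_arc g p q" "g p \<le> int m" "p \<le> q"
    using assms(4)
  proof (rule liftsE)
    fix l a b assume *: "shape g = shape l" "shape k = shape (lift l a b)"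
      "l \<in> LP" "lift l a b \<in> LP" "lowest_arc l a b" "l a \<le> int m" "a \<le> b"
    then have "g = l" "k = lift l a b" using assms shape_eq_iff by blast+
    then show thesis using that * by blast
  qed
  obtain P Q where k: "h = lift k P Q" "lowest_arc k P Q"
    using assms(5)
  proof (rule liftsE)
    fix l a b assume *: "shape k = shape l" "shape h = shape (lift l a b)"
      "l \<in> LP" "lift l a b \<in> LP" "lowest_arc l a b"
    then have "k = l" "h = lift l a b" using assms shape_eq_iff by blast+
    then show thesis using that * by blast
  qed
  show thesis
    using that[OF g(1) k(1)] lowest_arc_lift[OF assms(1) g(2,3) m_le_n, of P Q] k(2) g(1,4) by simp
qed

lemma cut_eq_cut: "cut h a b = cut h c d \<Longrightarrow> a \<le> b \<Longrightarrow> c = a \<and> d = b"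
proof -
  assume *: "cut h a b = cut h c d" and "a \<le> b"
  have "a \<le> x \<and> x \<le> b \<longleftrightarrow> c \<le> x \<and> x \<le> d" for x
    using fun_cong[OF *, of x] by (auto simp: cut_def split: if_splits)
  then have "{a..b} = {c..d}" by (intro Set.set_eqI) simp
  then show ?thesis using \<open>a \<le> b\<close> by (simp add: Icc_eq_Icc)
qed

text \<open>
  The paths of two successive lifts do not commute: after removal of the inner path first, the interior
  of the outer arc would drop below the height of its ends.
\<close>

lemma lifts_not_commuting:
  assumes h: "h \<in> LP" and c: "commuting_at h a b c d"
    and T: "(shape (cut (cut h a b) c d), shape (cut h a b)) \<in> lifts"
      "(shape (cut h a b), shape h) \<in> lifts"
  shows False
proof -
  have r: "removable_at h a b" "removable_at (cut h a b) c d" "removable_at (cut h c d) a b"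
    using c by (auto simp: commuting_at_def)
  let ?k = "cut h a b" and ?g = "cut (cut h a b) c d"
  have LP: "?k \<in> LP" "?g \<in> LP" using cut_LP h r by blast+
  obtain p q P Q where *: "?k = lift ?g p q" "h = lift ?k P Q" "P < p" "q < Q" "p \<le> q" "?k P = ?g p + 1"
    by (rule lifts_two_path[OF LP(2,1) h T])
  have "cut h P Q = ?k" using *(2) cut_lift[of ?k P Q] by argo
  then have PQ: "P = a" "Q = b" using cut_eq_cut[of h a b P Q] removable_atD(1)[OF r(1)] by auto
  have "cut ?k p q = ?g" using *(1) cut_lift[of ?g p q] by argo
  then have pq: "p = c" "q = d" using cut_eq_cut[of ?k c d p q] removable_atD(1)[OF r(2)] by auto
  have "cut h c d a \<le> cut h c d c" using removable_atD(5)[OF r(3), of c] * PQ pq by simp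
  then show False using * PQ pq by (simp add: cut_def)
qed

lemma lifts_overlap:
  assumes "h \<in> LP" "cut h a b \<in> LP" "cut (cut h a b) c d \<in> LP"
    and T: "(shape (cut (cut h a b) c d), shape (cut h a b)) \<in> lifts"
      "(shape (cut h a b), shape h) \<in> lifts"
  shows "{a..b} \<inter> {c..d} \<noteq> {}"
proof -
  obtain p q P Q where *: "cut h a b = lift (cut (cut h a b) c d) p q" "h = lift (cut h a b) P Q"
    "P < p" "q < Q" "p \<le> q"
    by (rule lifts_two_path[OF assms(3,2,1) T])
  have "h p = cut h a b p + 2" using fun_cong[OF *(2), of p, unfolded lift_def] *(3-5) by simp
  moreover have "cut h a b p = cut (cut h a b) c d p + 2"
    using fun_cong[OF *(1), of p, unfolded lift_def] *(3-5) by simp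
  ultimately have "h p = cut (cut h a b) c d p + 4" by simp
  then have "p \<in> {a..b} \<inter> {c..d}" by (auto simp: cut_def split: if_splits)
  then show ?thesis by blast
qed

lemma DRem_obtain:
  assumes "\<mu> \<in> Pmn m n" "P \<in> DRem m n \<mu>"
  obtains h a b where "h \<in> LP" "\<mu> = shape h" "P = {a..b}" "removable_at h a b" "cut h a b \<in> LP"
    "dminus m n \<mu> P = shape (cut h a b)"
proof -
  obtain h where h: "h \<in> LP" "\<mu> = shape h" by (rule Pmn_obtain[OF assms(1)])
  obtain a b where "P = {a..b}" "removable_at h a b"
    using assms(2) unfolding h(2) DRem_shape[OF h(1)] by blast
  then show thesis using that h cut_LP dminus_shape by blast
qed

lemma DRem_obtain_at:
  assumes "h \<in> LP" "P \<in> DRem m n (shape h)"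
  obtains a b where "P = {a..b}" "removable_at h a b" "cut h a b \<in> LP"
    "dminus m n (shape h) P = shape (cut h a b)"
  using assms cut_LP dminus_shape unfolding DRem_shape[OF assms(1)] by blast

text \<open>
  As the relations are closed under the anti-involution, vanishing has to be carried along for the dual
  element as well.
\<close>

definition killed :: "'k free_elem \<Rightarrow> bool" where
  "killed f \<longleftrightarrow> (\<forall>\<kappa>\<in>Pmn m n. \<forall>\<mu>. tr \<kappa> \<mu> f = 0 \<and> tr \<kappa> \<mu> (dual f) = 0)"

lemma killed_zero: "killed 0"
  by (simp add: killed_def)

lemma killed_add: "killed f \<Longrightarrow> killed g \<Longrightarrow> killed (f + g)"
  by (simp add: killed_def dual_add transition_add)

lemma killed_uminus: "killed f \<Longrightarrow> killed (- f)"
  by (simp add: killed_def dual_uminus transition_uminus)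

lemma killed_diff: "killed f \<Longrightarrow> killed g \<Longrightarrow> killed (f - g)"
  using killed_add[of f "- g"] killed_uminus[of g] by simp

lemma killed_sign: "killed f \<Longrightarrow> killed ((- 1) ^ k * f)"
  by (cases "even k") (auto intro: killed_uminus)

lemma killed_two: "killed f \<Longrightarrow> killed (2 * f)"
  using killed_add[of f f] by (simp add: mult_2)

lemma killed_sum: "(\<And>x. x \<in> A \<Longrightarrow> killed (f x)) \<Longrightarrow> killed (sum f A)"
  by (induction A rule: infinite_finite_induct) (auto intro: killed_zero killed_add)

lemma killed_arr2:
  assumes "\<not> ((a, b) \<in> lifts \<and> (b, d) \<in> lifts)" "\<not> ((d, b) \<in> lifts \<and> (b, a) \<in> lifts)"
  shows "killed (arr m n a b * arr m n b d)"
  using assms by (auto simp: killed_def dual_arr2 transition_arr2)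

text \<open>
  The relations on idempotents hold for the automaton by construction. Every other monomial that occurs is
  a product of two arrows, and none of them is a product of two successive lifts, in either order: a
  lift adds tiles, which rules out monomials with a removal; adjacent paths and the two sides of a
  split arc have disjoint contents, whereas successive lifts overlap; and successive lifts do not
  commute. For a join of adjacent paths one of the two arrows removes tiles or changes nothing.
\<close>

lemma killed_relations: "f \<in> relations m n \<Longrightarrow> killed f"
proof (induction rule: relations.induct)
  case unit
  have "(\<Sum>\<mu>\<in>Pmn m n. tr \<kappa> \<nu> (idem \<mu> :: 'k free_elem)) = tr \<kappa> \<nu> (1 :: 'k free_elem)"
    if "\<kappa> \<in> Pmn m n" for \<kappa> \<nu>
  proof -
    have "tr \<kappa> \<nu> (1 :: 'k free_elem) = (if \<kappa> = \<nu> then 1 else 0)"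
      unfolding single_one[symmetric] transition_single by (simp add: zero_free_monoid_def)
    moreover have "(\<Sum>\<mu>\<in>Pmn m n. tr \<kappa> \<nu> (idem \<mu> :: 'k free_elem)) =
        (\<Sum>\<mu>\<in>Pmn m n. if \<kappa> = \<mu> then (if \<kappa> = \<nu> then 1 else 0) else 0)"
      by (intro sum.cong) (auto simp: idem_def transition_single)
    ultimately show ?thesis using that finite_Pmn by (simp add: sum.delta)
  qed
  moreover have "dual (\<Sum>\<mu>\<in>A. idem \<mu> :: 'k free_elem) = (\<Sum>\<mu>\<in>A. idem \<mu>)" for A
  proof (induction A rule: infinite_finite_induct)
    case (insert x F)
    then show ?case by (simp add: dual_add) (simp add: idem_def dual_single dual_word_def)
  qed simp_all
  moreover have "dual (1 :: 'k free_elem) = 1"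
    unfolding single_one[symmetric] dual_single by (simp add: dual_word_def zero_free_monoid_def)
  ultimately show ?case by (simp add: killed_def transition_diff transition_sum dual_diff)
next
  case (idempotent \<mu> \<kappa>)
  show ?case
    by (auto simp: killed_def transition_diff dual_diff idem_def mult_single dual_single dual_word_def
        plus_free_monoid_def transition_single)
next
  case (idempotent_arr \<mu> P \<kappa>)
  show ?case
    by (auto simp: killed_def transition_diff dual_diff idem_def arr_def mult_single dual_single dual_word_def
        plus_free_monoid_def transition_single)
next
  case (self_dual \<mu> P \<kappa>)
  have asym: "\<not> ((a, b) \<in> lifts \<and> (b, a) \<in> lifts)" for a b
  proof
    assume *: "(a, b) \<in> lifts \<and> (b, a) \<in> lifts"
    then have ab: "a \<in> Pmn m n" "b \<in> Pmn m n" using lifts_Pmn by blast+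
    obtain g where g: "g \<in> LP" "a = shape g" by (rule Pmn_obtain[OF ab(1)])
    obtain h where h: "h \<in> LP" "b = shape h" by (rule Pmn_obtain[OF ab(2)])
    have "(\<forall>x. g x \<le> h x) \<and> g \<noteq> h" using lifts_less[OF g(1) h(1)] * g h by blast
    then show False using lifts_not_le[OF h(1) g(1)] * g h by blast
  qed
  show ?case
    by (intro killed_diff killed_sign killed_add killed_two killed_sum)
      (simp_all only: mult.assoc, (intro killed_sign killed_arr2; use asym in blast)+)
next
  case (commuting_down \<mu> P Q \<kappa> \<nu> \<rho>)
  have P: "P \<in> DRem m n \<mu>" and Q: "Q \<in> DRem m n \<mu>" and PQ: "P \<in> DRem m n \<nu>" and QP: "Q \<in> DRem m n \<kappa>"
    using commuting_down by (auto simp: commuting_def)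
  obtain h a b where h: "h \<in> LP" "\<mu> = shape h" "P = {a..b}" "removable_at h a b" "cut h a b \<in> LP"
    "\<kappa> = shape (cut h a b)"
    using DRem_obtain[OF commuting_down(1) P] commuting_down(3) by metis
  obtain c d where cd: "Q = {c..d}" "removable_at h c d" "cut h c d \<in> LP" "\<nu> = shape (cut h c d)"
    using DRem_obtain_at[OF h(1)] Q h(2) commuting_down(4) by metis
  have r1: "removable_at (cut h a b) c d"
    using QP removable_atD(1)[OF cd(2)] unfolding h(6) DRem_shape[OF h(5)] cd(1) by (auto simp: Icc_eq_Icc)
  have r2: "removable_at (cut h c d) a b"
    using PQ removable_atD(1)[OF h(4)] unfolding cd(4) DRem_shape[OF cd(3)] h(3) by (auto simp: Icc_eq_Icc)
  have c1: "commuting_at h a b c d" and c2: "commuting_at h c d a b"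
    using h cd r1 r2 by (auto simp: commuting_at_def)
  have rho: "\<rho> = shape (cut (cut h a b) c d)"
    using commuting_down(5) dminus_shape[OF h(5) r1] h(6) cd(1) by simp
  have rho': "\<rho> = shape (cut (cut h c d) a b)"
    unfolding rho by (rule arg_cong[of _ _ shape]) (auto simp: cut_def fun_eq_iff)
  have "killed (arr m n \<rho> \<kappa> * arr m n \<kappa> \<mu>)"
    using lifts_not_commuting[OF h(1) c1] lifts_not_le[OF h(1,5) cut_le] h rho by (intro killed_arr2) auto
  moreover have "killed (arr m n \<rho> \<nu> * arr m n \<nu> \<mu>)"
    using lifts_not_commuting[OF h(1) c2] lifts_not_le[OF h(1) cd(3) cut_le] h cd rho' by (intro killed_arr2) auto
  ultimately show ?case by (rule killed_diff)
next
  case (commuting_mixed \<mu> P Q \<kappa> \<nu> \<rho>)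
  have P: "P \<in> DRem m n \<mu>" and Q: "Q \<in> DRem m n \<mu>" and PQ: "P \<in> DRem m n \<nu>" and QP: "Q \<in> DRem m n \<kappa>"
    using commuting_mixed by (auto simp: commuting_def)
  obtain h a b where h: "h \<in> LP" "\<mu> = shape h" "P = {a..b}" "removable_at h a b" "cut h a b \<in> LP"
    "\<kappa> = shape (cut h a b)"
    using DRem_obtain[OF commuting_mixed(1) P] commuting_mixed(3) by metis
  obtain c d where cd: "Q = {c..d}" "removable_at h c d" "cut h c d \<in> LP" "\<nu> = shape (cut h c d)"
    using DRem_obtain_at[OF h(1)] Q h(2) commuting_mixed(4) by metis
  have r1: "removable_at (cut h a b) c d"
    using QP removable_atD(1)[OF cd(2)] unfolding h(6) DRem_shape[OF h(5)] cd(1) by (auto simp: Icc_eq_Icc)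
  have rho: "\<rho> = shape (cut (cut h a b) c d)"
    using commuting_mixed(5) dminus_shape[OF h(5) r1] h(6) cd(1) by simp
  have rl: "cut (cut h a b) c d \<in> LP" by (rule cut_LP[OF h(5) r1])
  have le: "cut (cut h a b) c d x \<le> cut h c d x" for x by (simp add: cut_def)
  have "killed (arr m n \<kappa> \<mu> * arr m n \<mu> \<nu>)"
    using lifts_not_le[OF h(1) cd(3) cut_le] lifts_not_le[OF h(1,5) cut_le] h(2,6) cd(4)
    by (intro killed_arr2) auto
  moreover have "killed (arr m n \<kappa> \<rho> * arr m n \<rho> \<nu>)"
    using lifts_not_le[OF h(5) rl cut_le] lifts_not_le[OF cd(3) rl le] h(6) cd(4) rho
    by (intro killed_arr2) auto
  ultimately show ?case by (rule killed_diff)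
next
  case (non_commuting \<mu> P Q \<kappa> \<nu> Q1 Q2 R)
  obtain h c d where h: "h \<in> LP" "\<mu> = shape h" "P = {c..d}" "removable_at h c d" "cut h c d \<in> LP"
    "\<kappa> = shape (cut h c d)"
    using DRem_obtain[OF non_commuting(1,2)] non_commuting(6) by metis
  obtain a b where ab: "Q = {a..b}" "removable_at h a b" "cut h a b \<in> LP" "\<nu> = shape (cut h a b)"
    using DRem_obtain_at[OF h(1)] non_commuting(3,7) h(2) by metis
  have R: "R \<in> DRem m n \<kappa>" using non_commuting by blast
  obtain k where k: "k \<in> LP" "dminus m n \<kappa> R = shape k" "\<And>x. k x \<le> cut h c d x"
    using DRem_obtain_at[OF h(5)] R h(6) cut_le by metis
  have "killed (arr m n \<nu> \<mu> * arr m n \<mu> \<kappa>)"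
    using lifts_not_le[OF h(1,5) cut_le] lifts_not_le[OF h(1) ab(3) cut_le] h(2,6) ab(4)
    by (intro killed_arr2) auto
  moreover have "killed (arr m n \<nu> (dminus m n \<kappa> R) * arr m n (dminus m n \<kappa> R) \<kappa>)"
  proof (intro killed_arr2 notI)
    assume "(\<nu>, dminus m n \<kappa> R) \<in> lifts \<and> (dminus m n \<kappa> R, \<kappa>) \<in> lifts"
    then have T: "(shape (cut h a b), shape k) \<in> lifts"
      "(shape k, shape (cut h c d)) \<in> lifts" using k(2) h(6) ab(4) by auto
    obtain p q P Q where *: "k = lift (cut h a b) p q" "cut h c d = lift k P Q" "P < p" "q < Q" "p \<le> q"
      by (rule lifts_two_path[OF ab(3) k(1) h(5) T])
    have "cut h c d p = cut h a b p + 4" using fun_cong[OF *(2), of p] * by (simp add: lift_def)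
    then show False by (simp add: cut_def split: if_splits)
  next
    assume "(\<kappa>, dminus m n \<kappa> R) \<in> lifts \<and> (dminus m n \<kappa> R, \<nu>) \<in> lifts"
    then show False using lifts_not_le[OF h(5) k(1,3)] k(2) h(6) by auto
  qed
  ultimately show ?case by (rule killed_diff)
next
  case (adjacent_join \<mu> P \<kappa> Q \<rho> R)
  obtain h a b where h: "h \<in> LP" "\<mu> = shape h" "P = {a..b}" "removable_at h a b" "cut h a b \<in> LP"
    "\<kappa> = shape (cut h a b)"
    using DRem_obtain[OF adjacent_join(1,2)] adjacent_join(3) by metis
  obtain c d where cd: "Q = {c..d}" "removable_at (cut h a b) c d" "cut (cut h a b) c d \<in> LP"
    "\<rho> = shape (cut (cut h a b) c d)"
    using DRem_obtain_at[OF h(5)] adjacent_join(4,6) h(6) by metis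
  have R: "R \<in> DRem m n \<mu>" "P \<union> Q \<subseteq> R" using adjacent_join(7) by (auto simp: is_join_def)
  obtain a' b' where R': "R = {a'..b'}" "cut h a' b' \<in> LP" "dminus m n \<mu> R = shape (cut h a' b')"
    using DRem_obtain_at[OF h(1)] R(1) h(2) by metis
  have dis: "P \<inter> Q = {}" using adjacent_join(5) by (simp add: adjacent_def)
  have le: "cut h a' b' x \<le> cut (cut h a b) c d x" for x
  proof -
    have "\<not> (x \<in> {a..b} \<and> x \<in> {c..d})" using dis h(3) cd(1) by blast
    moreover have "x \<in> {a..b} \<or> x \<in> {c..d} \<Longrightarrow> x \<in> {a'..b'}" using R(2) R'(1) h(3) cd(1) by blast
    ultimately show ?thesis by (auto simp: cut_def)
  qed
  have "killed (arr m n \<rho> \<kappa> * arr m n \<kappa> \<mu>)"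
  proof (intro killed_arr2 notI)
    assume "(\<rho>, \<kappa>) \<in> lifts \<and> (\<kappa>, \<mu>) \<in> lifts"
    then have T: "(shape (cut (cut h a b) c d), shape (cut h a b)) \<in> lifts"
      "(shape (cut h a b), shape h) \<in> lifts" using h(2,6) cd(4) by auto
    show False using lifts_overlap[OF h(1,5) cd(3) T] dis h(3) cd(1) by blast
  next
    assume "(\<mu>, \<kappa>) \<in> lifts \<and> (\<kappa>, \<rho>) \<in> lifts"
    then show False using lifts_not_le[OF h(1,5) cut_le] h(2,6) by auto
  qed
  moreover have "killed (arr m n \<rho> (dminus m n \<mu> R) * arr m n (dminus m n \<mu> R) \<mu>)"
    using lifts_not_le[OF cd(3) R'(2) le] lifts_not_le[OF h(1) R'(2) cut_le] h(2) cd(4) R'(3)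
    by (intro killed_arr2) auto
  ultimately show ?case unfolding mult.assoc by (intro killed_diff killed_sign)
next
  case (adjacent_no_join \<mu> P \<kappa> Q \<rho>)
  obtain h a b where h: "h \<in> LP" "\<mu> = shape h" "P = {a..b}" "removable_at h a b" "cut h a b \<in> LP"
    "\<kappa> = shape (cut h a b)"
    using DRem_obtain[OF adjacent_no_join(1,2)] adjacent_no_join(3) by metis
  obtain c d where cd: "Q = {c..d}" "removable_at (cut h a b) c d" "cut (cut h a b) c d \<in> LP"
    "\<rho> = shape (cut (cut h a b) c d)"
    using DRem_obtain_at[OF h(5)] adjacent_no_join(4,6) h(6) by metis
  have dis: "P \<inter> Q = {}" using adjacent_no_join(5) by (simp add: adjacent_def)
  show ?case
  proof (intro killed_arr2 notI)
    assume "(\<rho>, \<kappa>) \<in> lifts \<and> (\<kappa>, \<mu>) \<in> lifts"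
    then have T: "(shape (cut (cut h a b) c d), shape (cut h a b)) \<in> lifts"
      "(shape (cut h a b), shape h) \<in> lifts" using h(2,6) cd(4) by auto
    show False using lifts_overlap[OF h(1,5) cd(3) T] dis h(3) cd(1) by blast
  next
    assume "(\<mu>, \<kappa>) \<in> lifts \<and> (\<kappa>, \<rho>) \<in> lifts"
    then show False using lifts_not_le[OF h(1,5) cut_le] h(2,6) by auto
  qed
next
  case (dual x)
  then show ?case by (simp add: killed_def)
qed

end

section \<open>Heads of graded modules\<close>

text \<open>
  The part of the module axioms on which the structure of quotients and heads depends.
\<close>

definition right_action :: "('a, 'c) ring_scheme \<Rightarrow> ('a, 'b) graded_module \<Rightarrow> bool" where
  "right_action A M \<longleftrightarrow> abelian_group M \<and>
     (\<forall>x \<in> carrier M. \<forall>a \<in> carrier A. ract M x a \<in> carrier M) \<and>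
     (\<forall>x \<in> carrier M. \<forall>y \<in> carrier M. \<forall>a \<in> carrier A.
        ract M (x \<oplus>\<^bsub>M\<^esub> y) a = ract M x a \<oplus>\<^bsub>M\<^esub> ract M y a)"

lemma right_action_closed: "right_action A M \<Longrightarrow> x \<in> carrier M \<Longrightarrow> a \<in> carrier A \<Longrightarrow> ract M x a \<in> carrier M"
  and right_action_add: "right_action A M \<Longrightarrow> x \<in> carrier M \<Longrightarrow> y \<in> carrier M \<Longrightarrow> a \<in> carrier A \<Longrightarrow>
    ract M (x \<oplus>\<^bsub>M\<^esub> y) a = ract M x a \<oplus>\<^bsub>M\<^esub> ract M y a"
  and right_action_group: "right_action A M \<Longrightarrow> abelian_group M"
  by (auto simp: right_action_def)

lemma submodule_abelian_subgroup:
  "right_action A M \<Longrightarrow> right_submodule A M N \<Longrightarrow> abelian_subgroup N M"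
  by (intro abelian_subgroupI3) (auto simp: right_submodule_def right_action_def)

lemma quotient_carrier: "carrier (quotient_module M N) = (\<lambda>x. N +>\<^bsub>M\<^esub> x) ` carrier M"
  by (auto simp: quotient_module_def A_RCOSETS_def')

lemma quotient_hcomp: "hcomp (quotient_module M N) j = (\<lambda>x. N +>\<^bsub>M\<^esub> x) ` hcomp M j"
  by (simp add: quotient_module_def)

lemma quotient_add:
  assumes "right_action A M" "right_submodule A M N" "x \<in> carrier M" "y \<in> carrier M"
  shows "(N +>\<^bsub>M\<^esub> x) \<oplus>\<^bsub>quotient_module M N\<^esub> (N +>\<^bsub>M\<^esub> y) = N +>\<^bsub>M\<^esub> (x \<oplus>\<^bsub>M\<^esub> y)"
  using abelian_subgroup.a_rcos_sum[OF submodule_abelian_subgroup[OF assms(1,2)] assms(3,4)]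
  by (simp add: quotient_module_def)

lemma quotient_eq_iff:
  assumes "right_action A M" "right_submodule A M N" "x \<in> carrier M" "y \<in> carrier M"
  shows "N +>\<^bsub>M\<^esub> x = N +>\<^bsub>M\<^esub> y \<longleftrightarrow> x \<ominus>\<^bsub>M\<^esub> y \<in> N"
proof -
  interpret abelian_subgroup N M by (rule submodule_abelian_subgroup[OF assms(1,2)])
  have "x \<ominus>\<^bsub>M\<^esub> y \<in> N \<longleftrightarrow> x \<in> N +>\<^bsub>M\<^esub> y"
    using a_rcos_module[OF assms(4,3)] by (simp add: a_minus_def)
  also have "\<dots> \<longleftrightarrow> N +>\<^bsub>M\<^esub> x = N +>\<^bsub>M\<^esub> y"
    using a_repr_independence'[of x y] a_rcos_self[OF assms(3)] assms(4) by metis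
  finally show ?thesis by blast
qed

lemma quotient_ract:
  assumes M: "right_action A M" and N: "right_submodule A M N" and x: "x \<in> carrier M" and a: "a \<in> carrier A"
  shows "ract (quotient_module M N) (N +>\<^bsub>M\<^esub> x) a = N +>\<^bsub>M\<^esub> ract M x a"
proof -
  interpret abelian_subgroup N M by (rule submodule_abelian_subgroup[OF M N])
  have *: "N +>\<^bsub>M\<^esub> ract M y a = N +>\<^bsub>M\<^esub> ract M x a" if "y \<in> N +>\<^bsub>M\<^esub> x" for y
  proof -
    obtain h where h: "h \<in> N" "y = h \<oplus>\<^bsub>M\<^esub> x" using \<open>y \<in> N +>\<^bsub>M\<^esub> x\<close> by (auto simp: a_r_coset_def')
    have hM: "h \<in> carrier M" using h(1) by (rule a_Hcarr)
    have ha: "ract M h a \<in> N" using N h(1) a by (simp add: right_submodule_def)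
    have "ract M y a = ract M h a \<oplus>\<^bsub>M\<^esub> ract M x a"
      unfolding h(2) by (rule right_action_add[OF M hM x a])
    then have "ract M y a \<in> N +>\<^bsub>M\<^esub> ract M x a" using ha by (auto simp: a_r_coset_def')
    then show ?thesis using a_repr_independence' right_action_closed[OF M x a] by metis
  qed
  have "x \<in> N +>\<^bsub>M\<^esub> x" by (rule a_rcos_self[OF x])
  then have "(\<Union>y \<in> N +>\<^bsub>M\<^esub> x. N +>\<^bsub>M\<^esub> ract M x a) = N +>\<^bsub>M\<^esub> ract M x a" by blast
  moreover have "(\<Union>y \<in> N +>\<^bsub>M\<^esub> x. N +>\<^bsub>M\<^esub> ract M y a) = (\<Union>y \<in> N +>\<^bsub>M\<^esub> x. N +>\<^bsub>M\<^esub> ract M x a)"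
    by (rule SUP_cong[OF refl *])
  ultimately show ?thesis unfolding quotient_module_def by simp
qed

lemma right_action_quotient:
  assumes M: "right_action A M" and N: "right_submodule A M N"
  shows "right_action A (quotient_module M N)"
proof -
  interpret abelian_subgroup N M by (rule submodule_abelian_subgroup[OF M N])
  let ?Q = "quotient_module M N"
  have zero: "\<zero>\<^bsub>?Q\<^esub> = N +>\<^bsub>M\<^esub> \<zero>\<^bsub>M\<^esub>"
    using a_rcos_const[OF additive_subgroup.zero_closed] by (simp add: quotient_module_def a_subset additive_subgroup_axioms)
  note qs = quotient_add[OF M N]
  have ab: "abelian_group ?Q"
  proof (rule abelian_groupI)
    fix x y assume "x \<in> carrier ?Q" "y \<in> carrier ?Q"
    then show "x \<oplus>\<^bsub>?Q\<^esub> y \<in> carrier ?Q" by (auto simp: quotient_carrier qs)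
  next
    show "\<zero>\<^bsub>?Q\<^esub> \<in> carrier ?Q" unfolding zero quotient_carrier by auto
  next
    fix x y z assume "x \<in> carrier ?Q" "y \<in> carrier ?Q" "z \<in> carrier ?Q"
    then show "x \<oplus>\<^bsub>?Q\<^esub> y \<oplus>\<^bsub>?Q\<^esub> z = x \<oplus>\<^bsub>?Q\<^esub> (y \<oplus>\<^bsub>?Q\<^esub> z)"
      by (auto simp: quotient_carrier qs a_assoc)
  next
    fix x y assume "x \<in> carrier ?Q" "y \<in> carrier ?Q"
    then show "x \<oplus>\<^bsub>?Q\<^esub> y = y \<oplus>\<^bsub>?Q\<^esub> x" by (auto simp: quotient_carrier qs a_comm)
  next
    fix x assume "x \<in> carrier ?Q"
    then show "\<zero>\<^bsub>?Q\<^esub> \<oplus>\<^bsub>?Q\<^esub> x = x" unfolding zero by (auto simp: quotient_carrier qs)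
  next
    fix x assume "x \<in> carrier ?Q"
    then obtain y where y: "y \<in> carrier M" "x = N +>\<^bsub>M\<^esub> y" by (auto simp: quotient_carrier)
    then show "\<exists>z\<in>carrier ?Q. z \<oplus>\<^bsub>?Q\<^esub> x = \<zero>\<^bsub>?Q\<^esub>"
      unfolding zero by (intro bexI[of _ "N +>\<^bsub>M\<^esub> (\<ominus>\<^bsub>M\<^esub> y)"]) (auto simp: quotient_carrier qs l_neg)
  qed
  have closed: "\<And>x a. x \<in> carrier M \<Longrightarrow> a \<in> carrier A \<Longrightarrow> ract M x a \<in> carrier M"
    by (rule right_action_closed[OF M])
  show ?thesis
    unfolding right_action_def
  proof (intro conjI ballI ab)
    fix x a assume "x \<in> carrier ?Q" "a \<in> carrier A"
    then show "ract ?Q x a \<in> carrier ?Q"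
      by (auto simp: quotient_carrier quotient_ract[OF M N] closed)
  next
    fix x y a assume "x \<in> carrier ?Q" "y \<in> carrier ?Q" "a \<in> carrier A"
    then show "ract ?Q (x \<oplus>\<^bsub>?Q\<^esub> y) a = ract ?Q x a \<oplus>\<^bsub>?Q\<^esub> ract ?Q y a"
      by (auto simp: quotient_carrier quotient_ract[OF M N] closed qs right_action_add[OF M])
  qed
qed

text \<open>
  A coordinate on a one-dimensional module concentrated in degree \<open>d\<close>, on which \<open>A\<close> acts through the
  character \<open>\<chi>\<close>. Modules with the same \<open>\<chi>\<close> and \<open>d\<close> are isomorphic, which is how the two sides of the
  final isomorphism are compared.
\<close>

definition line_coordinate ::
    "('a, 'c) ring_scheme \<Rightarrow> ('a, 'b) graded_module \<Rightarrow> ('a \<Rightarrow> 'k::field) \<Rightarrow> int \<Rightarrow> ('b \<Rightarrow> 'k) \<Rightarrow> bool" where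
  "line_coordinate A L \<chi> d \<phi> \<longleftrightarrow> bij_betw \<phi> (carrier L) UNIV \<and> (\<zero>\<^bsub>L\<^esub> \<in> carrier L \<and> \<phi> \<zero>\<^bsub>L\<^esub> = 0) \<and>
     (\<forall>x \<in> carrier L. \<forall>y \<in> carrier L. x \<oplus>\<^bsub>L\<^esub> y \<in> carrier L \<and> \<phi> (x \<oplus>\<^bsub>L\<^esub> y) = \<phi> x + \<phi> y) \<and>
     (\<forall>x \<in> carrier L. \<forall>a \<in> carrier A. ract L x a \<in> carrier L \<and> \<phi> (ract L x a) = \<phi> x * \<chi> a) \<and>
     (\<forall>j. hcomp L j \<subseteq> carrier L \<and> \<phi> ` hcomp L j = (if j = d then UNIV else {0}))"

lemma line_coordinateD:
  assumes "line_coordinate A L \<chi> d \<phi>"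
  shows "bij_betw \<phi> (carrier L) UNIV"
    and "\<zero>\<^bsub>L\<^esub> \<in> carrier L" "\<phi> \<zero>\<^bsub>L\<^esub> = 0"
    and "x \<in> carrier L \<Longrightarrow> y \<in> carrier L \<Longrightarrow> x \<oplus>\<^bsub>L\<^esub> y \<in> carrier L"
    and "x \<in> carrier L \<Longrightarrow> y \<in> carrier L \<Longrightarrow> \<phi> (x \<oplus>\<^bsub>L\<^esub> y) = \<phi> x + \<phi> y"
    and "x \<in> carrier L \<Longrightarrow> a \<in> carrier A \<Longrightarrow> ract L x a \<in> carrier L"
    and "x \<in> carrier L \<Longrightarrow> a \<in> carrier A \<Longrightarrow> \<phi> (ract L x a) = \<phi> x * \<chi> a"
    and "hcomp L j \<subseteq> carrier L" "\<phi> ` hcomp L j = (if j = d then UNIV else {0})"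
  using assms unfolding line_coordinate_def by simp_all

lemma line_coordinate_inj:
  "line_coordinate A L \<chi> d \<phi> \<Longrightarrow> x \<in> carrier L \<Longrightarrow> y \<in> carrier L \<Longrightarrow> \<phi> x = \<phi> y \<Longrightarrow> x = y"
  using line_coordinateD(1)[of A L \<chi> d \<phi>] by (auto simp: bij_betw_def inj_on_def)

lemma line_coordinate_isomorphic:
  assumes phi: "line_coordinate A L \<chi> d \<phi>" and psi: "line_coordinate A L' \<chi> d \<psi>"
  shows "graded_isomorphic A L L'"
proof -
  note \<phi> = line_coordinateD[OF phi] and \<psi> = line_coordinateD[OF psi]
  define \<psi>' where "\<psi>' = inv_into (carrier L') \<psi>"
  have \<psi>': "bij_betw \<psi>' UNIV (carrier L')" unfolding \<psi>'_def by (rule bij_betw_inv_into[OF \<psi>(1)])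
  have mem: "\<psi>' c \<in> carrier L'" for c using \<psi>' by (auto simp: bij_betw_def)
  have right: "\<psi> (\<psi>' c) = c" for c unfolding \<psi>'_def using \<psi>(1) by (simp add: bij_betw_inv_into_right)
  have left: "\<psi>' (\<psi> x) = x" if "x \<in> carrier L'" for x
    unfolding \<psi>'_def using bij_betw_inv_into_left[OF \<psi>(1) that] .
  have eq: "x = \<psi>' c" if "x \<in> carrier L'" "\<psi> x = c" for x c
    using left[OF that(1)] that(2) by simp
  show ?thesis
    unfolding graded_isomorphic_def
  proof (intro exI[of _ "\<psi>' \<circ> \<phi>"] conjI ballI allI)
    show "bij_betw (\<psi>' \<circ> \<phi>) (carrier L) (carrier L')" by (rule bij_betw_trans[OF \<phi>(1) \<psi>'])
  next
    fix x y assume xy: "x \<in> carrier L" "y \<in> carrier L"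
    have "\<psi>' (\<phi> (x \<oplus>\<^bsub>L\<^esub> y)) = \<psi>' (\<phi> x) \<oplus>\<^bsub>L'\<^esub> \<psi>' (\<phi> y)"
      by (rule sym[OF eq[OF \<psi>(4)[OF mem mem]]]) (simp add: \<psi>(5)[OF mem mem] right \<phi>(5)[OF xy])
    then show "(\<psi>' \<circ> \<phi>) (x \<oplus>\<^bsub>L\<^esub> y) = (\<psi>' \<circ> \<phi>) x \<oplus>\<^bsub>L'\<^esub> (\<psi>' \<circ> \<phi>) y" by simp
  next
    fix x a assume xa: "x \<in> carrier L" "a \<in> carrier A"
    have "\<psi>' (\<phi> (ract L x a)) = ract L' (\<psi>' (\<phi> x)) a"
      by (rule sym[OF eq[OF \<psi>(6)[OF mem xa(2)]]]) (simp add: \<psi>(7)[OF mem xa(2)] right \<phi>(7)[OF xa])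
    then show "(\<psi>' \<circ> \<phi>) (ract L x a) = ract L' ((\<psi>' \<circ> \<phi>) x) a" by simp
  next
    fix j
    have "\<psi>' ` (\<psi> ` hcomp L' j) = (\<lambda>x. x) ` hcomp L' j"
      unfolding image_image using \<psi>(8)[of j] left by (intro image_cong) auto
    moreover have "\<phi> ` hcomp L j = \<psi> ` hcomp L' j" by (simp only: \<phi>(9) \<psi>(9))
    ultimately show "(\<psi>' \<circ> \<phi>) ` hcomp L j = hcomp L' j" by (simp only: image_comp[symmetric] image_ident)
  qed
qed

lemma line_coordinate_simple:
  fixes \<phi> :: "'b \<Rightarrow> 'k::field"
  assumes phi: "line_coordinate A L \<chi> d \<phi>" and \<chi>: "\<chi> ` carrier A = UNIV"
  shows "simple_module A L"
proof -
  note \<phi> = line_coordinateD[OF phi] and inj = line_coordinate_inj[OF phi]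
  have "carrier L \<noteq> {\<zero>\<^bsub>L\<^esub>}"
  proof
    assume "carrier L = {\<zero>\<^bsub>L\<^esub>}"
    then have "UNIV = {0 :: 'k}" using \<phi>(1,3) by (auto simp: bij_betw_def)
    then show False by (metis UNIV_I singletonD zero_neq_one)
  qed
  moreover have "N = {\<zero>\<^bsub>L\<^esub>} \<or> N = carrier L" if N: "right_submodule A L N" for N
  proof -
    have sg: "subgroup N (add_monoid L)"
      using N additive_subgroup.a_subgroup by (auto simp: right_submodule_def)
    have sub: "N \<subseteq> carrier L" and z: "\<zero>\<^bsub>L\<^esub> \<in> N"
      using subgroup.subset[OF sg] subgroup.one_closed[OF sg] by auto
    show ?thesis
    proof (cases "\<exists>x\<in>N. \<phi> x \<noteq> 0")
      case False
      have "x = \<zero>\<^bsub>L\<^esub>" if "x \<in> N" for x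
      proof (rule inj[OF _ \<phi>(2)])
        show "x \<in> carrier L" using sub that by blast
        show "\<phi> x = \<phi> \<zero>\<^bsub>L\<^esub>" using False that by (simp add: \<phi>(3))
      qed
      then have "N \<subseteq> {\<zero>\<^bsub>L\<^esub>}" by blast
      then show ?thesis using z by blast
    next
      case True
      then obtain x where x: "x \<in> N" "\<phi> x \<noteq> 0" by blast
      have "y \<in> N" if y: "y \<in> carrier L" for y
      proof -
        obtain a where a: "a \<in> carrier A" "\<chi> a = \<phi> y / \<phi> x" using \<chi> by (metis UNIV_I imageE)
        have "ract L x a \<in> carrier L" "\<phi> (ract L x a) = \<phi> y"
          using \<phi>(6)[OF subsetD[OF sub x(1)] a(1)] \<phi>(7)[OF subsetD[OF sub x(1)] a(1)] x(2) a(2) by simp_all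
        then have "y = ract L x a" by (intro inj[OF y]) simp_all
        then show ?thesis using N x(1) a(1) by (simp add: right_submodule_def)
      qed
      then show ?thesis using sub by blast
    qed
  qed
  ultimately show ?thesis by (simp add: simple_module_def)
qed

text \<open>
  By the generation hypothesis every proper submodule lies in the kernel of \<open>\<psi>\<close>, which is itself a
  proper submodule. So this kernel is the only maximal submodule, and \<open>\<psi>\<close> descends to a coordinate on
  the head.
\<close>

lemma head_line_module:
  fixes \<psi> :: "'b \<Rightarrow> 'k::field"
  assumes M: "right_action A M"
    and add: "\<And>x y. x \<in> carrier M \<Longrightarrow> y \<in> carrier M \<Longrightarrow> \<psi> (x \<oplus>\<^bsub>M\<^esub> y) = \<psi> x + \<psi> y"
    and act: "\<And>x a. x \<in> carrier M \<Longrightarrow> a \<in> carrier A \<Longrightarrow> \<psi> (ract M x a) = \<psi> x * \<chi> a"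
    and surj: "\<psi> ` carrier M = UNIV"
    and gen: "\<And>N x. right_submodule A M N \<Longrightarrow> x \<in> N \<Longrightarrow> \<psi> x \<noteq> 0 \<Longrightarrow> N = carrier M"
    and hc: "\<And>j. hcomp M j \<subseteq> carrier M" "\<And>j. \<psi> ` hcomp M j = (if j = d then UNIV else {0})"
  shows "\<exists>\<phi>. line_coordinate A (module_head A M) \<chi> d \<phi>"
proof -
  interpret M: abelian_group M by (rule right_action_group[OF M])
  define Z where "Z = {x \<in> carrier M. \<psi> x = 0}"
  have z0: "\<psi> \<zero>\<^bsub>M\<^esub> = 0" 
    using add[OF M.zero_closed M.zero_closed] unfolding M.l_zero[OF M.zero_closed]
    by (simp only: add_cancel_right_right)
  have neg: "\<psi> (\<ominus>\<^bsub>M\<^esub> x) = - \<psi> x" if "x \<in> carrier M" for x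
    using add[of x "\<ominus>\<^bsub>M\<^esub> x"] that z0 by (simp add: M.r_neg eq_neg_iff_add_eq_0 add.commute)
  have Zsub: "right_submodule A M Z"
    unfolding right_submodule_def
  proof (intro conjI ballI)
    show "additive_subgroup Z M"
      by (rule additive_subgroup.intro, rule group.subgroupI[OF M.a_group])
        (auto simp: Z_def z0 add neg simp flip: a_inv_def intro!: exI[of _ "\<zero>\<^bsub>M\<^esub>"])
    show "ract M x a \<in> Z" if "x \<in> Z" "a \<in> carrier A" for x a
      using that act right_action_closed[OF M] by (simp add: Z_def)
  qed
  have ssub: "N \<subseteq> carrier M" if "right_submodule A M N" for N
    using that additive_subgroup.a_subset by (auto simp: right_submodule_def)
  have proper: "N \<subseteq> Z" if "right_submodule A M N" "N \<noteq> carrier M" for N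
    using gen[OF that(1)] that ssub[OF that(1)] by (auto simp: Z_def)
  have Zne: "Z \<noteq> carrier M"
  proof
    assume "Z = carrier M"
    obtain x where x: "x \<in> carrier M" "\<psi> x = 1" using surj by (metis UNIV_I imageE)
    have "x \<in> Z" unfolding \<open>Z = carrier M\<close> by (rule x(1))
    then show False using x(2) by (simp add: Z_def)
  qed
  have "maximal_submodule A M N \<longleftrightarrow> N = Z" for N
    unfolding maximal_submodule_def using Zsub Zne proper by blast
  then have rad: "mod_radical A M = Z" by (auto simp: mod_radical_def Z_def)
  let ?L = "quotient_module M Z"
  have L: "right_action A ?L" by (rule right_action_quotient[OF M Zsub])
  have minus: "\<psi> (x \<ominus>\<^bsub>M\<^esub> y) = \<psi> x - \<psi> y" if "x \<in> carrier M" "y \<in> carrier M" for x y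
    using that by (simp add: a_minus_def add neg)
  have eq: "Z +>\<^bsub>M\<^esub> x = Z +>\<^bsub>M\<^esub> y \<longleftrightarrow> \<psi> x = \<psi> y" if "x \<in> carrier M" "y \<in> carrier M" for x y
    unfolding quotient_eq_iff[OF M Zsub that] using that minus by (auto simp: Z_def)
  define \<phi> where "\<phi> X = (THE c. \<exists>x \<in> carrier M. X = Z +>\<^bsub>M\<^esub> x \<and> c = \<psi> x)" for X
  have \<phi>: "\<phi> (Z +>\<^bsub>M\<^esub> x) = \<psi> x" if "x \<in> carrier M" for x
    unfolding \<phi>_def using that eq by (intro the_equality) blast+
  have zero: "\<zero>\<^bsub>?L\<^esub> = Z +>\<^bsub>M\<^esub> \<zero>\<^bsub>M\<^esub>"
  proof -
    interpret abelian_subgroup Z M by (rule submodule_abelian_subgroup[OF M Zsub])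
    show ?thesis using a_rcos_const[OF additive_subgroup.zero_closed]
      by (simp add: quotient_module_def a_subset additive_subgroup_axioms)
  qed
  have bij: "bij_betw \<phi> (carrier ?L) UNIV"
    unfolding bij_betw_def quotient_carrier
  proof
    show "inj_on \<phi> ((\<lambda>x. Z +>\<^bsub>M\<^esub> x) ` carrier M)"
    proof (rule inj_onI, clarify)
      fix x y assume xy: "x \<in> carrier M" "y \<in> carrier M" and "\<phi> (Z +>\<^bsub>M\<^esub> x) = \<phi> (Z +>\<^bsub>M\<^esub> y)"
      then show "Z +>\<^bsub>M\<^esub> x = Z +>\<^bsub>M\<^esub> y" by (simp only: eq[OF xy] \<phi>)
    qed
    show "\<phi> ` (\<lambda>x. Z +>\<^bsub>M\<^esub> x) ` carrier M = UNIV" using surj by (auto simp: image_image \<phi>)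
  qed
  have "line_coordinate A ?L \<chi> d \<phi>"
    unfolding line_coordinate_def
  proof (intro conjI ballI allI bij)
    show "\<zero>\<^bsub>?L\<^esub> \<in> carrier ?L" "\<phi> \<zero>\<^bsub>?L\<^esub> = 0" unfolding zero by (auto simp: quotient_carrier \<phi> z0)
  next
    fix x y assume *: "x \<in> carrier ?L" "y \<in> carrier ?L"
    show "x \<oplus>\<^bsub>?L\<^esub> y \<in> carrier ?L" "\<phi> (x \<oplus>\<^bsub>?L\<^esub> y) = \<phi> x + \<phi> y"
      using * by (auto simp: quotient_carrier quotient_add[OF M Zsub] \<phi> add)
  next
    fix x a assume *: "x \<in> carrier ?L" "a \<in> carrier A"
    show "ract ?L x a \<in> carrier ?L" "\<phi> (ract ?L x a) = \<phi> x * \<chi> a"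
      using * by (auto simp: quotient_carrier quotient_ract[OF M Zsub] \<phi> act right_action_closed[OF M])
  next
    fix j
    show "hcomp ?L j \<subseteq> carrier ?L" using hc(1)[of j] by (auto simp: quotient_hcomp quotient_carrier)
    have "\<phi> ` hcomp ?L j = \<psi> ` hcomp M j"
      unfolding quotient_hcomp image_image using hc(1)[of j] \<phi> by (intro image_cong) auto
    then show "\<phi> ` hcomp ?L j = (if j = d then UNIV else {0})" using hc(2) by simp
  qed
  then show ?thesis unfolding module_head_def rad by blast
qed

lemma line_coordinate_shift:
  assumes "line_coordinate A L \<chi> d \<phi>"
  shows "line_coordinate A (shift_module L k) \<chi> (d - k) \<phi>"
proof -
  have "j + k = d \<longleftrightarrow> j = d - k" for j by auto
  then show ?thesis using assms unfolding line_coordinate_def shift_module_def by simp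
qed

lemma line_coordinate_corner:
  assumes phi: "line_coordinate A L \<chi> d \<phi>" and e: "e \<in> carrier A" "\<chi> e = 1" and B: "carrier B \<subseteq> carrier A"
  shows "line_coordinate B (corner_module L e) \<chi> d \<phi>"
proof -
  note \<phi> = line_coordinateD[OF phi]
  have fixed: "ract L x e = x" if "x \<in> carrier L" for x
    by (rule line_coordinate_inj[OF phi \<phi>(6)[OF that e(1)] that]) (simp add: \<phi>(7)[OF that e(1)] e(2))
  have car: "{ract L x e | x. x \<in> carrier L} = carrier L"
  proof (intro equalityI subsetI)
    fix y assume "y \<in> {ract L x e | x. x \<in> carrier L}"
    then show "y \<in> carrier L" using fixed by auto
  next
    fix y assume "y \<in> carrier L"
    then show "y \<in> {ract L x e | x. x \<in> carrier L}" using fixed[of y] by force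
  qed
  have hc: "hcomp L j \<inter> carrier L = hcomp L j" for j using \<phi>(8)[of j] by blast
  show ?thesis
    using phi B unfolding line_coordinate_def corner_module_def restrict_module_def car
    by (simp add: hc subset_iff)
qed

lemma additive_subgroup_of_closed:
  assumes "abelian_group M" "N \<subseteq> carrier M" "\<zero>\<^bsub>M\<^esub> \<in> N" "\<And>x y. x \<in> N \<Longrightarrow> y \<in> N \<Longrightarrow> x \<oplus>\<^bsub>M\<^esub> y \<in> N"
    "\<And>x. x \<in> N \<Longrightarrow> \<exists>y\<in>N. y \<oplus>\<^bsub>M\<^esub> x = \<zero>\<^bsub>M\<^esub>"
  shows "additive_subgroup N M"
proof -
  interpret M: abelian_group M by fact
  have neg: "\<ominus>\<^bsub>M\<^esub> x \<in> N" if x: "x \<in> N" for x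
  proof -
    obtain y where y: "y \<in> N" "y \<oplus>\<^bsub>M\<^esub> x = \<zero>\<^bsub>M\<^esub>" using assms(5)[OF x] by blast
    then have "\<ominus>\<^bsub>M\<^esub> x = y" using x assms(2) by (intro M.minus_equality) auto
    then show ?thesis using y by simp
  qed
  show ?thesis
    by (rule additive_subgroup.intro, rule group.subgroupI[OF M.a_group])
      (use assms neg in \<open>auto simp flip: a_inv_def\<close>)
qed

lemma right_action_restrict:
  assumes M: "right_action A M" and B: "carrier B \<subseteq> carrier A" and N: "right_submodule B M N"
  shows "right_action B (restrict_module M N)"
proof -
  interpret M: abelian_group M by (rule right_action_group[OF M])
  have N': "additive_subgroup N M" and act: "\<And>x a. x \<in> N \<Longrightarrow> a \<in> carrier B \<Longrightarrow> ract M x a \<in> N"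
    using N by (auto simp: right_submodule_def)
  interpret N: additive_subgroup N M by fact
  have "abelian_group (restrict_module M N)"
  proof (rule abelian_groupI)
    fix x assume x: "x \<in> carrier (restrict_module M N)"
    then show "\<exists>y\<in>carrier (restrict_module M N). y \<oplus>\<^bsub>restrict_module M N\<^esub> x = \<zero>\<^bsub>restrict_module M N\<^esub>"
      using M.l_neg[of x] N.a_inv_closed[of x] N.a_subset
      by (intro bexI[of _ "\<ominus>\<^bsub>M\<^esub> x"]) (auto simp: restrict_module_def)
  qed (use N.a_subset in \<open>auto simp: restrict_module_def M.a_ac subset_iff\<close>)
  moreover have "\<And>x. x \<in> N \<Longrightarrow> x \<in> carrier M" using N.a_subset by blast
  ultimately show ?thesis
    using act B right_action_add[OF M] by (auto simp: right_action_def restrict_module_def subset_iff)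
qed

context arc_rectangle begin

abbreviation KA :: "'k arc_elem ring" where "KA \<equiv> arc_algebra m n"

section \<open>Standard modules\<close>

lemma transition_mult_in:
  assumes "W \<subseteq> Pmn m n" "\<kappa> \<in> W" "\<And>\<rho> \<mu>. (\<rho>, \<mu>) \<in> lifts \<Longrightarrow> \<rho> \<in> W \<Longrightarrow> \<mu> \<in> W"
  shows "tr \<kappa> \<mu> (f * g) = (\<Sum>\<nu>\<in>W. tr \<kappa> \<nu> f * tr \<nu> \<mu> g)"
  by (rule transition_mult[OF finite_subset[OF assms(1) finite_Pmn] assms(2,3)])

lemma FA_minus: "x \<in> carrier FA \<Longrightarrow> \<ominus>\<^bsub>FA\<^esub> x = - x"
  using abelian_group.minus_equality[OF ring.is_abelian_group[OF ring_FA], of "- x" x]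
  by (simp add: FA_ops)

text \<open>
  Once started in \<open>W\<close> the automaton stays there; therefore the elements whose matrix coefficients from
  \<open>W\<close> vanish absorb products on both sides.
\<close>

lemma ideal_vanishing:
  assumes W: "W \<subseteq> Pmn m n" "\<And>\<rho> \<mu>. (\<rho>, \<mu>) \<in> lifts \<Longrightarrow> \<rho> \<in> W \<Longrightarrow> \<mu> \<in> W"
  shows "ideal (vanishing W) FA"
proof (rule idealI[OF ring_FA])
  interpret FA: ring FA by (rule ring_FA)
  show "subgroup (vanishing W) (add_monoid FA)"
  proof (rule group.subgroupI[OF FA.a_group])
    show "vanishing W \<noteq> {}" using F_zero by (force simp: vanishing_def)
  next
    fix x assume "x \<in> vanishing W"
    then show "inv\<^bsub>add_monoid FA\<^esub> x \<in> vanishing W"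
      unfolding a_inv_def[symmetric] using FA_minus[of x] by (simp add: vanishing_def transition_uminus)
  qed (auto simp: vanishing_def transition_add FA_ops)
next
  fix f x assume *: "f \<in> vanishing W" "x \<in> carrier FA"
  show "x \<otimes>\<^bsub>FA\<^esub> f \<in> vanishing W"
    using * by (simp add: vanishing_def FA_ops transition_mult_in[OF W(1) _ W(2)])
  show "f \<otimes>\<^bsub>FA\<^esub> x \<in> vanishing W"
    using * by (simp add: vanishing_def FA_ops transition_mult_in[OF W(1) _ W(2)])
qed

lemma RI_vanishing: "RI \<subseteq> vanishing (Pmn m n)"
  unfolding rel_ideal_def
proof (rule ring.genideal_minimal[OF ring_FA ideal_vanishing])
  show "relations m n \<subseteq> vanishing (Pmn m n)"
    using killed_relations relations_carrier by (force simp: vanishing_def killed_def)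
qed (use lifts_Pmn in auto)

lemma transition_RI: "f \<in> RI \<Longrightarrow> \<kappa> \<in> Pmn m n \<Longrightarrow> tr \<kappa> \<mu> f = 0"
  using RI_vanishing by (auto simp: vanishing_def)

lemma defect_lifts: assumes "(\<kappa>, \<mu>) \<in> lifts" shows "defect m \<mu> = defect m \<kappa> + 1"
  using assms
proof (rule liftsE)
  fix h a b assume *: "\<kappa> = shape h" "\<mu> = shape (lift h a b)" "h \<in> LP" "lift h a b \<in> LP"
    "lowest_arc h a b" "h a \<le> int m"
  obtain A B where AB: "lowest_arc (lift h a b) A B" by (rule lowest_arc_exists[OF *(4)])
  show ?thesis
    using defect_shape[OF *(3,5)] defect_shape[OF *(4) AB]
      lowest_arc_lift(1)[OF *(3,5,6) m_le_n AB] *(1,2) by simp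
qed

text \<open>
  Every lift raises the defect by one and is an arrow of degree one, so the degree of an accepted word
  is determined by its end points.
\<close>

lemma run_degree:
  "run lifts \<kappa> w = Some \<mu> \<Longrightarrow> int (sum_list (map generator_degree w)) = defect m \<mu> - defect m \<kappa>"
proof (induction w arbitrary: \<kappa>)
  case (Cons g w)
  show ?case
  proof (cases g)
    case (ArrGen \<rho> \<nu>)
    then have "\<kappa> = \<rho>" "(\<rho>, \<nu>) \<in> lifts" "run lifts \<nu> w = Some \<mu>" using Cons.prems by (auto split: if_splits)
    then show ?thesis using Cons.IH[of \<nu>] defect_lifts[of \<rho> \<nu>] ArrGen by (simp add: generator_degree_def del: One_nat_def)
  qed (use Cons in \<open>auto simp: generator_degree_def split: if_splits\<close>)
qed simp

lemma transition_homogeneous: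
  assumes "\<forall>w \<in> Poly_Mapping.keys f. int (word_degree w) = j" "j \<noteq> defect m \<mu> - defect m \<kappa>"
  shows "tr \<kappa> \<mu> f = 0"
proof -
  have "run lifts \<kappa> (letters w) \<noteq> Some \<mu>" if "w \<in> Poly_Mapping.keys f" for w
    using run_degree[of \<kappa> "letters w" \<mu>] assms that by (auto simp: word_degree_def)
  then show ?thesis by (auto simp: transition_def intro: sum.neutral)
qed

definition cls :: "'k free_elem \<Rightarrow> 'k arc_elem" where
  "cls f = arc_class m n f"

lemma cls_hom: "cls \<in> ring_hom FA KA"
  using ideal.rcos_ring_hom[OF ideal_RI] unfolding cls_def arc_class_def arc_algebra_def by (simp add: eta_contract_eq)

lemma KA_carrier: "carrier KA = cls ` carrier FA"
  unfolding arc_algebra_def cls_def arc_class_def by (auto simp: FactRing_def A_RCOSETS_def')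

lemma cls_mult: "f \<in> carrier FA \<Longrightarrow> g \<in> carrier FA \<Longrightarrow> cls f \<otimes>\<^bsub>KA\<^esub> cls g = cls (f * g)"
  and cls_add: "f \<in> carrier FA \<Longrightarrow> g \<in> carrier FA \<Longrightarrow> cls f \<oplus>\<^bsub>KA\<^esub> cls g = cls (f + g)"
  using ring_hom_mult[OF cls_hom, of f g] ring_hom_add[OF cls_hom, of f g] by (simp_all add: FA_ops)

lemma cls_set: "cls f = (\<lambda>h. h + f) ` RI"
  unfolding cls_def arc_class_def a_r_coset_def' by (auto simp: FA_ops)

lemma cls_zero: "\<zero>\<^bsub>KA\<^esub> = cls 0"
  unfolding cls_set by (simp add: arc_algebra_def FactRing_def)

lemma cls_eq_iff: "cls f = cls g \<longleftrightarrow> f - g \<in> RI"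
proof
  assume "cls f = cls g"
  moreover have "f \<in> cls f" unfolding cls_set by (rule image_eqI[of _ _ 0]) simp_all
  ultimately obtain x where "x \<in> RI" "f = x + g" unfolding cls_set by blast
  then show "f - g \<in> RI" by simp
next
  assume *: "f - g \<in> RI"
  show "cls f = cls g"
  proof (intro equalityI subsetI)
    fix y assume "y \<in> cls f"
    then obtain x where x: "x \<in> RI" "y = x + f" unfolding cls_set by blast
    then have "y = (x + (f - g)) + g" by simp
    then show "y \<in> cls g" unfolding cls_set using RI_add[OF x(1) *] by (rule image_eqI)
  next
    fix y assume "y \<in> cls g"
    then obtain x where x: "x \<in> RI" "y = x + g" unfolding cls_set by blast
    then have "y = (x + (g - f)) + f" by simp
    then show "y \<in> cls f" unfolding cls_set using RI_add[OF x(1) RI_sym[OF *]] by (rule image_eqI)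
  qed
qed

lemma ring_KA: "ring KA" by (rule ring_arc_algebra)

definition idem_below :: "(int \<Rightarrow> int) \<Rightarrow> 'k free_elem" where
  "idem_below h = (\<Sum>\<mu> | \<mu> \<in> Pmn m n \<and> \<mu> \<subset> shape h. idem \<mu>)"

text \<open>
  The preimage in the free algebra of the two-sided ideal generated by the idempotents of smaller
  partitions.
\<close>

definition low_ideal :: "(int \<Rightarrow> int) \<Rightarrow> 'k free_elem set" where
  "low_ideal h = {f \<in> carrier FA. cls f \<in> genideal KA {cls (idem_below h)}}"

lemma F_idem_below: "idem_below h \<in> carrier FA"
  unfolding idem_below_def by (rule F_sum) auto

lemma idem_below_carrier: "{cls (idem_below h)} \<subseteq> carrier KA"
  unfolding KA_carrier using F_idem_below by blast

lemma genideal_KA: "ideal (genideal KA {cls (idem_below h)}) KA"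
  by (rule ring.genideal_ideal[OF ring_KA idem_below_carrier])

lemma low_ideal_F: "f \<in> low_ideal h \<Longrightarrow> f \<in> carrier FA"
  by (simp add: low_ideal_def)

lemma low_ideal_add: "f \<in> low_ideal h \<Longrightarrow> g \<in> low_ideal h \<Longrightarrow> f + g \<in> low_ideal h"
  using additive_subgroup.a_closed[OF ideal.axioms(1)[OF genideal_KA]]
  by (simp add: low_ideal_def flip: cls_add)

lemma low_ideal_left: "x \<in> carrier FA \<Longrightarrow> f \<in> low_ideal h \<Longrightarrow> x * f \<in> low_ideal h"
  using ideal.I_l_closed[OF genideal_KA] by (simp add: low_ideal_def KA_carrier flip: cls_mult)

lemma low_ideal_right: "f \<in> low_ideal h \<Longrightarrow> x \<in> carrier FA \<Longrightarrow> f * x \<in> low_ideal h"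
  using ideal.I_r_closed[OF genideal_KA] by (simp add: low_ideal_def KA_carrier flip: cls_mult)

lemma low_ideal_uminus: "f \<in> low_ideal h \<Longrightarrow> - f \<in> low_ideal h"
  using low_ideal_left[of "- 1" f h] by simp

lemma low_ideal_diff: "f \<in> low_ideal h \<Longrightarrow> g \<in> low_ideal h \<Longrightarrow> f - g \<in> low_ideal h"
  using low_ideal_add[of f h "- g"] low_ideal_uminus[of g h] by simp

lemma RI_low_ideal: "f \<in> RI \<Longrightarrow> f \<in> low_ideal h"
proof -
  assume f: "f \<in> RI"
  then have "cls f = \<zero>\<^bsub>KA\<^esub>" unfolding cls_zero cls_eq_iff by simp
  then show ?thesis
    using additive_subgroup.zero_closed[OF ideal.axioms(1)[OF genideal_KA]] RI_sub[OF f]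
    by (simp add: low_ideal_def)
qed

lemma low_ideal_cong: "f - g \<in> RI \<Longrightarrow> g \<in> low_ideal h \<Longrightarrow> f \<in> low_ideal h"
  using low_ideal_add[of "f - g" h g] RI_low_ideal[of "f - g" h] by simp

lemma RI_sum: "(\<And>x. x \<in> A \<Longrightarrow> f x \<in> RI) \<Longrightarrow> sum f A \<in> RI"
  by (induction A rule: infinite_finite_induct) auto

lemma idem_mult_sum:
  assumes A: "A \<subseteq> Pmn m n" and g: "g \<in> LP"
  shows "E g * (\<Sum>\<mu>\<in>A. idem \<mu>) - (if shape g \<in> A then E g else 0) \<in> RI"
    and "(\<Sum>\<mu>\<in>A. idem \<mu>) * E g - (if shape g \<in> A then E g else 0) \<in> RI"
proof -
  have fin: "finite A" using A finite_Pmn finite_subset by blast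
  have delta: "(\<Sum>\<mu>\<in>A. if shape g = \<mu> then E g else 0) = (if shape g \<in> A then E g else 0)"
    using fin by simp
  have "(\<Sum>\<mu>\<in>A. E g * idem \<mu> - (if shape g = \<mu> then E g else 0)) \<in> RI"
  proof (rule RI_sum)
    fix \<mu> assume "\<mu> \<in> A"
    then have "\<mu> \<in> Pmn m n" using A by blast
    from RI_relation[OF relations.idempotent[OF shape_Pmn[OF g] this]]
    show "E g * idem \<mu> - (if shape g = \<mu> then E g else 0) \<in> RI"
      by (cases "shape g = \<mu>") (auto simp: E_def)
  qed
  then show "E g * (\<Sum>\<mu>\<in>A. idem \<mu>) - (if shape g \<in> A then E g else 0) \<in> RI"
    by (simp add: sum_subtractf sum_distrib_left delta)
  have "(\<Sum>\<mu>\<in>A. idem \<mu> * E g - (if shape g = \<mu> then E g else 0)) \<in> RI"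
  proof (rule RI_sum)
    fix \<mu> assume "\<mu> \<in> A"
    then have "\<mu> \<in> Pmn m n" using A by blast
    from RI_relation[OF relations.idempotent[OF this shape_Pmn[OF g]]]
    show "idem \<mu> * E g - (if shape g = \<mu> then E g else 0) \<in> RI"
      by (cases "shape g = \<mu>") (auto simp: E_def)
  qed
  then show "(\<Sum>\<mu>\<in>A. idem \<mu>) * E g - (if shape g \<in> A then E g else 0) \<in> RI"
    by (simp add: sum_subtractf sum_distrib_right delta)
qed

lemma E_low_ideal:
  assumes h: "h \<in> LP" and g: "g \<in> LP" "\<And>z. g z \<le> h z" "g \<noteq> h"
  shows "E g \<in> low_ideal h"
proof -
  have "shape g \<subset> shape h"
    using shape_subset_iff[OF g(1) h] shape_eq_iff[OF g(1) h] g(2,3) by blast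
  then have mem: "shape g \<in> {\<mu>. \<mu> \<in> Pmn m n \<and> \<mu> \<subset> shape h}" using shape_Pmn[OF g(1)] by blast
  have c1: "E g * idem_below h - E g \<in> RI"
    using idem_mult_sum(1)[OF _ g(1), of "{\<mu>. \<mu> \<in> Pmn m n \<and> \<mu> \<subset> shape h}"] mem
    unfolding idem_below_def by auto
  have c2: "idem_below h \<in> low_ideal h"
    using F_idem_below ring.genideal_self'[OF ring_KA] idem_below_carrier by (simp add: low_ideal_def)
  show ?thesis by (rule low_ideal_cong[OF RI_sym[OF c1] low_ideal_left[OF F_E[OF g(1)] c2]])
qed

lemma rspan_low_ideal:
  assumes h: "h \<in> LP" and f: "f \<in> rspan (low h)"
  shows "f \<in> low_ideal h"
  using f
proof (induction rule: rspan_induct)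
  case (base f)
  then obtain x g y where *: "f = E h * x * E g * y" "x \<in> carrier FA" "y \<in> carrier FA"
    "g \<in> LP" "\<And>z. g z \<le> h z" "g \<noteq> h" unfolding low_def by blast
  show ?case unfolding *(1)
    by (intro low_ideal_right[OF low_ideal_left[OF _ E_low_ideal[OF h *(4-6)]]] F_mult F_E h *(2,3))
next
  case zero
  show ?case by (rule RI_low_ideal) simp
qed (auto intro: RI_low_ideal low_ideal_add low_ideal_left)

text \<open>
  Lifts only add tiles. So from a partition not below \<open>h\<close> the automaton never reaches the idempotents
  that generate the ideal.
\<close>

lemma low_ideal_vanishing:
  assumes "f \<in> low_ideal h" "\<kappa> \<in> Pmn m n" "\<not> \<kappa> \<subset> shape h"
  shows "tr \<kappa> \<mu> f = 0"
proof -
  define W where "W = {\<kappa> \<in> Pmn m n. \<not> \<kappa> \<subset> shape h}"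
  have W: "W \<subseteq> Pmn m n" by (auto simp: W_def)
  have closed: "\<mu> \<in> W" if "(\<rho>, \<mu>) \<in> lifts" "\<rho> \<in> W" for \<rho> \<mu>
  proof -
    have "\<rho> \<subseteq> \<mu>" using that(1)
    proof (rule liftsE)
      fix h a b assume *: "\<rho> = shape h" "\<mu> = shape (lift h a b)" "h \<in> LP" "lift h a b \<in> LP"
      show ?thesis unfolding *(1,2) shape_subset_iff[OF *(3,4)] by (simp add: lift_def)
    qed
    then show ?thesis using that(2) lifts_Pmn[OF that(1)] by (auto simp: W_def)
  qed
  have id: "ideal (vanishing W) FA" by (rule ideal_vanishing[OF W closed])
  have "ideal (cls ` vanishing W) KA"
    using ring.ring_ideal_imp_quot_ideal[OF ring_FA ideal_RI id]
    unfolding cls_def arc_class_def arc_algebra_def .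
  moreover have "idem_below h \<in> vanishing W"
    unfolding vanishing_def
  proof (intro CollectI conjI ballI allI F_idem_below)
    fix \<kappa> \<mu> assume "\<kappa> \<in> W"
    then have "tr \<kappa> \<mu> (idem \<nu> :: 'k free_elem) = 0" if "\<nu> \<subset> shape h" for \<nu>
      using that by (auto simp: idem_def transition_single W_def)
    then show "tr \<kappa> \<mu> (idem_below h) = 0"
      unfolding idem_below_def transition_sum by (intro sum.neutral) auto
  qed
  ultimately have "genideal KA {cls (idem_below h)} \<subseteq> cls ` vanishing W"
    by (intro ring.genideal_minimal[OF ring_KA]) auto
  then obtain f' where f': "f' \<in> vanishing W" "cls f = cls f'" using assms(1) by (auto simp: low_ideal_def)
  then have "f - f' \<in> RI" by (simp add: cls_eq_iff)
  then have "tr \<kappa> \<mu> (f - f') = 0" using transition_RI assms(2) by blast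
  moreover have "tr \<kappa> \<mu> f' = 0" using f'(1) assms(2,3) by (auto simp: vanishing_def W_def)
  ultimately show ?thesis by (simp add: transition_diff)
qed

lemma right_action_regular: "right_action KA (regular_module m n)"
proof -
  interpret KA: ring KA by (rule ring_KA)
  have "abelian_group (regular_module m n :: ('k arc_elem, 'k arc_elem) graded_module)"
    by (rule abelian_groupI) (auto simp: regular_module_def KA.a_ac intro: KA.l_neg)
  then show ?thesis by (auto simp: right_action_def regular_module_def KA.l_distr)
qed

text \<open>
  The submodules that define the standard module, parametrised by elements of the free algebra. The
  same is done for the standard module itself in \<open>std_cls\<close>.
\<close>

definition proj_cls :: "(int \<Rightarrow> int) \<Rightarrow> 'k arc_elem set" where
  "proj_cls h = (\<lambda>f. cls (E h * f)) ` carrier FA"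

lemma proj_module_eq: assumes "h \<in> LP"
  shows "proj_module m n (shape h) = restrict_module (regular_module m n) (proj_cls h)"
proof -
  have "{cls (E h) \<otimes>\<^bsub>KA\<^esub> x | x. x \<in> carrier KA} = (\<lambda>f. cls (E h) \<otimes>\<^bsub>KA\<^esub> cls f) ` carrier FA"
    unfolding KA_carrier by blast
  also have "\<dots> = proj_cls h"
    unfolding proj_cls_def using assms by (intro image_cong) (auto simp: cls_mult)
  finally show ?thesis by (simp add: proj_module_def cls_def E_def)
qed

definition low_cls :: "(int \<Rightarrow> int) \<Rightarrow> 'k arc_elem set" where
  "low_cls h = (\<lambda>f. cls (E h * f)) ` low_ideal h"

lemma lower_submodule_eq: assumes "h \<in> LP"
  shows "lower_submodule m n (shape h) = low_cls h"
proof -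
  let ?G = "genideal KA {cls (idem_below h)}"
  have G: "?G = cls ` low_ideal h"
    using additive_subgroup.a_subset[OF ideal.axioms(1)[OF genideal_KA[of h]]]
    unfolding low_ideal_def KA_carrier by blast
  have "lower_submodule m n (shape h) = {cls (E h) \<otimes>\<^bsub>KA\<^esub> x | x. x \<in> ?G}"
    unfolding lower_submodule_def idem_below_def E_def cls_def ..
  also have "\<dots> = (\<lambda>f. cls (E h) \<otimes>\<^bsub>KA\<^esub> cls f) ` low_ideal h" unfolding G by blast
  also have "\<dots> = low_cls h"
    unfolding low_cls_def using assms low_ideal_F by (intro image_cong) (auto simp: cls_mult)
  finally show ?thesis .
qed

lemma right_submodule_cls:
  assumes h: "h \<in> LP" and X: "X \<subseteq> carrier FA" "0 \<in> X" "\<And>f g. f \<in> X \<Longrightarrow> g \<in> X \<Longrightarrow> f + g \<in> X"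
    "\<And>f. f \<in> X \<Longrightarrow> - f \<in> X" "\<And>f g. f \<in> X \<Longrightarrow> g \<in> carrier FA \<Longrightarrow> f * g \<in> X"
    and M: "abelian_group M" "carrier M \<supseteq> (\<lambda>f. cls (E h * f)) ` X" "\<zero>\<^bsub>M\<^esub> = cls 0" "add M = add KA" "ract M = mult KA"
  shows "right_submodule KA M ((\<lambda>f. cls (E h * f)) ` X)"
proof -
  have F: "\<And>f. f \<in> X \<Longrightarrow> f \<in> carrier FA" using X(1) by blast
  have Eh: "\<And>f. f \<in> X \<Longrightarrow> E h * f \<in> carrier FA" using F h by auto
  have "additive_subgroup ((\<lambda>f. cls (E h * f)) ` X) M"
  proof (rule additive_subgroup_of_closed[OF M(1,2)])
    show "\<zero>\<^bsub>M\<^esub> \<in> (\<lambda>f. cls (E h * f)) ` X" unfolding M(3) using X(2) by (intro image_eqI[of _ _ 0]) auto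
  next
    fix x y assume "x \<in> (\<lambda>f. cls (E h * f)) ` X" "y \<in> (\<lambda>f. cls (E h * f)) ` X"
    then obtain f g where "f \<in> X" "g \<in> X" "x = cls (E h * f)" "y = cls (E h * g)" by blast
    then show "x \<oplus>\<^bsub>M\<^esub> y \<in> (\<lambda>f. cls (E h * f)) ` X"
      unfolding M(4) using Eh X(3) by (intro image_eqI[of _ _ "f + g"]) (auto simp: cls_add distrib_left)
  next
    fix x assume "x \<in> (\<lambda>f. cls (E h * f)) ` X"
    then obtain f where f: "f \<in> X" "x = cls (E h * f)" by blast
    have "cls (E h * (- f)) \<oplus>\<^bsub>M\<^esub> x = \<zero>\<^bsub>M\<^esub>"
      unfolding M(3,4) f(2) using Eh[OF f(1)] Eh[OF X(4)[OF f(1)]] by (simp add: cls_add)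
    then show "\<exists>y\<in>(\<lambda>f. cls (E h * f)) ` X. y \<oplus>\<^bsub>M\<^esub> x = \<zero>\<^bsub>M\<^esub>" using X(4)[OF f(1)] by blast
  qed
  moreover have "ract M x a \<in> (\<lambda>f. cls (E h * f)) ` X"
    if x: "x \<in> (\<lambda>f. cls (E h * f)) ` X" and a: "a \<in> carrier KA" for x a
  proof -
    obtain f g where fg: "f \<in> X" "x = cls (E h * f)" "g \<in> carrier FA" "a = cls g"
      using x a unfolding KA_carrier by blast
    have "ract M x a = cls (E h * (f * g))"
      unfolding M(5) fg(2,4) using Eh[OF fg(1)] fg(3) by (simp add: cls_mult mult.assoc)
    then show ?thesis using X(5)[OF fg(1,3)] by blast
  qed
  ultimately show ?thesis by (simp add: right_submodule_def)
qed

lemma right_action_proj: assumes h: "h \<in> LP"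
  shows "right_action KA (proj_module m n (shape h))"
  unfolding proj_module_eq[OF h]
proof (rule right_action_restrict[OF right_action_regular subset_refl])
  show "right_submodule KA (regular_module m n) (proj_cls h)"
    unfolding proj_cls_def using h right_action_group[OF right_action_regular]
    by (intro right_submodule_cls) (auto simp: regular_module_def cls_zero KA_carrier)
qed

lemma right_submodule_low: assumes h: "h \<in> LP"
  shows "right_submodule KA (proj_module m n (shape h)) (low_cls h)"
  unfolding low_cls_def
proof (rule right_submodule_cls[OF h])
  show "abelian_group (proj_module m n (shape h) :: ('k arc_elem, 'k arc_elem) graded_module)"
    by (rule right_action_group[OF right_action_proj[OF h]])
  show "0 \<in> low_ideal h" by (rule RI_low_ideal) simp
qed (auto simp: proj_module_eq[OF h] restrict_module_def regular_module_def cls_zero proj_cls_def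
      intro: low_ideal_F low_ideal_add low_ideal_uminus low_ideal_right)

definition std_cls :: "(int \<Rightarrow> int) \<Rightarrow> 'k free_elem \<Rightarrow> 'k arc_elem set" where
  "std_cls h f = low_cls h +>\<^bsub>proj_module m n (shape h)\<^esub> cls (E h * f)"

context fixes h assumes h: "h \<in> LP" begin

abbreviation "PM \<equiv> proj_module m n (shape h) :: ('k arc_elem, 'k arc_elem) graded_module"
abbreviation "DM \<equiv> Delta_module m n (shape h) :: ('k arc_elem, 'k arc_elem set) graded_module"

lemma DM_eq: "DM = quotient_module PM (low_cls h)"
  by (simp add: Delta_module_def lower_submodule_eq[OF h])

lemma right_action_DM: "right_action KA DM"
  unfolding DM_eq by (rule right_action_quotient[OF right_action_proj[OF h] right_submodule_low[OF h]])

lemma PM_carrier: "carrier PM = proj_cls h"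
  by (simp add: proj_module_eq[OF h] restrict_module_def)

lemma PM_mem: "f \<in> carrier FA \<Longrightarrow> cls (E h * f) \<in> carrier PM"
  by (auto simp: PM_carrier proj_cls_def)

lemma PM_ops: "add PM = add KA" "ract PM = mult KA" "\<zero>\<^bsub>PM\<^esub> = cls 0" "hcomp PM j = arc_hcomp m n j \<inter> proj_cls h"
  by (simp_all add: proj_module_eq[OF h] restrict_module_def regular_module_def cls_zero)

lemma DM_carrier: "carrier DM = std_cls h ` carrier FA"
  unfolding DM_eq quotient_carrier PM_carrier proj_cls_def std_cls_def by (simp add: image_image)

lemma std_cls_add: "f \<in> carrier FA \<Longrightarrow> g \<in> carrier FA \<Longrightarrow> std_cls h f \<oplus>\<^bsub>DM\<^esub> std_cls h g = std_cls h (f + g)"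
  unfolding DM_eq std_cls_def
  by (subst quotient_add[OF right_action_proj[OF h] right_submodule_low[OF h]])
    (auto simp: PM_mem PM_ops cls_add distrib_left h)

lemma std_cls_ract: "f \<in> carrier FA \<Longrightarrow> g \<in> carrier FA \<Longrightarrow> ract DM (std_cls h f) (cls g) = std_cls h (f * g)"
  unfolding DM_eq std_cls_def
  by (subst quotient_ract[OF right_action_proj[OF h] right_submodule_low[OF h]])
    (auto simp: PM_mem PM_ops cls_mult mult.assoc h KA_carrier)

lemma std_cls_eq_iff:
  assumes "f \<in> carrier FA" "g \<in> carrier FA"
  shows "std_cls h f = std_cls h g \<longleftrightarrow> E h * (f - g) \<in> low_ideal h"
proof -
  interpret PM: abelian_group PM by (rule right_action_group[OF right_action_proj[OF h]])
  have F: "E h * f \<in> carrier FA" "E h * g \<in> carrier FA" using assms h by auto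
  have "cls (E h * (- g)) \<oplus>\<^bsub>PM\<^esub> cls (E h * g) = \<zero>\<^bsub>PM\<^esub>"
    unfolding PM_ops using F by (subst cls_add) auto
  then have neg: "\<ominus>\<^bsub>PM\<^esub> cls (E h * g) = cls (E h * (- g))"
    by (intro PM.minus_equality PM_mem F_uminus assms)
  have "cls (E h * f) \<ominus>\<^bsub>PM\<^esub> cls (E h * g) = cls (E h * (f - g))"
    unfolding a_minus_def neg PM_ops using F by (subst cls_add) (auto simp: right_diff_distrib)
  then have "std_cls h f = std_cls h g \<longleftrightarrow> cls (E h * (f - g)) \<in> low_cls h"
    unfolding std_cls_def
    by (simp only: quotient_eq_iff[OF right_action_proj[OF h] right_submodule_low[OF h] PM_mem[OF assms(1)] PM_mem[OF assms(2)]])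
  also have "\<dots> \<longleftrightarrow> E h * (f - g) \<in> low_ideal h"
  proof
    assume "cls (E h * (f - g)) \<in> low_cls h"
    then obtain x where x: "x \<in> low_ideal h" "cls (E h * (f - g)) = cls (E h * x)" unfolding low_cls_def by blast
    then show "E h * (f - g) \<in> low_ideal h"
      using low_ideal_cong[of "E h * (f - g)" "E h * x" h] low_ideal_left[OF F_E[OF h] x(1)] by (simp add: cls_eq_iff)
  next
    assume *: "E h * (f - g) \<in> low_ideal h"
    have "(E h * E h - E h) * (f - g) \<in> RI" using E_mult[OF h h] assms by (intro RI_right) auto
    then have "cls (E h * (E h * (f - g))) = cls (E h * (f - g))"
      unfolding cls_eq_iff by (simp only: left_diff_distrib mult.assoc)
    then show "cls (E h * (f - g)) \<in> low_cls h" unfolding low_cls_def using * by (metis image_eqI)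
  qed
  finally show ?thesis .
qed

lemma std_cls_cong: "f \<in> carrier FA \<Longrightarrow> g \<in> carrier FA \<Longrightarrow> f - g \<in> RI \<Longrightarrow> std_cls h f = std_cls h g"
  using RI_low_ideal[OF RI_left[OF F_E[OF h]], of "f - g" h] by (simp add: std_cls_eq_iff)

lemma DM_hcomp:
  "hcomp DM j = {std_cls h g | f g. f \<in> carrier FA \<and> g \<in> carrier FA \<and> f - E h * g \<in> RI \<and>
     (\<forall>w \<in> Poly_Mapping.keys f. int (word_degree w) = j)}"
proof -
  have eq: "arc_hcomp m n j \<inter> proj_cls h = {cls (E h * g) | f g. f \<in> carrier FA \<and> g \<in> carrier FA \<and>
      f - E h * g \<in> RI \<and> (\<forall>w \<in> Poly_Mapping.keys f. int (word_degree w) = j)}" (is "?L = ?R")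
  proof (intro equalityI subsetI)
    fix x assume "x \<in> ?L"
    then obtain f g where "x = cls f" "f \<in> carrier FA" "\<forall>w \<in> Poly_Mapping.keys f. int (word_degree w) = j"
      "x = cls (E h * g)" "g \<in> carrier FA"
      unfolding arc_hcomp_def proj_cls_def cls_def by blast
    then show "x \<in> ?R" using cls_eq_iff by blast
  next
    fix x assume "x \<in> ?R"
    then obtain f g where fg: "x = cls (E h * g)" "f \<in> carrier FA" "g \<in> carrier FA" "f - E h * g \<in> RI"
      "\<forall>w \<in> Poly_Mapping.keys f. int (word_degree w) = j" by blast
    then have "x = cls f" using cls_eq_iff by metis
    then show "x \<in> ?L" using fg unfolding arc_hcomp_def proj_cls_def cls_def by blast
  qed
  show ?thesis unfolding DM_eq quotient_hcomp PM_ops eq std_cls_def by blast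
qed

end

end

section \<open>The head of the Specht module\<close>

definition homogeneous :: "int \<Rightarrow> 'k::field free_elem \<Rightarrow> bool" where
  "homogeneous j f \<longleftrightarrow> (\<forall>w \<in> Poly_Mapping.keys f. int (word_degree w) = j)"

lemma homogeneous_mult:
  assumes "homogeneous i f" "homogeneous j g"
  shows "homogeneous (i + j) (f * g)"
  unfolding homogeneous_def
proof
  fix w assume "w \<in> Poly_Mapping.keys (f * g)"
  then obtain u v where "u \<in> Poly_Mapping.keys f" "v \<in> Poly_Mapping.keys g" "w = u + v"
    using keys_mult[of f g] by blast
  then show "int (word_degree w) = i + j"
    using assms by (auto simp: homogeneous_def word_degree_def plus_free_monoid_def)
qed

lemma homogeneous_single: "int (word_degree w) = j \<Longrightarrow> homogeneous j (Poly_Mapping.single w c)"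
  by (auto simp: homogeneous_def split: if_splits)

context arc_rectangle begin

lemma homogeneous_arrows: "hs \<noteq> [] \<Longrightarrow> homogeneous (int (length hs) - 1) (arrows hs)"
proof (induction hs rule: arrows.induct)
  case (1 g h hs)
  have "homogeneous 1 (D g h)"
    unfolding D_def arr_def
    by (auto intro!: homogeneous_single simp: word_degree_def generator_degree_def) (simp add: homogeneous_def)
  moreover have "homogeneous (int (length (h # hs)) - 1) (arrows (h # hs))" using 1 by simp
  ultimately show ?case using homogeneous_mult[of 1 "D g h"] by fastforce
next
  case ("2_2" v)
  have "homogeneous 0 (Poly_Mapping.single 0 (1::'k))"
    by (rule homogeneous_single) (simp add: word_degree_def zero_free_monoid_def)
  then show ?case by simp
qed simp

lemma transition_E_left:
  "tr (shape h) \<mu> (E h * f) = tr (shape h) \<mu> f"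
  by (induction f rule: poly_mapping_additive_induct)
    (simp_all add: E_def idem_def mult_single transition_single plus_free_monoid_def distrib_left transition_add)

definition regular_idem :: "'k free_elem" where
  "regular_idem = (\<Sum>\<kappa> \<in> Rmn m n. idem \<kappa>)"

lemma Rmn_subset: "Rmn m n \<subseteq> Pmn m n" by (auto simp: Rmn_def)

lemma F_regular_idem [simp, intro]: "regular_idem \<in> carrier FA"
  unfolding regular_idem_def using Rmn_subset by (intro F_sum) auto

lemma arc_e_eq: "arc_e m n = cls regular_idem"
  by (simp add: arc_e_def cls_def regular_idem_def)

lemma regular_idem_E:
  assumes "g \<in> LP" "shape g \<in> Rmn m n"
  shows "E g * regular_idem - E g \<in> RI" "regular_idem * E g - E g \<in> RI"
  using idem_mult_sum[OF Rmn_subset assms(1)] assms(2) unfolding regular_idem_def by simp_all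

lemma regular_idem_idem: "regular_idem * regular_idem - regular_idem \<in> RI"
proof -
  have "(\<Sum>\<kappa>\<in>Rmn m n. idem \<kappa> * regular_idem - idem \<kappa>) \<in> RI"
  proof (rule RI_sum)
    fix \<kappa> assume \<kappa>: "\<kappa> \<in> Rmn m n"
    then obtain g where "g \<in> LP" "\<kappa> = shape g" using Rmn_subset Pmn_obtain by blast
    then show "idem \<kappa> * regular_idem - idem \<kappa> \<in> RI" using regular_idem_E(1)[of g] \<kappa> by (simp add: E_def)
  qed
  then show ?thesis
    unfolding sum_subtractf sum_distrib_right[symmetric] regular_idem_def[symmetric] .
qed

abbreviation HA :: "'k arc_elem ring" where "HA \<equiv> H_algebra m n"

lemma HA_carrier: "carrier HA = (\<lambda>f. cls (regular_idem * f * regular_idem)) ` carrier FA"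
proof -
  have "carrier HA = {cls regular_idem \<otimes>\<^bsub>KA\<^esub> x \<otimes>\<^bsub>KA\<^esub> cls regular_idem | x. x \<in> carrier KA}"
    by (simp add: H_algebra_def corner_def arc_e_eq)
  also have "\<dots> = (\<lambda>f. cls regular_idem \<otimes>\<^bsub>KA\<^esub> cls f \<otimes>\<^bsub>KA\<^esub> cls regular_idem) ` carrier FA"
    unfolding KA_carrier by blast
  also have "\<dots> = (\<lambda>f. cls (regular_idem * f * regular_idem)) ` carrier FA"
    by (intro image_cong) (simp_all add: cls_mult)
  finally show ?thesis .
qed

lemma HA_subset: "carrier HA \<subseteq> carrier KA"
  unfolding HA_carrier KA_carrier by auto

text \<open>
  The one-dimensional representation given by the state of the partition \<open>r\<close>; for regular \<open>r\<close> it is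
  multiplicative, as no lift leaves this state.
\<close>

definition character :: "(int \<Rightarrow> int) \<Rightarrow> 'k arc_elem \<Rightarrow> 'k" where
  "character r X = (THE c. \<exists>f \<in> carrier FA. X = cls f \<and> c = tr (shape r) (shape r) f)"

lemma character_cls:
  assumes "r \<in> LP" "f \<in> carrier FA"
  shows "character r (cls f) = tr (shape r) (shape r) f"
  unfolding character_def
proof (rule the_equality)
  fix c assume "\<exists>g \<in> carrier FA. cls f = cls g \<and> c = tr (shape r) (shape r) g"
  then obtain g where "cls f = cls g" and c: "c = tr (shape r) (shape r) g" by blast
  then have "f - g \<in> RI" by (simp only: cls_eq_iff)
  from transition_RI[OF this shape_Pmn[OF assms(1)]]
  show "c = tr (shape r) (shape r) f" using c by (simp add: transition_diff)
qed (use assms in blast)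

end

text \<open>
  In this locale \<open>k\<close> is minus the defect of the partition of \<open>h\<close>, \<open>r\<close> is the path of its
  regularisation, and \<open>V\<close> is the product of the arrows that lead from \<open>h\<close> to \<open>r\<close>.
\<close>

locale regularisation = arc_rectangle m n ground_field
  for m n :: nat and ground_field :: "'k::field itself" +
  fixes h :: "int \<Rightarrow> int" and a b :: int
  assumes h: "h \<in> LP" and lowest: "lowest_arc h a b"
begin

definition k :: nat where "k = nat (int m + 1 - h a)"
definition r :: "int \<Rightarrow> int" where "r = reg_chain h k"
definition V :: "'k free_elem" where "V = reg_arrows h k"
abbreviation T :: "'k free_elem \<Rightarrow> 'k" where "T \<equiv> tr (shape r) (shape r)"

lemma hk: "h a + int k = int m + 1"
proof -
  obtain a' b' where "lowest_arc h a' b'" "h a' \<le> int m + 1" using lowest_arc_exists[OF h] by blast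
  then have "h a \<le> int m + 1" using lowest_arc_unique[OF lowest] by metis
  then show ?thesis by (simp add: k_def)
qed

lemma r_lowest: obtains A B where "r \<in> LP" "lowest_arc r A B" "r A = int m + 1"
proof -
  have "h a + int k \<le> int m + 1" using hk by simp
  from reg_chain_lowest[OF h lowest m_le_n this] show thesis
    using that hk unfolding r_def by metis
qed

lemma r: "r \<in> LP" and r_ge: "int m + 1 \<le> r x"
  using r_lowest lowest_arcD(2) by metis+

lemma r_Rmn: "shape r \<in> Rmn m n"
  unfolding Rmn_shape[OF r] using r_ge by blast

lemma reg_eq: "reg m n (shape h) = shape r"
proof -
  have "nat (- defect m (shape h)) = k"
    unfolding defect_shape[OF h lowest] using hk by simp
  then show ?thesis
    using reg_iter_shape[OF h lowest m_le_n, of k] hk by (simp add: reg_def r_def)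
qed

lemma defect_h: "defect m (shape h) = - int k"
  unfolding defect_shape[OF h lowest] using hk by simp

lemma defect_r: "defect m (shape r) = 0"
proof -
  obtain A B where "lowest_arc r A B" "r A = int m + 1" by (rule r_lowest)
  then show ?thesis using defect_shape[OF r] by simp
qed

lemma r_final: "(shape r, \<mu>) \<notin> lifts"
proof
  assume "(shape r, \<mu>) \<in> lifts"
  then show False
  proof (rule liftsE)
    fix g c d assume "shape r = shape g" "g \<in> LP" "g c \<le> int m"
    then show False using shape_eq_iff[OF r, of g] r_ge[of c] by simp
  qed
qed

lemma T_mult: "T (f * g) = T f * T g"
  using transition_mult_in[of "{shape r}" "shape r" "shape r" f g]
    shape_Pmn[OF r] r_final by auto

lemma T_E: "T (E r) = 1"
  by (simp add: E_def idem_def transition_single)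

lemma T_scalar: "T (scalar c) = c"
  by (simp add: transition_single zero_free_monoid_def)

lemma T_RI: "f \<in> RI \<Longrightarrow> T f = 0"
  using transition_RI shape_Pmn[OF r] by blast

lemma T_regular_idem: "T regular_idem = 1"
  using T_RI[OF regular_idem_E(1)[OF r r_Rmn]] by (simp add: transition_diff T_mult T_E)

lemma T_long_path:
  assumes "f \<in> rspan (loops r)"
  shows "T f = 0"
  using assms
proof (induction rule: rspan_induct)
  case (base f)
  then obtain hs where hs: "f = path hs" "hd hs = r" "2 \<le> length hs" unfolding loops_def by blast
  then obtain u us where "hs = r # u # us" by (cases hs; cases "tl hs") auto
  moreover have "T (D r u) = 0" using r_final by (auto simp: D_def arr_def transition_single)
  ultimately show ?case using hs(1) by (simp add: path_def T_mult)
qed (simp_all add: T_RI transition_add transition_scale)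

text \<open>
  The word \<open>V\<close> is accepted from the state of \<open>h\<close> and leads to the state of \<open>r\<close>. With the vanishing of the
  automaton on relations this shows that \<open>V\<close> is not zero in the standard module.
\<close>

lemma transition_V: "tr (shape h) \<nu> V = (if \<nu> = shape r then 1 else 0)"
proof -
  have "tr (shape h) \<nu> (reg_arrows h i) = (if \<nu> = shape (reg_chain h i) then 1 else 0)"
    if "h a + int i \<le> int m + 1" for i \<nu>
    using that
  proof (induction i arbitrary: \<nu>)
    case 0
    have "tr (shape h) \<nu> (Poly_Mapping.single 0 (1::'k)) = (if \<nu> = shape h then 1 else 0)"
      by (simp add: transition_single zero_free_monoid_def eq_commute del: single_one)
    then show ?case by (simp add: reg_arrows_def reg_chain_def)
  next
    case (Suc i)
    then have i: "h a + int i \<le> int m + 1" by simp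
    obtain A B where *: "reg_chain h i \<in> LP" "lowest_arc (reg_chain h i) A B" "reg_chain h i A = h a + int i"
      by (rule reg_chain_lowest[OF h lowest m_le_n i])
    have M: "reg_chain h i A \<le> int m" using Suc.prems *(3) by simp
    let ?g = "reg_chain h i" and ?g' = "reg_chain h (Suc i)"
    have eq: "?g' = lift ?g A B" using lowest_lift_eq[OF *(2)] by (simp add: reg_chain_def)
    have add: "addable_at ?g A B" "?g' \<in> LP" using lowest_arc_addable[OF *(1,2) M m_le_n] eq by simp_all
    have up: "up_step ?g ?g'" unfolding up_step_def using *(1) add eq by blast
    have lk: "linked m n (shape ?g) (shape ?g')" using linked_shape[OF *(1) add(2)] up by simp
    have lf: "(shape ?g, shape ?g') \<in> lifts" unfolding lifts_def eq using *(1,2) M by blast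
    have D: "tr (shape ?g) \<nu> (D ?g ?g') = (if \<nu> = shape ?g' then 1 else 0)"
      using lk lf by (auto simp: D_def arr_def transition_single)
    have "tr (shape h) \<nu> (reg_arrows h (Suc i)) =
        (\<Sum>\<rho>\<in>Pmn m n. tr (shape h) \<rho> (reg_arrows h i) * tr \<rho> \<nu> (D ?g ?g'))"
      unfolding reg_arrows_Suc
      by (rule transition_mult_in[OF subset_refl shape_Pmn[OF h]]) (use lifts_Pmn in blast)
    also have "\<dots> = (\<Sum>\<rho>\<in>Pmn m n. if \<rho> = shape ?g then tr \<rho> \<nu> (D ?g ?g') else 0)"
      unfolding Suc.IH[OF i] by (intro sum.cong) auto
    also have "\<dots> = tr (shape ?g) \<nu> (D ?g ?g')"
      using finite_Pmn shape_Pmn[OF *(1)] by (simp add: sum.delta)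
    finally show ?case unfolding D .
  qed
  then show ?thesis using hk by (simp add: V_def r_def)
qed

lemma transition_V_mult: "tr (shape h) (shape r) (V * x) = T x"
proof -
  have "tr (shape h) (shape r) (V * x) =
      (\<Sum>\<rho>\<in>Pmn m n. tr (shape h) \<rho> V * tr \<rho> (shape r) x)"
    by (rule transition_mult_in[OF subset_refl shape_Pmn[OF h]]) (use lifts_Pmn in blast)
  also have "\<dots> = (\<Sum>\<rho>\<in>Pmn m n. if \<rho> = shape r then tr \<rho> (shape r) x else 0)"
    unfolding transition_V by (intro sum.cong) auto
  also have "\<dots> = T x" using finite_Pmn shape_Pmn[OF r] by (simp add: sum.delta)
  finally show ?thesis .
qed

text \<open>
  The matrix coefficient from \<open>h\<close> to \<open>r\<close> as a functional on the standard module. On the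
  Specht module its kernel turns out to be the only maximal submodule.
\<close>

definition psi :: "'k arc_elem set \<Rightarrow> 'k" where
  "psi X = (THE c. \<exists>f \<in> carrier FA. X = std_cls h f \<and> c = tr (shape h) (shape r) f)"

lemma psi_std_cls:
  assumes "f \<in> carrier FA"
  shows "psi (std_cls h f) = tr (shape h) (shape r) f"
  unfolding psi_def
proof (rule the_equality)
  fix c assume "\<exists>g \<in> carrier FA. std_cls h f = std_cls h g \<and> c = tr (shape h) (shape r) g"
  then obtain g where g: "g \<in> carrier FA" "std_cls h f = std_cls h g"
    and c: "c = tr (shape h) (shape r) g" by blast
  then have "E h * (f - g) \<in> low_ideal h" using std_cls_eq_iff[OF h assms g(1)] by blast
  then have "tr (shape h) (shape r) (E h * (f - g)) = 0"
    by (rule low_ideal_vanishing[OF _ shape_Pmn[OF h]]) simp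
  then show "c = tr (shape h) (shape r) f"
    using c by (simp add: transition_E_left transition_diff)
qed (use assms in blast)

lemma F_V [simp, intro]: "V \<in> carrier FA" by (simp add: V_def)

lemma F_Er [simp, intro]: "E r \<in> carrier FA" using r by (rule F_E)

lemma F_Eh [simp, intro]: "E h \<in> carrier FA" using h by (rule F_E)

definition vs :: "(int \<Rightarrow> int) list" where "vs = map (reg_chain h) [0..<Suc k]"

lemma vs: "vs \<noteq> []" "set vs \<subseteq> LP" "hd vs = h" "last vs = r" "path vs = E h * V" "length vs = Suc k"
proof -
  show "vs \<noteq> []" "last vs = r" "length vs = Suc k" by (simp_all add: vs_def r_def)
  show hd: "hd vs = h" by (simp add: vs_def hd_map reg_chain_def del: upt_Suc)
  show "path vs = E h * V" unfolding path_def hd by (simp add: V_def reg_arrows_def vs_def)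
  show "set vs \<subseteq> LP"
  proof
    fix g assume "g \<in> set vs"
    then obtain i where i: "i \<le> k" "g = reg_chain h i" by (auto simp: vs_def less_Suc_eq_le simp del: upt_Suc)
    then have "h a + int i \<le> int m + 1" using hk by simp
    then show "g \<in> LP" unfolding i(2) by (rule reg_chain_lowest[OF h lowest m_le_n])
  qed
qed

lemma V_Er: assumes "x \<in> carrier FA" shows "std_cls h (V * E r * x) = std_cls h (V * x)"
proof -
  have "(path vs * E r - path vs) * x \<in> RI"
    using path_E[OF r vs(1,2)] vs(4) assms by (intro RI_right) auto
  then have "E h * (V * E r * x - V * x) \<in> RI"
    unfolding vs(5) by (simp add: algebra_simps)
  then show ?thesis using assms by (subst std_cls_eq_iff[OF h]) (auto intro: RI_low_ideal)
qed

text \<open>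
  The generator \<open>V\<close> is recovered from every multiple on which the functional does not vanish: between
  the idempotents of \<open>r\<close> the element \<open>x\<close> is a multiple of the idempotent plus loops, and the functional
  picks out the coefficient of the idempotent.
\<close>

lemma recover_generator:
  assumes x: "x \<in> carrier FA" and Tx: "T x \<noteq> 0"
  shows "\<exists>y \<in> carrier FA. std_cls h (V * x * (E r * y * E r)) = std_cls h V"
proof -
  obtain c where c: "E r * x * E r - scalar c * E r \<in>
      rspan (loops r)"
    using loop_decomposition[OF x r] by blast
  have "T x = c" using T_long_path[OF c] by (simp add: transition_diff T_mult T_E T_scalar)
  then have c0: "c \<noteq> 0" using Tx by simp
  have F: "E r * x * E r \<in> carrier FA" using x by auto
  obtain y where y: "y \<in> carrier FA" "path vs * (E r * x * E r) * y - path vs \<in> rspan (low h)"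
    using local_inverse[OF vs(1,2) vs(4)[symmetric] c F c0] unfolding vs(3) by blast
  have "(path vs * (E r * x * E r) * y - path vs) * E r \<in> low_ideal h"
    by (intro low_ideal_right rspan_low_ideal[OF h y(2)] F_Er)
  moreover have "path vs * E r - path vs \<in> low_ideal h"
    using path_E[OF r vs(1,2)] vs(4) by (intro RI_low_ideal) simp
  ultimately have "(path vs * (E r * x * E r) * y - path vs) * E r + (path vs * E r - path vs) \<in> low_ideal h"
    by (rule low_ideal_add)
  then have "E h * (V * E r * (x * (E r * y * E r)) - V) \<in> low_ideal h"
    unfolding vs(5) by (simp add: algebra_simps)
  then have "std_cls h (V * E r * (x * (E r * y * E r))) = std_cls h V"
    using x y(1) by (subst std_cls_eq_iff[OF h]) auto
  then have "std_cls h (V * x * (E r * y * E r)) = std_cls h V"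
    using V_Er[of "x * (E r * y * E r)"] x y(1) by (simp add: mult.assoc)
  then show ?thesis using y(1) by blast
qed

text \<open>
  The functional sees only words of degree \<open>k\<close>; in this degree it takes all values on the multiples of
  \<open>V\<close>.
\<close>

lemma psi_hcomp:
  assumes C: "C \<subseteq> carrier (DM h)" "std_cls h 0 \<in> C" "\<And>c. std_cls h (scalar c * V) \<in> C"
  shows "psi ` (hcomp (DM h) j \<inter> C) = (if j = int k then UNIV else {0})"
proof -
  have sub: "psi X = 0" if X: "X \<in> hcomp (DM h) j" and j: "j \<noteq> int k" for X
  proof -
    obtain f g where fg: "X = std_cls h g" "g \<in> carrier FA" "f - E h * g \<in> RI"
      "\<forall>w \<in> Poly_Mapping.keys f. int (word_degree w) = j"
      using X unfolding DM_hcomp[OF h] by blast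
    have "tr (shape h) (shape r) f = 0"
      by (rule transition_homogeneous[OF fg(4)]) (use j in \<open>simp add: defect_h defect_r\<close>)
    moreover have "tr (shape h) (shape r) (f - E h * g) = 0"
      by (rule transition_RI[OF fg(3) shape_Pmn[OF h]])
    ultimately show ?thesis
      unfolding fg(1) psi_std_cls[OF fg(2)] by (simp add: transition_diff transition_E_left)
  qed
  show ?thesis
  proof (cases "j = int k")
    case False
    have "std_cls h 0 \<in> hcomp (DM h) j"
      unfolding DM_hcomp[OF h] by (intro CollectI exI[of _ 0]) simp
    then have "0 \<in> psi ` (hcomp (DM h) j \<inter> C)"
      using C(2) sub[OF _ False] by (metis IntI image_eqI)
    then show ?thesis using False sub by auto
  next
    case True
    have "c \<in> psi ` (hcomp (DM h) j \<inter> C)" for c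
    proof (rule image_eqI[of _ _ "std_cls h (scalar c * V)"])
      have "tr (shape h) (shape r) (scalar c * V) = c"
        by (simp add: transition_scale transition_V)
      then show "c = psi (std_cls h (scalar c * V))" by (subst psi_std_cls) auto
      have "homogeneous 0 (E h)" unfolding E_def idem_def
        by (rule homogeneous_single) (simp add: word_degree_def generator_degree_def)
      moreover have "homogeneous 0 (scalar c)"
        by (rule homogeneous_single) (simp add: word_degree_def zero_free_monoid_def)
      moreover have "homogeneous (int k) V"
        using homogeneous_arrows[OF vs(1)] vs(6) by (simp add: V_def reg_arrows_def vs_def)
      ultimately have "homogeneous (int k) (E h * (scalar c * V))"
        using homogeneous_mult[of 0 "E h" "int k" "scalar c * V"] homogeneous_mult[of 0 "scalar c" "int k" V] by simp
      then have "std_cls h (scalar c * V) \<in> hcomp (DM h) j"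
        unfolding DM_hcomp[OF h] homogeneous_def True
        by (intro CollectI exI[of _ "E h * (scalar c * V)"] exI[of _ "scalar c * V"]) auto
      then show "std_cls h (scalar c * V) \<in> hcomp (DM h) j \<inter> C" using C(3) by blast
    qed
    then show ?thesis using True by auto
  qed
qed

text \<open>
  For \<open>k = 0\<close> the partition is regular, \<open>V\<close> is the unit, and the functional is the character itself.
  This yields the simple module of a regular partition.
\<close>

lemma standard_head_line:
  assumes k0: "k = 0"
  shows "\<exists>\<phi>. line_coordinate KA (L_module m n (shape h)) (character r) 0 \<phi>"
proof -
  have rh: "r = h" by (simp add: r_def k0 reg_chain_def)
  have V1: "V = 1" by (simp add: V_def k0 reg_arrows_def)
  have psi: "psi (std_cls h f) = T f" if "f \<in> carrier FA" for f using psi_std_cls[OF that] by (simp add: rh)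
  have hc: "hcomp (DM h) j \<subseteq> carrier (DM h)" for j
    unfolding DM_hcomp[OF h] DM_carrier[OF h] by blast
  show ?thesis
    unfolding L_module_def
  proof (rule head_line_module[where \<psi> = psi, OF right_action_DM[OF h]])
    fix X Y assume "X \<in> carrier (DM h)" "Y \<in> carrier (DM h)"
    then obtain f g where fg: "f \<in> carrier FA" "g \<in> carrier FA" "X = std_cls h f" "Y = std_cls h g"
      unfolding DM_carrier[OF h] by blast
    then show "psi (X \<oplus>\<^bsub>DM h\<^esub> Y) = psi X + psi Y"
      by (simp add: std_cls_add[OF h] psi transition_add)
  next
    fix X y assume "X \<in> carrier (DM h)" "y \<in> carrier KA"
    then obtain f g where fg: "f \<in> carrier FA" "g \<in> carrier FA" "X = std_cls h f" "y = cls g"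
      unfolding DM_carrier[OF h] KA_carrier by blast
    then show "psi (ract (DM h) X y) = psi X * character r y"
      by (simp add: std_cls_ract[OF h] psi character_cls[OF r] T_mult)
  next
    have "c \<in> psi ` carrier (DM h)" for c
      unfolding DM_carrier[OF h] image_image
      by (rule image_eqI[of _ _ "scalar c"]) (simp_all add: psi T_scalar)
    then show "psi ` carrier (DM h) = UNIV" by blast
  next
    fix N X assume N: "right_submodule KA (DM h) N" and X: "X \<in> N" "psi X \<noteq> 0"
    have sub: "N \<subseteq> carrier (DM h)"
      using N additive_subgroup.a_subset unfolding right_submodule_def by blast
    then obtain f where f: "f \<in> carrier FA" "X = std_cls h f" using X(1) unfolding DM_carrier[OF h] by blast
    then have "T f \<noteq> 0" using X(2) psi by simp
    then obtain y where y: "y \<in> carrier FA" "std_cls h (V * f * (E r * y * E r)) = std_cls h V"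
      using recover_generator[OF f(1)] by blast
    have act: "ract (DM h) Y (cls g) \<in> N" if "Y \<in> N" "g \<in> carrier FA" for Y g
      using N that unfolding right_submodule_def KA_carrier by blast
    have "ract (DM h) X (cls (E r * y * E r)) = std_cls h 1"
      using y f by (simp add: std_cls_ract[OF h] V1)
    then have one: "std_cls h 1 \<in> N" using act[OF X(1), of "E r * y * E r"] y(1) by simp
    have "std_cls h g \<in> N" if "g \<in> carrier FA" for g
      using act[OF one that] that by (simp add: std_cls_ract[OF h])
    then show "N = carrier (DM h)" using sub unfolding DM_carrier[OF h] by blast
  next
    fix j show "hcomp (DM h) j \<subseteq> carrier (DM h)" by (rule hc)
    have "std_cls h 0 \<in> carrier (DM h)" "std_cls h (scalar c * V) \<in> carrier (DM h)" for c
      unfolding DM_carrier[OF h] by auto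
    from psi_hcomp[OF subset_refl this, of j]
    show "psi ` hcomp (DM h) j = (if j = 0 then UNIV else {0})"
      using hc[of j] by (simp add: Int_absorb2 k0)
  qed
qed

abbreviation SM where "SM \<equiv> (Specht_module m n (shape h) :: ('k arc_elem, 'k arc_elem set) graded_module)"

definition specht_carrier :: "'k arc_elem set set" where
  "specht_carrier = (\<lambda>f. std_cls h (f * regular_idem)) ` carrier FA"

lemma SM_eq: "SM = restrict_module (DM h) specht_carrier"
proof -
  have "{ract (DM h) X (arc_e m n) | X. X \<in> carrier (DM h)} = (\<lambda>f. ract (DM h) (std_cls h f) (cls regular_idem)) ` carrier FA"
    unfolding DM_carrier[OF h] arc_e_eq by blast
  also have "\<dots> = specht_carrier"
    unfolding specht_carrier_def by (intro image_cong) (simp_all add: std_cls_ract[OF h])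
  finally show ?thesis by (simp add: Specht_module_def corner_module_def)
qed

lemma specht_carrier_subset: "specht_carrier \<subseteq> carrier (DM h)"
  unfolding specht_carrier_def DM_carrier[OF h] by auto

lemma SM_ops: "carrier SM = specht_carrier" "add SM = add (DM h)" "ract SM = ract (DM h)"
  "hcomp SM j = hcomp (DM h) j \<inter> specht_carrier"
  by (simp_all add: SM_eq restrict_module_def)

text \<open>
  The Specht module is generated by \<open>V\<close>: its elements are combinations of paths that end in regular
  partitions, and these factor through the regularisation.
\<close>

lemma specht_carrier_generated:
  assumes "X \<in> specht_carrier"
  obtains x where "x \<in> carrier FA" "X = std_cls h (V * (x * regular_idem))"
proof -
  obtain f where f: "f \<in> carrier FA" "X = std_cls h (f * regular_idem)" using assms unfolding specht_carrier_def by blast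
  let ?B = "{E h * V * x | x. x \<in> carrier FA} \<union> low h"
  have "E h * f * idem \<kappa> \<in> rspan ?B" if \<kappa>: "\<kappa> \<in> Rmn m n" for \<kappa>
  proof -
    obtain g where g: "g \<in> LP" "\<kappa> = shape g" using \<kappa> Rmn_subset Pmn_obtain by blast
    then have "int m + 1 \<le> g x" for x using Rmn_shape[OF g(1)] \<kappa> by blast
    then show ?thesis
      using generation[OF h lowest m_le_n _ g(1) _ f(1), of k] hk unfolding V_def g(2) E_def by simp
  qed
  then have "(\<Sum>\<kappa>\<in>Rmn m n. E h * f * idem \<kappa>) \<in> rspan ?B" by (rule rspan_sum)
  then have span: "E h * f * regular_idem \<in> rspan ?B" unfolding regular_idem_def by (simp add: sum_distrib_left)
  have "\<exists>x \<in> carrier FA. y - E h * V * x \<in> low_ideal h" if "y \<in> rspan ?B" for y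
    using that
  proof (induction rule: rspan_induct)
    case (rel y)
    then show ?case by (intro bexI[of _ 0]) (auto intro: RI_low_ideal)
  next
    case (base y)
    then show ?case
    proof
      assume "y \<in> {E h * V * x | x. x \<in> carrier FA}"
      then obtain x where "y = E h * V * x" "x \<in> carrier FA" by blast
      then show ?thesis by (intro bexI[of _ x]) (auto intro: RI_low_ideal)
    next
      assume "y \<in> low h"
      then show ?thesis using rspan_low_ideal[OF h rspan_base] by (intro bexI[of _ 0]) auto
    qed
  next
    case zero
    show ?case by (intro bexI[of _ 0]) (auto intro: RI_low_ideal)
  next
    case (add y z)
    then obtain x x' where *: "x \<in> carrier FA" "x' \<in> carrier FA" "y - E h * V * x \<in> low_ideal h"
      "z - E h * V * x' \<in> low_ideal h" by blast
    have "(y - E h * V * x) + (z - E h * V * x') \<in> low_ideal h" by (rule low_ideal_add[OF *(3,4)])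
    then show ?case using *(1,2) by (intro bexI[of _ "x + x'"]) (auto simp: algebra_simps)
  next
    case (scale c y)
    then obtain x where *: "x \<in> carrier FA" "y - E h * V * x \<in> low_ideal h" by blast
    have "scalar c * (E h * V * x) = scalar c * (E h * V) * x" by (simp only: mult.assoc)
    also have "\<dots> = E h * V * scalar c * x" unfolding scalar_commute[of c "E h * V"] ..
    also have "\<dots> = E h * V * (scalar c * x)" by (simp only: mult.assoc)
    finally have "scalar c * y - E h * V * (scalar c * x) = scalar c * (y - E h * V * x)"
      by (simp add: right_diff_distrib)
    then show ?case using * low_ideal_left[OF F_scalar *(2), of c] by (intro bexI[of _ "scalar c * x"]) auto
  qed
  from this[OF span] obtain x where x: "x \<in> carrier FA" "E h * f * regular_idem - E h * V * x \<in> low_ideal h" by blast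
  have "(E h * f * regular_idem - E h * V * x) * regular_idem \<in> low_ideal h"
    by (intro low_ideal_right x(2) F_regular_idem)
  moreover have "(E h * f) * (regular_idem * regular_idem - regular_idem) \<in> low_ideal h"
    using f(1) regular_idem_idem by (intro RI_low_ideal RI_left) auto
  ultimately have "(E h * f * regular_idem - E h * V * x) * regular_idem -
      (E h * f) * (regular_idem * regular_idem - regular_idem) \<in> low_ideal h" by (rule low_ideal_diff)
  then have "E h * (f * regular_idem - V * (x * regular_idem)) \<in> low_ideal h"
    by (simp add: algebra_simps)
  then have "X = std_cls h (V * (x * regular_idem))"
    unfolding f(2) using f(1) x(1) by (subst std_cls_eq_iff[OF h]) auto
  then show thesis using that x(1) by blast
qed

lemma right_action_SM: "right_action HA SM"
  unfolding SM_eq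
proof (rule right_action_restrict[OF right_action_DM[OF h] HA_subset])
  interpret DM: abelian_group "DM h" by (rule right_action_group[OF right_action_DM[OF h]])
  have zero: "\<zero>\<^bsub>DM h\<^esub> = std_cls h 0"
  proof -
    have c: "std_cls h 0 \<in> carrier (DM h)" unfolding DM_carrier[OF h] by auto
    have "std_cls h 0 \<oplus>\<^bsub>DM h\<^esub> std_cls h 0 = std_cls h 0" by (simp add: std_cls_add[OF h])
    then show ?thesis using c DM.add.r_cancel_one' by metis
  qed
  have "additive_subgroup specht_carrier (DM h)"
  proof (rule additive_subgroup_of_closed[OF DM.abelian_group_axioms specht_carrier_subset])
    show "\<zero>\<^bsub>DM h\<^esub> \<in> specht_carrier"
      unfolding zero specht_carrier_def by (rule image_eqI[of _ _ 0]) simp_all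
  next
    fix X Y assume "X \<in> specht_carrier" "Y \<in> specht_carrier"
    then obtain f g where "f \<in> carrier FA" "g \<in> carrier FA" "X = std_cls h (f * regular_idem)" "Y = std_cls h (g * regular_idem)"
      unfolding specht_carrier_def by blast
    then show "X \<oplus>\<^bsub>DM h\<^esub> Y \<in> specht_carrier"
      unfolding specht_carrier_def by (intro image_eqI[of _ _ "f + g"]) (simp_all add: std_cls_add[OF h] distrib_right)
  next
    fix X assume "X \<in> specht_carrier"
    then obtain f where f: "f \<in> carrier FA" "X = std_cls h (f * regular_idem)" unfolding specht_carrier_def by blast
    then have "std_cls h ((- f) * regular_idem) \<oplus>\<^bsub>DM h\<^esub> X = std_cls h ((- f) * regular_idem + f * regular_idem)"
      by (simp only: std_cls_add[OF h] F_mult F_uminus F_regular_idem)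
    then have "std_cls h ((- f) * regular_idem) \<oplus>\<^bsub>DM h\<^esub> X = \<zero>\<^bsub>DM h\<^esub>" unfolding zero by simp
    moreover have "std_cls h ((- f) * regular_idem) \<in> specht_carrier" unfolding specht_carrier_def using f(1) by blast
    ultimately show "\<exists>Y\<in>specht_carrier. Y \<oplus>\<^bsub>DM h\<^esub> X = \<zero>\<^bsub>DM h\<^esub>" by blast
  qed
  moreover have "ract (DM h) X y \<in> specht_carrier" if X: "X \<in> specht_carrier" and y: "y \<in> carrier HA" for X y
  proof -
    obtain f g where "f \<in> carrier FA" "g \<in> carrier FA" "X = std_cls h (f * regular_idem)"
      "y = cls (regular_idem * g * regular_idem)"
      using X y unfolding specht_carrier_def HA_carrier by blast
    then show ?thesis
      unfolding specht_carrier_def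
      by (intro image_eqI[of _ _ "f * regular_idem * (regular_idem * g)"]) (simp_all add: std_cls_ract[OF h] mult.assoc)
  qed
  ultimately show "right_submodule HA (DM h) specht_carrier" by (simp add: right_submodule_def)
qed

text \<open>
  As \<open>V\<close> ends at the regular partition of \<open>r\<close>, acting on it by elements of the algebra and by their
  truncations in the corner algebra gives the same.
\<close>

lemma std_cls_V_regular: assumes "c \<in> carrier FA"
  shows "std_cls h (V * (regular_idem * (E r * c))) = std_cls h (V * c)"
proof -
  have "V * ((regular_idem * E r - E r) * c) \<in> RI"
    using regular_idem_E(2)[OF r r_Rmn] assms by (intro RI_left RI_right) auto
  then have "V * (regular_idem * (E r * c)) - V * E r * c \<in> RI"
    by (simp add: algebra_simps)
  then have "std_cls h (V * (regular_idem * (E r * c))) = std_cls h (V * E r * c)"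
    using assms by (intro std_cls_cong[OF h]) auto
  then show ?thesis using V_Er[OF assms] by simp
qed

lemma scalar_V_specht: "std_cls h (scalar c * V) \<in> specht_carrier"
proof -
  have F: "scalar c * regular_idem \<in> carrier FA" by auto
  have "V * ((E r * regular_idem - E r) * scalar c) \<in> RI"
    using regular_idem_E(1)[OF r r_Rmn] by (intro RI_left RI_right) auto
  then have "V * E r * (regular_idem * scalar c) - V * E r * scalar c \<in> RI" by (simp add: algebra_simps)
  then have "std_cls h (V * E r * (regular_idem * scalar c)) = std_cls h (V * E r * scalar c)"
    by (intro std_cls_cong[OF h]) auto
  then have "std_cls h (V * (scalar c * regular_idem)) = std_cls h (V * scalar c)"
    using V_Er[of "regular_idem * scalar c"] V_Er[of "scalar c"] scalar_commute[of c regular_idem] by auto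
  then have "std_cls h (scalar c * V) = std_cls h ((V * scalar c) * regular_idem)"
    by (simp add: scalar_commute[of c V] mult.assoc)
  then show ?thesis unfolding specht_carrier_def by (intro image_eqI[of _ _ "V * scalar c"]) auto
qed

lemma specht_head_line:
  "\<exists>\<phi>. line_coordinate HA (module_head HA SM) (character r) (int k) \<phi>"
proof (rule head_line_module[where \<psi> = psi, OF right_action_SM])
  have psiV: "psi (std_cls h (V * x)) = T x" if "x \<in> carrier FA" for x
    using psi_std_cls[of "V * x"] that by (simp add: transition_V_mult)
  {
    fix X Y assume "X \<in> carrier SM" "Y \<in> carrier SM"
    then obtain f g where fg: "f \<in> carrier FA" "g \<in> carrier FA" "X = std_cls h (f * regular_idem)" "Y = std_cls h (g * regular_idem)"
      unfolding SM_ops specht_carrier_def by blast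
    then show "psi (X \<oplus>\<^bsub>SM\<^esub> Y) = psi X + psi Y"
      unfolding SM_ops by (simp add: std_cls_add[OF h] psi_std_cls transition_add)
  next
    fix X y assume X: "X \<in> carrier SM" and y: "y \<in> carrier HA"
    obtain x where x: "x \<in> carrier FA" "X = std_cls h (V * (x * regular_idem))"
      using X unfolding SM_ops by (rule specht_carrier_generated)
    obtain g where g: "g \<in> carrier FA" "y = cls (regular_idem * g * regular_idem)" using y unfolding HA_carrier by blast
    have "ract SM X y = std_cls h (V * (x * regular_idem * (regular_idem * g * regular_idem)))"
      unfolding SM_ops x(2) g(2) using x(1) g(1) by (simp add: std_cls_ract[OF h] mult.assoc)
    then show "psi (ract SM X y) = psi X * character r y"
      using x g by (simp add: psiV character_cls[OF r] T_mult)
  next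
    have "c \<in> psi ` carrier SM" for c
      unfolding SM_ops using psi_std_cls[of "scalar c * V"]
      by (intro image_eqI[OF _ scalar_V_specht[of c]]) (simp add: transition_scale transition_V)
    then show "psi ` carrier SM = UNIV" by blast
  next
    fix N X assume N: "right_submodule HA SM N" and X: "X \<in> N" "psi X \<noteq> 0"
    have sub: "N \<subseteq> specht_carrier"
      using N additive_subgroup.a_subset unfolding right_submodule_def SM_ops(1)[symmetric] by blast
    then obtain x where x: "x \<in> carrier FA" "X = std_cls h (V * (x * regular_idem))"
      using X(1) specht_carrier_generated by blast
    have xe: "x * regular_idem \<in> carrier FA" using x(1) by auto
    have "T (x * regular_idem) \<noteq> 0" using X(2) psiV[OF xe] x(2) by simp
    then obtain y where y: "y \<in> carrier FA" "std_cls h (V * (x * regular_idem) * (E r * y * E r)) = std_cls h V"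
      using recover_generator[OF xe] by blast
    have act: "ract (DM h) Y (cls (regular_idem * g * regular_idem)) \<in> N" if "Y \<in> N" "g \<in> carrier FA" for Y g
      using N that unfolding right_submodule_def HA_carrier SM_ops by blast
    let ?z = "E r * y * E r"
    have zF: "?z \<in> carrier FA" using y(1) by auto
    have "regular_idem * ?z * regular_idem - ?z \<in> RI"
    proof -
      have "(regular_idem * E r - E r) * (y * E r * regular_idem) + E r * y * (E r * regular_idem - E r) \<in> RI"
        using regular_idem_E[OF r r_Rmn] y(1) by (intro RI_add[OF RI_right RI_left]) auto
      then show ?thesis by (simp add: algebra_simps)
    qed
    then have "cls (regular_idem * ?z * regular_idem) = cls ?z" unfolding cls_eq_iff .
    moreover have "ract (DM h) X (cls ?z) = std_cls h V"
      unfolding x(2) using y xe zF by (subst std_cls_ract[OF h]) auto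
    ultimately have V: "std_cls h V \<in> N" using act[OF X(1) zF] by simp
    have "Y \<in> N" if "Y \<in> specht_carrier" for Y
    proof -
      obtain w where w: "w \<in> carrier FA" "Y = std_cls h (V * (w * regular_idem))"
        using \<open>Y \<in> specht_carrier\<close> by (rule specht_carrier_generated)
      have "ract (DM h) (std_cls h V) (cls (regular_idem * (E r * w) * regular_idem)) \<in> N"
        using w(1) by (intro act[OF V]) auto
      moreover have "ract (DM h) (std_cls h V) (cls (regular_idem * (E r * w) * regular_idem)) =
          std_cls h (V * (regular_idem * (E r * (w * regular_idem))))"
        using w(1) by (subst std_cls_ract[OF h]) (auto simp: mult.assoc)
      ultimately show ?thesis using std_cls_V_regular[of "w * regular_idem"] w by auto
    qed
    then show "N = carrier SM" using sub unfolding SM_ops by blast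
  next
    fix j show "hcomp SM j \<subseteq> carrier SM" unfolding SM_ops by blast
    have "std_cls h 0 \<in> specht_carrier" unfolding specht_carrier_def by (rule image_eqI[of _ _ 0]) simp_all
    then show "psi ` hcomp SM j = (if j = int k then UNIV else {0})"
      unfolding SM_ops by (intro psi_hcomp specht_carrier_subset scalar_V_specht)
  }
qed

lemma character_surj: "character r ` carrier HA = UNIV"
proof -
  have "c \<in> character r ` carrier HA" for c
    unfolding HA_carrier image_image
    by (rule image_eqI[of _ _ "scalar c"]) (simp_all add: character_cls[OF r] T_mult T_scalar T_regular_idem)
  then show ?thesis by blast
qed

lemma character_regular_idem: "character r (arc_e m n) = 1"
  unfolding arc_e_eq by (simp add: character_cls[OF r] T_regular_idem)

text \<open>
  The regularisation of \<open>r\<close> is \<open>r\<close> itself, so the case \<open>k = 0\<close> applies to it. Truncation by the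
  idempotent of the regular partitions does not change the line, as the character is one there.
\<close>

lemma simple_head_line:
  "\<exists>\<phi>. line_coordinate HA (D_module m n (shape r)) (character r) 0 \<phi>"
proof -
  obtain A B where AB: "lowest_arc r A B" "r A = int m + 1" by (rule r_lowest)
  interpret r: regularisation m n ground_field r A B
    by unfold_locales (rule r, rule AB(1))
  have k0: "r.k = 0" using AB(2) by (simp add: r.k_def)
  have "r.r = r" by (simp add: r.r_def k0 reg_chain_def)
  then obtain \<phi> where \<phi>: "line_coordinate KA (L_module m n (shape r)) (character r) 0 \<phi>"
    using r.standard_head_line[OF k0] by auto
  have "arc_e m n \<in> carrier KA" unfolding arc_e_eq KA_carrier by blast
  from line_coordinate_corner[where \<chi> = "character r", OF \<phi> this character_regular_idem HA_subset]
  show ?thesis unfolding D_module_def by blast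
qed

theorem specht_head:
  "simple_module HA (module_head HA SM) \<and>
   graded_isomorphic HA (module_head HA SM)
     (shift_module (D_module m n (reg m n (shape h))) (defect m (shape h)))"
proof -
  obtain \<phi> where \<phi>: "line_coordinate HA (module_head HA SM) (character r) (int k) \<phi>"
    using specht_head_line by blast
  obtain \<psi> where "line_coordinate HA (D_module m n (shape r)) (character r) 0 \<psi>"
    using simple_head_line by blast
  from line_coordinate_shift[OF this, of "- int k"]
  have "line_coordinate HA (shift_module (D_module m n (shape r)) (- int k)) (character r) (int k) \<psi>" by simp
  from line_coordinate_isomorphic[OF \<phi> this] line_coordinate_simple[OF \<phi> character_surj]
  show ?thesis unfolding reg_eq defect_h by blast
qed

end

theorem proposition5p13:
  fixes m n :: nat and \<alpha> :: diagram
  assumes "1 \<le> m" and "m \<le> n" and "\<alpha> \<in> Pmn m n"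
  defines "H \<equiv> (H_algebra m n :: 'k::field arc_elem ring)"
  defines "S \<equiv> (Specht_module m n \<alpha> :: ('k arc_elem, 'k arc_elem set) graded_module)"
  shows "simple_module H (module_head H S) \<and>
         graded_isomorphic H (module_head H S)
           (shift_module (D_module m n (reg m n \<alpha>)) (defect m \<alpha>))"
proof -
  interpret rectangle m n .
  obtain g where g: "g \<in> LP" "\<alpha> = shape g" by (rule Pmn_obtain[OF assms(3)])
  obtain a b where ab: "lowest_arc g a b" by (rule lowest_arc_exists[OF g(1)])
  interpret regularisation m n "TYPE('k)" g a b
    by unfold_locales (rule assms(2), rule g(1), rule ab)
  show ?thesis unfolding H_def S_def g(2) by (rule specht_head)
qed

end
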